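(* Let $f,g:\mathbb{C}\to\mathbb{C}$ be non-injective entire maps sharing a bounded periodic Fatou component $D$ (that is, $D$ is a bounded Fatou component of both $f$ and $g$, and is periodic for both $f$ and $g$). Assume that $D$ is an attracting, but not superattracting, Fatou component for $g$. If the semigroup $\langle f,g\rangle$ generated by $f$ and $g$ under composition contains no free non-cyclic subsemigroups, then $f$ and $g$ have the same set of preperiodic points.
   Context: A Fatou component $D$ of $f$ is periodic if $f^p(D)\subseteq D$ for some $p\geq 1$. A periodic Fatou component is attracting but not superattracting if it contains an attracting periodic point whose multiplier is nonzero. A point is preperiodic for a map if its forward orbit is finite. "Free non-cyclic" means free on at least two generators. *)

theory Defs
  imports "HOL-Complex_Analysis.Complex_Analysis"
begin

section \<open>Fatou components of entire maps\<close>

text \<open>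
  Normality is meant in the sense of Montel, as maps into the Riemann sphere: locally uniform
  divergence to infinity is allowed. Splitting the limit into a finite one and the constant
  infinity is the classical form for holomorphic families on a domain, that is, a connected
  open set; \<open>normal_on\<close> is only used for such sets.
\<close>

definition normal_on :: "(complex \<Rightarrow> complex) set \<Rightarrow> complex set \<Rightarrow> bool" where
  "normal_on F U \<longleftrightarrow>
     (\<forall>h :: nat \<Rightarrow> complex \<Rightarrow> complex. range h \<subseteq> F \<longrightarrow>
       (\<exists>r :: nat \<Rightarrow> nat. strict_mono r \<and>
         ((\<exists>l. \<forall>K. compact K \<and> K \<subseteq> U \<longrightarrow> uniform_limit K (h \<circ> r) l sequentially) \<or>
          (\<forall>K. compact K \<and> K \<subseteq> U \<longrightarrow>
             (\<forall>B. \<forall>\<^sub>F n in sequentially. \<forall>z\<in>K. B < norm (h (r n) z))))))"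

definition fatou_set :: "(complex \<Rightarrow> complex) \<Rightarrow> complex set" where
  "fatou_set f =
     {z. \<exists>U. open U \<and> connected U \<and> z \<in> U \<and> normal_on (range (\<lambda>n. f ^^ n)) U}"

definition fatou_component :: "(complex \<Rightarrow> complex) \<Rightarrow> complex set \<Rightarrow> bool" where
  "fatou_component f D \<longleftrightarrow> D \<in> components (fatou_set f)"

definition periodic_fatou_component :: "(complex \<Rightarrow> complex) \<Rightarrow> complex set \<Rightarrow> bool" where
  "periodic_fatou_component f D \<longleftrightarrow>
     fatou_component f D \<and> (\<exists>p\<ge>1. (f ^^ p) ` D \<subseteq> D)"


section \<open>Periodic and preperiodic points\<close>

definition periodic_point :: "('a \<Rightarrow> 'a) \<Rightarrow> 'a \<Rightarrow> bool" where
  "periodic_point f z \<longleftrightarrow> (\<exists>p\<ge>1. (f ^^ p) z = z)"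

text \<open>Only meaningful for periodic points.\<close>

definition exact_period :: "('a \<Rightarrow> 'a) \<Rightarrow> 'a \<Rightarrow> nat" where
  "exact_period f z = (LEAST p. p \<ge> 1 \<and> (f ^^ p) z = z)"

definition multiplier :: "(complex \<Rightarrow> complex) \<Rightarrow> complex \<Rightarrow> complex" where
  "multiplier f z = deriv (f ^^ exact_period f z) z"

definition attracting_periodic_point :: "(complex \<Rightarrow> complex) \<Rightarrow> complex \<Rightarrow> bool" where
  "attracting_periodic_point f z \<longleftrightarrow> periodic_point f z \<and> norm (multiplier f z) < 1"

definition attracting_not_superattracting :: "(complex \<Rightarrow> complex) \<Rightarrow> complex set \<Rightarrow> bool" where
  "attracting_not_superattracting f D \<longleftrightarrow>
     periodic_fatou_component f D \<and>
     (\<exists>z\<in>D. attracting_periodic_point f z \<and> multiplier f z \<noteq> 0)"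

definition preperiodic_points :: "('a \<Rightarrow> 'a) \<Rightarrow> 'a set" where
  "preperiodic_points f = {z. finite (range (\<lambda>n. (f ^^ n) z))}"


section \<open>Semigroups of maps under composition\<close>

inductive_set generated_semigroup :: "('a \<Rightarrow> 'a) set \<Rightarrow> ('a \<Rightarrow> 'a) set"
  for X :: "('a \<Rightarrow> 'a) set" where
  generator: "h \<in> X \<Longrightarrow> h \<in> generated_semigroup X"
| composition: "h \<in> generated_semigroup X \<Longrightarrow> k \<in> generated_semigroup X \<Longrightarrow>
    h \<circ> k \<in> generated_semigroup X"

definition subsemigroup :: "('a \<Rightarrow> 'a) set \<Rightarrow> ('a \<Rightarrow> 'a) set \<Rightarrow> bool" where
  "subsemigroup T S \<longleftrightarrow> T \<noteq> {} \<and> T \<subseteq> S \<and> (\<forall>h\<in>T. \<forall>k\<in>T. h \<circ> k \<in> T)"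

definition compose_word :: "('a \<Rightarrow> 'a) list \<Rightarrow> 'a \<Rightarrow> 'a" where
  "compose_word w = foldr (\<circ>) w id"

text \<open>
  The free semigroup on \<open>X\<close> consists of the nonempty words over \<open>X\<close>, so \<open>T\<close> is free on
  \<open>X\<close> if \<open>X\<close> generates \<open>T\<close> and distinct nonempty words have distinct values. The basis may be
  infinite.
\<close>

definition free_semigroup_on :: "('a \<Rightarrow> 'a) set \<Rightarrow> ('a \<Rightarrow> 'a) set \<Rightarrow> bool" where
  "free_semigroup_on T X \<longleftrightarrow>
     T = generated_semigroup X \<and> inj_on compose_word {w. w \<noteq> [] \<and> set w \<subseteq> X}"

definition free_noncyclic_semigroup :: "('a \<Rightarrow> 'a) set \<Rightarrow> bool" where
  "free_noncyclic_semigroup T \<longleftrightarrow>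
     (\<exists>X. free_semigroup_on T X \<and> (\<exists>a\<in>X. \<exists>b\<in>X. a \<noteq> b))"

end

theory Submission
  imports Defs
begin

text \<open>
  Suitable iterates \<open>F\<close> of \<open>f\<close> and \<open>G\<close> of \<open>g\<close> map \<open>D\<close> into itself, and \<open>G\<close> fixes a point \<open>\<alpha>\<close> of \<open>D\<close>
  with multiplier \<open>lam\<close>, where \<open>0 < norm lam < 1\<close>. Iterating a map does not change its preperiodic
  points, so it suffices to compare \<open>F\<close> and \<open>G\<close>. Three facts about \<open>D\<close> are used: \<open>D\<close> is a bounded
  domain, the orbits of \<open>G\<close> in \<open>D\<close> converge to \<open>\<alpha>\<close>, and neither map sends a point of \<open>frontier D\<close> into
  \<open>D\<close>, because the Fatou set contains its preimages. By the second, the linearization \<open>\<phi>\<close> of Koenigs,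
  with \<open>\<phi> \<circ> G = lam * \<phi>\<close>, exists on all of \<open>D\<close>.

  A nonconstant entire map can be cancelled on the right of a composite, since it is open, but not on
  the left. So the aim is a relation \<open>G ^^ M \<circ> F ^^ a = G ^^ (M + c)\<close> with \<open>a, c \<ge> 1\<close> rather than a
  common iterate (\<open>iterates_eventually_agree\<close>). For even \<open>G\<close> and \<open>F = - G\<close> one has
  \<open>G \<circ> F = G \<circ> G\<close>, so \<open>M\<close> cannot always be \<open>0\<close>. The relation is forced as follows.

  \<^item> If \<open>\<phi> (F \<alpha>) \<noteq> 0\<close>, then for large \<open>a\<close> the map \<open>G ^^ a \<circ> F\<close> has an attracting fixed point near, but
    different from, \<open>\<alpha>\<close>; it and \<open>G\<close> play ping-pong there (\<open>free_if_moves_off_fibre\<close>). Otherwise some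
    \<open>K = G ^^ m \<circ> F\<close> fixes \<open>\<alpha>\<close>.
  \<^item> If \<open>deriv K \<alpha> = 0\<close>, the leading coefficients at \<open>\<alpha>\<close> of the words in \<open>K\<close> and \<open>G \<circ> K\<close> separate these
    words (\<open>free_if_superattracting\<close>).
  \<^item> If \<open>deriv K \<alpha> \<noteq> 0\<close> and \<open>K\<close> does not commute with \<open>G\<close>, the first nonlinear coefficient of the words
    in \<open>G ^^ n\<close> and \<open>G ^^ n \<circ> K\<close> separates them (\<open>free_if_not_commuting\<close>).
  \<^item> So \<open>\<phi> \<circ> K = mu * \<phi>\<close>, where \<open>mu = deriv K \<alpha>\<close>. The map \<open>\<phi>\<close> has a critical value other than \<open>0\<close>, since
    otherwise an inverse branch of \<open>\<phi>\<close> would extend to arbitrarily large discs while staying in the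
    bounded set \<open>D\<close> (\<open>critical_point_exists\<close>). Critical values of \<open>\<phi>\<close> come, up to powers of \<open>lam\<close>, from
    the finitely many critical points of \<open>G\<close> in \<open>D\<close>, and they may be divided by \<open>mu\<close>, because
    \<open>K ` D = D\<close>. The pigeonhole principle gives \<open>mu ^ a * lam ^ i = lam ^ l\<close> with \<open>a \<ge> 1\<close>
    (\<open>multipliers_dependent\<close>), and the relation follows. The case \<open>c \<le> 0\<close> would produce a
    noninjective entire map that preserves a nonconstant function on a bounded open set, which is
    impossible (\<open>inj_of_invariant_function\<close>).

  The relation makes \<open>G ^^ M\<close> a semiconjugacy from \<open>F ^^ a\<close> to \<open>G ^^ c\<close>, hence every preperiodic point of
  \<open>F\<close> is one of \<open>G\<close>. It also shows that \<open>F ^^ a\<close> maps the finite set of points of \<open>D\<close> that \<open>G ^^ M\<close> sends to \<open>\<alpha>\<close> into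
  itself, and so has a periodic point there; its multiplier has a power equal to a power of \<open>lam\<close>. Thus \<open>D\<close> is
  attracting but not superattracting for \<open>F\<close> too, and the argument with the two maps exchanged gives the
  other inclusion (\<open>preperiodic_points_eq_self_maps\<close>).
\<close>

section \<open>Free pairs in semigroups of maps\<close>

definition contains_free :: "('a \<Rightarrow> 'a) set \<Rightarrow> bool" where
  "contains_free X \<longleftrightarrow>
     (\<exists>T. subsemigroup T (generated_semigroup X) \<and> free_noncyclic_semigroup T)"

text \<open>
  Words in two maps are encoded by Boolean lists, so that equality of words does not depend on the
  maps.
\<close>

definition word_val :: "('a \<Rightarrow> 'a) \<Rightarrow> ('a \<Rightarrow> 'a) \<Rightarrow> bool list \<Rightarrow> 'a \<Rightarrow> 'a" where
  "word_val A B w = compose_word (map (\<lambda>b. if b then A else B) w)"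

lemma word_val_Nil [simp]: "word_val A B [] = id"
  and word_val_Cons [simp]: "word_val A B (b # w) = (if b then A else B) \<circ> word_val A B w"
  by (simp_all add: word_val_def compose_word_def)

lemma word_val_append: "word_val A B (v @ w) = word_val A B v \<circ> word_val A B w"
  by (induction v) auto

lemma generated_semigroup_subset:
  assumes "Y \<subseteq> generated_semigroup X"
  shows "generated_semigroup Y \<subseteq> generated_semigroup X"
proof
  fix h assume "h \<in> generated_semigroup Y"
  then show "h \<in> generated_semigroup X"
  proof induction
    case (composition h k)
    show ?case by (rule generated_semigroup.composition[OF composition.IH])
  qed (use assms in blast)
qed

lemma contains_free_mono:
  assumes "Y \<subseteq> generated_semigroup X" and "contains_free Y"
  shows "contains_free X"
proof -
  obtain T where T: "subsemigroup T (generated_semigroup Y)" "free_noncyclic_semigroup T"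
    using assms(2) unfolding contains_free_def by blast
  then have "subsemigroup T (generated_semigroup X)"
    using generated_semigroup_subset[OF assms(1)] unfolding subsemigroup_def
    by (meson subset_trans)
  then show ?thesis
    using T(2) unfolding contains_free_def by blast
qed

lemma funpow_in_generated_semigroup:
  assumes "h \<in> generated_semigroup X" and "n \<ge> 1"
  shows "h ^^ n \<in> generated_semigroup X"
  using assms(2)
proof (induction n rule: dec_induct)
  case base
  then show ?case using assms(1) by simp
next
  case (step n)
  show ?case
    unfolding funpow.simps(2) by (rule generated_semigroup.composition[OF assms(1) step.IH])
qed

lemma funpow_comp_in_generated_semigroup:
  assumes "h \<in> generated_semigroup X" and "k \<in> generated_semigroup X"
  shows "(h ^^ n) \<circ> k \<in> generated_semigroup X"
proof (induction n)
  case 0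
  show ?case using assms(2) by simp
next
  case (Suc n)
  show ?case
    unfolding funpow.simps(2) comp_assoc
    by (rule generated_semigroup.composition[OF assms(1) Suc])
qed

lemma contains_freeI:
  assumes A: "A \<in> generated_semigroup X" and B: "B \<in> generated_semigroup X"
    and inj: "\<And>v w. word_val A B v = word_val A B w \<Longrightarrow> v = w"
  shows "contains_free X"
proof -
  let ?T = "generated_semigroup {A, B}"
  have "A \<noteq> B"
    using inj[of "[True]" "[False]"] by auto
  have *: "map (\<lambda>b. if b then A else B) (map (\<lambda>x. x = A) u) = u" if "set u \<subseteq> {A, B}" for u
    using that by (induction u) auto
  have "inj_on compose_word {w. w \<noteq> [] \<and> set w \<subseteq> {A, B}}"
  proof (rule inj_onI)
    fix v w assume "v \<in> {w. w \<noteq> [] \<and> set w \<subseteq> {A, B}}" and "w \<in> {w. w \<noteq> [] \<and> set w \<subseteq> {A, B}}"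
      and eq: "compose_word v = compose_word w"
    then have vw: "set v \<subseteq> {A, B}" "set w \<subseteq> {A, B}" by simp_all
    have "word_val A B (map (\<lambda>x. x = A) v) = word_val A B (map (\<lambda>x. x = A) w)"
      unfolding word_val_def *[OF vw(1)] *[OF vw(2)] by (rule eq)
    then have "map (\<lambda>x. x = A) v = map (\<lambda>x. x = A) w"
      by (rule inj)
    then show "v = w"
      using *[OF vw(1)] *[OF vw(2)] by simp
  qed
  then have "free_semigroup_on ?T {A, B}"
    unfolding free_semigroup_on_def by (intro conjI refl)
  then have "free_noncyclic_semigroup ?T"
    unfolding free_noncyclic_semigroup_def using \<open>A \<noteq> B\<close>
    by (intro exI[of _ "{A, B}"] conjI bexI[of _ A] bexI[of _ B]) simp_all
  moreover have "subsemigroup ?T (generated_semigroup X)"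
    unfolding subsemigroup_def
  proof (intro conjI ballI)
    show "?T \<noteq> {}"
      using generated_semigroup.generator[of A "{A, B}"] by force
    show "?T \<subseteq> generated_semigroup X"
      using A B by (intro generated_semigroup_subset) simp
  qed (rule generated_semigroup.composition)
  ultimately show ?thesis
    unfolding contains_free_def by (intro exI[of _ ?T] conjI)
qed

text \<open>
  The first letter of a word can be read off from the part of \<open>U\<close> that contains its values, and it can
  then be cancelled on the left because both maps are injective on \<open>U\<close>. The empty word is excluded
  because the values of the other words miss part of \<open>U\<close>.
\<close>

lemma ping_pong:
  assumes "U \<noteq> {}" and "A ` U \<subseteq> U" and "B ` U \<subseteq> U" and "inj_on A U" and "inj_on B U"
    and disj: "A ` U \<inter> B ` U = {}"
    and "\<And>x. x \<in> U \<Longrightarrow> word_val A B v x = word_val A B w x"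
  shows "v = w"
proof -
  define L where "L b = (if b then A else B)" for b
  have L_U: "L b x \<in> U" if "x \<in> U" for b x
    using that assms(2,3) by (auto simp: L_def)
  have L_eqD: "b = c \<and> x = y" if eq: "L b x = L c y" and U: "x \<in> U" "y \<in> U" for b c x y
  proof -
    have "A x \<noteq> B y" "A y \<noteq> B x" using disj U by blast+
    then have "b = c" using eq by (cases b; cases c) (simp_all add: L_def)
    moreover have "inj_on (L c) U" using assms(4,5) by (cases c) (simp_all add: L_def)
    ultimately show ?thesis using inj_onD[of "L c" U x y] eq U by blast
  qed
  have val: "word_val A B (b # u) x = L b (word_val A B u x)" for b u x
    by (simp add: L_def)
  have in_U: "word_val A B u x \<in> U" if "x \<in> U" for u x
    using that by (induction u) (simp_all add: val L_U del: word_val_Cons)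
  have not_id: False if "\<And>x. x \<in> U \<Longrightarrow> word_val A B (b # u) x = x" for b u
  proof -
    obtain x where x: "x \<in> U" using assms(1) by blast
    have "L b (word_val A B u (L (\<not> b) x)) = L (\<not> b) x"
      using that[OF L_U[OF x]] unfolding val .
    then show False
      using L_eqD[OF _ in_U[OF L_U[OF x]] x] by blast
  qed
  show ?thesis
    using assms(7)
  proof (induction v arbitrary: w)
    case Nil
    show ?case
    proof (cases w)
      case (Cons c u)
      have False
        by (rule not_id[of c u]) (simp only: Nil[symmetric] Cons[symmetric] word_val_Nil id_apply)
      then show ?thesis ..
    qed simp
  next
    case (Cons b v)
    show ?case
    proof (cases w)
      case Nil
      have False
        by (rule not_id[of b v]) (simp only: Cons.prems Nil word_val_Nil id_apply)
      then show ?thesis ..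
    next
      case w: (Cons c u)
      have eq: "L b (word_val A B v x) = L c (word_val A B u x)" if "x \<in> U" for x
        using Cons.prems[OF that] unfolding w val .
      have *: "b = c \<and> word_val A B v x = word_val A B u x" if "x \<in> U" for x
        by (rule L_eqD[OF eq[OF that] in_U[OF that] in_U[OF that]])
      then have "v = u" by (intro Cons.IH) blast
      moreover have "b = c" using * assms(1) by blast
      ultimately show ?thesis using w by simp
    qed
  qed
qed



section \<open>Entire functions\<close>

lemma entire_comp:
  assumes "f holomorphic_on UNIV" and "g holomorphic_on UNIV"
  shows "f \<circ> g holomorphic_on UNIV"
  using assms holomorphic_on_compose holomorphic_on_subset by blast

lemma entire_funpow:
  assumes "f holomorphic_on UNIV"
  shows "f ^^ n holomorphic_on UNIV"
proof (induction n)
  case (Suc n)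
  show ?case
    unfolding funpow.simps(2) by (rule entire_comp[OF assms Suc])
qed (auto simp: id_def)

lemma entire_eqI:
  assumes "f holomorphic_on UNIV" and "g holomorphic_on UNIV"
    and "open S" and "S \<noteq> {}" and "\<And>z. z \<in> S \<Longrightarrow> f z = g z"
  shows "f = g"
proof
  show "f z = g z" for z
    by (rule analytic_continuation_open[of S UNIV f g]) (use assms in auto)
qed

lemma entire_isCont: "f holomorphic_on UNIV \<Longrightarrow> isCont f z"
  by (meson continuous_on_eq_continuous_at holomorphic_on_imp_continuous_on iso_tuple_UNIV_I open_UNIV)

lemma entire_DERIV:
  "f holomorphic_on UNIV \<Longrightarrow> (f has_field_derivative deriv f z) (at z)"
  using holomorphic_derivI by blast

lemma entire_open_image:
  assumes "f holomorphic_on UNIV" and "\<not> f constant_on UNIV" and "open S"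
  shows "open (f ` S)"
  using open_mapping_thm[of f UNIV S] assms by auto

lemma entire_finite_fibre:
  assumes "f holomorphic_on UNIV" and "\<not> f constant_on UNIV" and "bounded D"
  shows "finite {z \<in> D. f z = w}"
proof -
  have "finite {z \<in> closure D. f z - w = 0}"
  proof (rule holomorphic_compact_finite_zeros[of _ UNIV])
    show "(\<lambda>z. f z - w) holomorphic_on UNIV"
      using assms(1) by (intro holomorphic_intros)
    show "\<not> (\<lambda>z. f z - w) constant_on UNIV"
      using assms(2) unfolding constant_on_def by (metis diff_add_cancel)
  qed (use assms(3) in auto)
  then show ?thesis
    by (rule rev_finite_subset) (use closure_subset in auto)
qed

text \<open>
  An uncountable zero set has a limit point.
\<close>

lemma entire_eq_uncountable:
  assumes "f holomorphic_on UNIV" and "g holomorphic_on UNIV" and "uncountable {z. f z = g z}"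
  shows "f = g"
proof -
  have "(\<lambda>z. f z - g z) constant_on UNIV"
  proof (rule ccontr)
    assume "\<not> ?thesis"
    then have "countable {z\<in>UNIV. f z - g z = 0}"
      using assms(1,2)
      by (intro holomorphic_countable_zeros) (auto intro: holomorphic_intros fsigma_UNIV)
    then show False using assms(3) by simp
  qed
  then obtain c where c: "\<And>z. f z - g z = c"
    unfolding constant_on_def by auto
  obtain z where "f z = g z"
    using assms(3) by (metis (mono_tags) Collect_empty_eq countable_empty)
  then have "c = 0" using c[of z] by simp
  then show ?thesis using c by auto
qed

text \<open>
  The orbit of a point of \<open>D\<close> stays in a fibre of \<open>P\<close> over a bounded set, so it is finite. There are only
  countably many pairs \<open>i < j\<close> and \<open>D\<close> is uncountable, so one equation \<open>(E ^^ i) z = (E ^^ j) z\<close> has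
  uncountably many solutions and is an identity. Cancelling \<open>E ^^ i\<close> on the right makes an
  iterate of \<open>E\<close> the identity.
\<close>

lemma inj_of_invariant_function:
  assumes P: "P holomorphic_on UNIV" "\<not> P constant_on UNIV" and E: "E holomorphic_on UNIV"
    and D: "open D" "D \<noteq> {}" "bounded D" and "E ` D \<subseteq> D"
    and inv: "\<And>z. z \<in> D \<Longrightarrow> P (E z) = P z"
  shows "inj E"
proof -
  have orbit: "(E ^^ n) z \<in> D \<and> P ((E ^^ n) z) = P z" if "z \<in> D" for z n
    using that assms(7) inv by (induction n) auto
  have unc: "uncountable D"
    using D(1,2) by (metis open_contains_ball countable_subset uncountable_ball ex_in_conv)
  have "\<exists>i j. i < j \<and> (E ^^ i) z = (E ^^ j) z" if "z \<in> D" for z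
  proof -
    have "finite (range (\<lambda>n. (E ^^ n) z))"
      by (rule finite_subset[OF _ entire_finite_fibre[OF P D(3), of "P z"]])
         (use orbit[OF that] in auto)
    then have "\<not> inj (\<lambda>n. (E ^^ n) z)"
      using finite_imageD by blast
    then show ?thesis
      unfolding inj_on_def by (metis linorder_neqE_nat)
  qed
  then have "D \<subseteq> (\<Union>p\<in>{(i, j). i < j}. {z. (E ^^ fst p) z = (E ^^ snd p) z})"
    by fastforce
  then have "uncountable (\<Union>p\<in>{(i::nat, j). i < j}. {z. (E ^^ fst p) z = (E ^^ snd p) z})"
    using unc countable_subset by blast
  then obtain p :: "nat \<times> nat" where p: "p \<in> {(i, j). i < j}" "uncountable {z. (E ^^ fst p) z = (E ^^ snd p) z}"
    using countable_UN[of "{(i::nat, j). i < j}"] by (meson countableI_type)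
  obtain i j where ij: "i < j" "uncountable {z. (E ^^ i) z = (E ^^ j) z}"
    using p by (cases p) auto
  then have eq: "E ^^ i = E ^^ j"
    using entire_eq_uncountable entire_funpow[OF E] by blast
  have "\<not> (E ^^ i) constant_on UNIV"
  proof
    assume "(E ^^ i) constant_on UNIV"
    then obtain c where "\<And>z. (E ^^ i) z = c" unfolding constant_on_def by auto
    then have "\<And>z. z \<in> D \<Longrightarrow> P z = P c" using orbit by metis
    then have "P = (\<lambda>_. P c)"
      using D P by (intro entire_eqI[of _ _ D]) auto
    then show False using P(2) unfolding constant_on_def by metis
  qed
  then have "open ((E ^^ i) ` UNIV)"
    using entire_open_image entire_funpow[OF E] by blast
  moreover have "(E ^^ (j - i)) w = id w" if w: "w \<in> range (E ^^ i)" for w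
  proof -
    obtain z where z: "w = (E ^^ i) z" using w by blast
    have "(E ^^ (j - i)) ((E ^^ i) z) = (E ^^ (j - i + i)) z"
      by (simp add: funpow_add del: funpow.simps)
    then show ?thesis using z ij(1) eq by simp
  qed
  ultimately have "E ^^ (j - i) = id"
    using entire_funpow[OF E] by (intro entire_eqI[of _ _ "range (E ^^ i)"]) (auto simp: id_def)
  moreover obtain m where "j - i = Suc m" using ij(1) by (metis Suc_diff_Suc)
  ultimately have "(E ^^ m) \<circ> E = id" by (metis funpow_Suc_right)
  then show ?thesis by (metis inj_on_id inj_on_imageI2)
qed

lemma entire_nonconstant_comp:
  assumes "f holomorphic_on UNIV" "g holomorphic_on UNIV" "\<not> f constant_on UNIV" "\<not> g constant_on UNIV"
  shows "\<not> (f \<circ> g) constant_on UNIV"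
proof
  assume "(f \<circ> g) constant_on UNIV"
  then obtain c where c: "\<And>z. f (g z) = c" unfolding constant_on_def by auto
  have "f = (\<lambda>_. c)"
  proof (rule entire_eqI[of _ _ "range g"])
    show "open (range g)" using entire_open_image assms by blast
  qed (use assms c in auto)
  then show False using assms(3) unfolding constant_on_def by metis
qed

lemma entire_nonconstant_funpow:
  assumes "f holomorphic_on UNIV" "\<not> f constant_on UNIV"
  shows "\<not> (f ^^ n) constant_on UNIV"
proof (induction n)
  case 0
  show ?case unfolding constant_on_def by (metis UNIV_I funpow_0 zero_neq_one)
next
  case (Suc n)
  show ?case
    unfolding funpow.simps(2) by (rule entire_nonconstant_comp[OF assms(1) entire_funpow[OF assms(1)] assms(2) Suc])
qed

lemma entire_deriv_comp:
  assumes "f holomorphic_on UNIV" "g holomorphic_on UNIV"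
  shows "deriv (f \<circ> g) z = deriv f (g z) * deriv g z"
  using assms by (intro deriv_chain) (auto simp: holomorphic_on_def)

lemma entire_eventually_ne:
  assumes "f holomorphic_on UNIV" "\<not> f constant_on UNIV"
  shows "\<forall>\<^sub>F z in at a. f z \<noteq> w"
proof (cases "f a = w")
  case True
  obtain b where "f b \<noteq> w" using assms(2) unfolding constant_on_def by auto
  then have b: "f b - w \<noteq> 0" by simp
  have hol: "(\<lambda>z. f z - w) holomorphic_on UNIV" using assms(1) by (intro holomorphic_intros)
  obtain r where r: "0 < r" "\<And>z. z \<in> ball a r - {a} \<Longrightarrow> f z - w \<noteq> 0"
    using isolated_zeros[OF hol open_UNIV connected_UNIV UNIV_I _ UNIV_I b, of a] True by auto
  then show ?thesis
    unfolding eventually_at by (intro exI[of _ r]) (auto simp: dist_commute)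
next
  case False
  have "(f \<longlongrightarrow> f a) (at a)" using entire_isCont[OF assms(1)] by (simp add: isCont_def)
  then show ?thesis using False by (rule tendsto_imp_eventually_ne)
qed

lemma entire_eventually_regular:
  assumes "f holomorphic_on UNIV" "\<not> f constant_on UNIV"
  shows "\<forall>\<^sub>F z in at a. deriv f z \<noteq> 0"
proof (cases "deriv f constant_on UNIV")
  case True
  then obtain c where c: "\<And>z. deriv f z = c" unfolding constant_on_def by auto
  have "c \<noteq> 0"
  proof
    assume "c = 0"
    then have "(f has_field_derivative 0) (at z)" for z
      using entire_DERIV[OF assms(1), of z] c by simp
    then obtain d where "\<And>z. z \<in> UNIV \<Longrightarrow> f z = d"
      using has_field_derivative_zero_constant[of UNIV f] by auto
    then show False using assms(2) unfolding constant_on_def by blast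
  qed
  then show ?thesis using c by simp
next
  case False
  then show ?thesis
    using entire_eventually_ne[of "deriv f"] holomorphic_deriv[OF assms(1)] by auto
qed

section \<open>Linearization at an attracting fixed point\<close>

text \<open>
  The condition \<open>boundary\<close> is what makes \<open>G\<close> proper as a self-map of \<open>D\<close>.
\<close>

locale attracting_domain =
  fixes G :: "complex \<Rightarrow> complex" and D :: "complex set" and \<alpha> lam :: complex
  assumes entire: "G holomorphic_on UNIV"
    and open_D: "open D" and connected_D: "connected D" and bounded_D: "bounded D"
    and \<alpha>_in_D: "\<alpha> \<in> D" and G_D: "G ` D \<subseteq> D"
    and boundary: "\<And>z. z \<in> frontier D \<Longrightarrow> G z \<notin> D"
    and fixed: "G \<alpha> = \<alpha>" and deriv_G: "deriv G \<alpha> = lam"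
    and lam_nonzero: "lam \<noteq> 0" and lam_less_1: "norm lam < 1"
begin

text \<open>
  The bound \<open>c\<^sup>2 < norm lam\<close> makes the quadratic errors, which decay like \<open>c\<^sup>2\<close> per iteration, small
  after division by the powers of \<open>lam\<close> in Koenigs' limit.
\<close>

lemma local_bounds:
  obtains r c C where "r > 0" "cball \<alpha> r \<subseteq> D" "0 < c" "c < 1" "c\<^sup>2 < norm lam"
    "\<And>z. z \<in> cball \<alpha> r \<Longrightarrow> norm (G z - \<alpha>) \<le> c * norm (z - \<alpha>)"
    "\<And>z. z \<in> cball \<alpha> r \<Longrightarrow> norm (G z - \<alpha> - lam * (z - \<alpha>)) \<le> C * (norm (z - \<alpha>))\<^sup>2"
proof -
  have hol: "(deriv ^^ i) G holomorphic_on UNIV" for i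
    using entire holomorphic_higher_deriv by blast
  have "compact ((deriv ^^ 2) G ` cball \<alpha> 1)"
    by (intro compact_continuous_image)
       (use hol in \<open>auto intro: holomorphic_on_imp_continuous_on holomorphic_on_subset\<close>)
  then obtain B where B: "\<And>z. z \<in> cball \<alpha> 1 \<Longrightarrow> norm ((deriv ^^ 2) G z) \<le> B"
    using compact_imp_bounded bounded_iff by (metis imageI)
  have "0 \<le> B" using B[of \<alpha>] by (metis centre_in_cball norm_ge_zero order_trans zero_le_one)
  have quad: "norm (G z - \<alpha> - lam * (z - \<alpha>)) \<le> B * (norm (z - \<alpha>))\<^sup>2" if "z \<in> cball \<alpha> 1" for z
  proof -
    have "norm ((deriv ^^ 0) G z - (\<Sum>i\<le>1. (deriv ^^ i) G \<alpha> * (z - \<alpha>) ^ i / fact i))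
        \<le> B * norm (z - \<alpha>) ^ Suc 1 / fact 1"
    proof (rule complex_Taylor)
      show "((deriv ^^ i) G has_field_derivative (deriv ^^ Suc i) G x) (at x within cball \<alpha> 1)" for i x
        using entire_DERIV[OF hol[of i], of x] by (simp add: has_field_derivative_at_within)
      show "norm ((deriv ^^ Suc 1) G x) \<le> B" if "x \<in> cball \<alpha> 1" for x
        using B[OF that] by (simp add: numeral_2_eq_2)
    qed (use that in auto)
    then show ?thesis
      by (simp add: fixed deriv_G diff_diff_eq power2_eq_square)
  qed
  have "norm lam < sqrt (norm lam)"
    using lam_nonzero lam_less_1 by (simp add: real_less_rsqrt power2_eq_square)
  then obtain c where c: "norm lam < c" "c < sqrt (norm lam)"
    using dense by blast
  have c0: "0 < c" using c(1) by (metis norm_ge_zero order_le_less_trans)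
  have c2: "c\<^sup>2 < norm lam"
    using c c0 by (metis less_eq_real_def norm_ge_zero power_strict_mono real_sqrt_pow2 zero_less_numeral)
  have c1: "c < 1"
    using c(2) lam_less_1 by (smt (verit) real_sqrt_lt_1_iff)
  obtain r0 where r0: "r0 > 0" "cball \<alpha> r0 \<subseteq> D"
    using open_D \<alpha>_in_D open_contains_cball by blast
  \<comment> \<open>Small enough for \<open>B * norm (z - \<alpha>) + norm lam \<le> c\<close> on the disc, where \<open>B\<close> bounds the quadratic error.\<close>
  define r where "r = min (min r0 1) ((c - norm lam) / (B + 1))"
  have r: "r > 0" "r \<le> r0" "r \<le> 1" "r * (B + 1) \<le> c - norm lam"
  proof -
    show "r > 0" using r0 c \<open>0 \<le> B\<close> by (simp add: r_def)
    show "r \<le> r0" "r \<le> 1" by (simp_all add: r_def)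
    have "r \<le> (c - norm lam) / (B + 1)" by (simp add: r_def)
    then show "r * (B + 1) \<le> c - norm lam" using \<open>0 \<le> B\<close> by (simp add: pos_le_divide_eq)
  qed
  have contr: "norm (G z - \<alpha>) \<le> c * norm (z - \<alpha>)" if "z \<in> cball \<alpha> r" for z
  proof -
    have z: "norm (z - \<alpha>) \<le> r" using that by (simp add: dist_norm norm_minus_commute)
    have "norm (G z - \<alpha>) \<le> norm (G z - \<alpha> - lam * (z - \<alpha>)) + norm (lam * (z - \<alpha>))"
      by (metis diff_add_cancel norm_triangle_ineq)
    also have "\<dots> \<le> B * (norm (z - \<alpha>))\<^sup>2 + norm lam * norm (z - \<alpha>)"
      using quad[of z] z r(3) by (simp add: norm_mult dist_norm norm_minus_commute)
    also have "\<dots> = (B * norm (z - \<alpha>) + norm lam) * norm (z - \<alpha>)"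
      by (simp add: power2_eq_square algebra_simps)
    also have "\<dots> \<le> c * norm (z - \<alpha>)"
    proof (rule mult_right_mono)
      have "B * norm (z - \<alpha>) \<le> B * r" using z \<open>0 \<le> B\<close> by (rule mult_left_mono)
      then show "B * norm (z - \<alpha>) + norm lam \<le> c" using r(1,4) by (simp add: algebra_simps)
    qed simp
    finally show ?thesis .
  qed
  show ?thesis
  proof (rule that[of r c B])
    show "cball \<alpha> r \<subseteq> D" using r0(2) r(2) by force
    show "norm (G z - \<alpha> - lam * (z - \<alpha>)) \<le> B * (norm (z - \<alpha>))\<^sup>2" if "z \<in> cball \<alpha> r" for z
      using quad[of z] that r(3) by simp
  qed (use r c0 c1 c2 contr in auto)
qed

lemma entire_iterate: "G ^^ n holomorphic_on UNIV"
  by (rule entire_funpow[OF entire])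

lemma iterate_in_D: "z \<in> D \<Longrightarrow> (G ^^ n) z \<in> D"
  using G_D by (induction n) auto

lemma iterate_fix [simp]: "(G ^^ n) \<alpha> = \<alpha>"
  by (induction n) (auto simp: fixed)

lemma nonconstant: "\<not> G constant_on UNIV"
proof
  assume "G constant_on UNIV"
  then obtain c where "G = (\<lambda>_. c)" unfolding constant_on_def by auto
  then show False using deriv_G lam_nonzero by simp
qed

lemma iterate_local:
  assumes "\<And>z. z \<in> cball \<alpha> r \<Longrightarrow> norm (G z - \<alpha>) \<le> c * norm (z - \<alpha>)"
    and "0 \<le> c" "c < 1" and z: "z \<in> cball \<alpha> r"
  shows "norm ((G ^^ n) z - \<alpha>) \<le> c ^ n * norm (z - \<alpha>)"
proof (induction n)
  case (Suc n)
  have "c ^ n * norm (z - \<alpha>) \<le> 1 * norm (z - \<alpha>)"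
    using assms(2,3) by (intro mult_right_mono power_le_one) auto
  then have "(G ^^ n) z \<in> cball \<alpha> r"
    using Suc z by (simp add: dist_norm norm_minus_commute)
  then have "norm ((G ^^ Suc n) z - \<alpha>) \<le> c * norm ((G ^^ n) z - \<alpha>)"
    using assms(1) by simp
  also have "\<dots> \<le> c * (c ^ n * norm (z - \<alpha>))"
    using Suc assms(2) by (intro mult_left_mono)
  finally show ?case by (simp add: mult.assoc)
qed simp

lemma local_convergence:
  assumes "\<And>z. z \<in> cball \<alpha> r \<Longrightarrow> norm (G z - \<alpha>) \<le> c * norm (z - \<alpha>)"
    and "0 \<le> c" "c < 1" and z: "(G ^^ k) z \<in> cball \<alpha> r"
  shows "(\<lambda>n. (G ^^ n) z) \<longlonglongrightarrow> \<alpha>"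
proof -
  have "(\<lambda>n. (G ^^ n) ((G ^^ k) z) - \<alpha>) \<longlonglongrightarrow> 0"
  proof (rule Lim_null_comparison)
    show "\<forall>\<^sub>F n in sequentially. norm ((G ^^ n) ((G ^^ k) z) - \<alpha>) \<le> c ^ n * norm ((G ^^ k) z - \<alpha>)"
      using iterate_local[OF assms(1-3) z] by (intro always_eventually) blast
    have "(\<lambda>n. c ^ n) \<longlonglongrightarrow> 0" using assms(2,3) by (intro LIMSEQ_power_zero) auto
    then show "(\<lambda>n. c ^ n * norm ((G ^^ k) z - \<alpha>)) \<longlonglongrightarrow> 0"
      by (rule tendsto_mult_left_zero)
  qed
  then have "(\<lambda>n. (G ^^ (n + k)) z) \<longlonglongrightarrow> \<alpha>"
    unfolding funpow_add o_apply by (subst Lim_null)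
  then show ?thesis by (rule LIMSEQ_offset)
qed

text \<open>
  The iterates form a bounded family on \<open>D\<close>. A locally uniform limit of a subsequence is \<open>\<alpha>\<close> near \<open>\<alpha>\<close>,
  hence on \<open>D\<close> by the identity theorem, so every orbit reaches the disc on which \<open>G\<close> contracts.
\<close>

lemma convergence:
  assumes "z \<in> D"
  shows "(\<lambda>n. (G ^^ n) z) \<longlonglongrightarrow> \<alpha>"
proof -
  obtain r c C where r: "r > 0" "cball \<alpha> r \<subseteq> D" and c: "0 < c" "c < 1"
    and contr: "\<And>z. z \<in> cball \<alpha> r \<Longrightarrow> norm (G z - \<alpha>) \<le> c * norm (z - \<alpha>)"
    using local_bounds by metis
  obtain B where B: "\<And>w. w \<in> D \<Longrightarrow> norm w \<le> B" using bounded_D bounded_iff by blast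
  obtain g k where g: "g holomorphic_on D" and k: "strict_mono (k :: nat \<Rightarrow> nat)"
    and lim: "\<And>x. x \<in> D \<Longrightarrow> (\<lambda>n. (G ^^ k n) x) \<longlonglongrightarrow> g x"
  proof (rule Montel[of D "range (\<lambda>n. G ^^ n)" "\<lambda>n. G ^^ n"])
    show "\<exists>B. \<forall>h\<in>range ((^^) G). \<forall>z\<in>K. norm (h z) \<le> B" if "K \<subseteq> D" for K
      using that B iterate_in_D by blast
    show "h holomorphic_on D" if "h \<in> range ((^^) G)" for h
      using that entire_iterate holomorphic_on_subset by blast
  qed (use open_D in auto)
  have g_ball: "g x = \<alpha>" if "x \<in> ball \<alpha> r" for x
  proof -
    have "(\<lambda>n. (G ^^ n) x) \<longlonglongrightarrow> \<alpha>"
      using that c local_convergence[OF contr, where k = 0 and z = x] by simp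
    then have "(\<lambda>n. (G ^^ k n) x) \<longlonglongrightarrow> \<alpha>"
      using LIMSEQ_subseq_LIMSEQ[OF _ k] by (fastforce simp: o_def)
    moreover have "x \<in> D" using that r(2) by auto
    ultimately show ?thesis using lim LIMSEQ_unique by blast
  qed
  have "g z = \<alpha>"
  proof (rule analytic_continuation_open[of "ball \<alpha> r" D g "\<lambda>_. \<alpha>"])
    show "ball \<alpha> r \<noteq> {}" using r(1) by simp
    show "ball \<alpha> r \<subseteq> D" using r(2) by auto
  qed (use open_D connected_D g g_ball assms in simp_all)
  have "\<forall>\<^sub>F n in sequentially. dist ((G ^^ k n) z) \<alpha> < r"
    using \<open>g z = \<alpha>\<close> lim[OF assms] r(1) tendstoD by blast
  then obtain n where "dist ((G ^^ k n) z) \<alpha> < r"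
    using eventually_happens'[OF sequentially_bot] by blast
  then show ?thesis
    using local_convergence[OF contr, where k = "k n" and z = z] c by (simp add: dist_commute)
qed

lemma enters_ball:
  assumes "z \<in> D" and "0 < r"
  obtains n where "(G ^^ n) z \<in> ball \<alpha> r"
proof -
  have "\<forall>\<^sub>F n in sequentially. dist ((G ^^ n) z) \<alpha> < r"
    using convergence[OF assms(1)] assms(2) tendstoD by blast
  then obtain n where "dist ((G ^^ n) z) \<alpha> < r"
    using eventually_happens'[OF sequentially_bot] by blast
  then show ?thesis using that by (simp add: dist_commute)
qed

text \<open>
  The map \<open>\<phi>\<close> is the limit of \<open>P n = (G ^^ n - \<alpha>) / lam ^ n\<close>. Consecutive terms differ near \<open>\<alpha>\<close> by at
  most a multiple of \<open>norm (z - \<alpha>)\<^sup>2\<close> times \<open>(c\<^sup>2 / norm lam) ^ n\<close>; summation gives uniform convergence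
  on a disc and also the derivative at \<open>\<alpha>\<close>. From the disc the limit spreads to \<open>D\<close>, because
  \<open>P (n + k) = P n \<circ> G ^^ k / lam ^ k\<close>.
\<close>

lemma Koenigs:
  obtains \<phi> where "\<phi> holomorphic_on D" "\<phi> \<alpha> = 0" "deriv \<phi> \<alpha> = 1"
    "\<And>z. z \<in> D \<Longrightarrow> \<phi> (G z) = lam * \<phi> z"
proof -
  obtain r c C where r: "r > 0" "cball \<alpha> r \<subseteq> D" and c: "0 < c" "c < 1" "c\<^sup>2 < norm lam"
    and contr: "\<And>z. z \<in> cball \<alpha> r \<Longrightarrow> norm (G z - \<alpha>) \<le> c * norm (z - \<alpha>)"
    and quad: "\<And>z. z \<in> cball \<alpha> r \<Longrightarrow> norm (G z - \<alpha> - lam * (z - \<alpha>)) \<le> C * (norm (z - \<alpha>))\<^sup>2"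
    using local_bounds by metis
  define P where "P n z = ((G ^^ n) z - \<alpha>) / lam ^ n" for n z
  define a where "a n z = P (Suc n) z - P n z" for n z
  define q where "q = c\<^sup>2 / norm lam"
  define K where "K = \<bar>C\<bar> / norm lam"
  have q: "0 \<le> q" "q < 1" using c by (auto simp: q_def divide_simps)
  have K: "0 \<le> K" by (simp add: K_def)
  have a_le: "norm (a n z) \<le> K * (norm (z - \<alpha>))\<^sup>2 * q ^ n" if z: "z \<in> cball \<alpha> r" for n z
  proof -
    let ?w = "(G ^^ n) z"
    have w: "norm (?w - \<alpha>) \<le> c ^ n * norm (z - \<alpha>)"
      using iterate_local[OF contr _ _ z] c by simp
    also have "\<dots> \<le> 1 * norm (z - \<alpha>)"
      using c by (intro mult_right_mono power_le_one) auto
    finally have w_in: "?w \<in> cball \<alpha> r"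
      using z by (simp add: dist_norm norm_minus_commute)
    have "a n z = (G ?w - \<alpha> - lam * (?w - \<alpha>)) / lam ^ Suc n"
      using lam_nonzero by (simp add: a_def P_def field_simps)
    then have "norm (a n z) = norm (G ?w - \<alpha> - lam * (?w - \<alpha>)) / norm lam ^ Suc n"
      by (simp add: norm_divide norm_power norm_mult)
    also have "\<dots> \<le> \<bar>C\<bar> * (norm (?w - \<alpha>))\<^sup>2 / norm lam ^ Suc n"
    proof (rule divide_right_mono)
      show "norm (G ?w - \<alpha> - lam * (?w - \<alpha>)) \<le> \<bar>C\<bar> * (norm (?w - \<alpha>))\<^sup>2"
        using quad[OF w_in] by (rule order_trans) (simp add: mult_right_mono)
    qed simp
    also have "\<dots> \<le> \<bar>C\<bar> * (c ^ n * norm (z - \<alpha>))\<^sup>2 / norm lam ^ Suc n"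
      using w by (intro divide_right_mono mult_left_mono power_mono) auto
    also have "\<dots> = K * (norm (z - \<alpha>))\<^sup>2 * q ^ n"
      by (simp add: K_def q_def power_mult_distrib power_divide flip: power_mult)
         (simp add: mult.commute)
    finally show ?thesis .
  qed
  have sum_q: "summable (\<lambda>n. B * q ^ n)" for B
    using q by (intro summable_mult summable_geometric) simp
  have telescope: "(\<Sum>i<n. a i z) = P n z - (z - \<alpha>)" for n z
    unfolding a_def by (subst sum_lessThan_telescope) (simp add: P_def)
  define L where "L z = (z - \<alpha>) + (\<Sum>i. a i z)" for z
  have "uniform_limit (cball \<alpha> r) (\<lambda>n z. \<Sum>i<n. a i z) (\<lambda>z. \<Sum>i. a i z) sequentially"
  proof (rule Weierstrass_m_test)
    show "norm (a n z) \<le> K * r\<^sup>2 * q ^ n" if "z \<in> cball \<alpha> r" for n z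
    proof -
      have "norm (z - \<alpha>) \<le> r" using that by (simp add: dist_norm norm_minus_commute)
      then have "K * (norm (z - \<alpha>))\<^sup>2 * q ^ n \<le> K * r\<^sup>2 * q ^ n"
        using K q by (intro mult_right_mono mult_left_mono power_mono) auto
      then show ?thesis using a_le[OF that, of n] by linarith
    qed
  qed (rule sum_q)
  then have "uniform_limit (cball \<alpha> r) (\<lambda>n z. (z - \<alpha>) + (\<Sum>i<n. a i z)) L sequentially"
    unfolding L_def by (intro uniform_limit_intros)
  then have uP: "uniform_limit (cball \<alpha> r) P L sequentially"
    by (simp add: telescope)
  have holP: "P n holomorphic_on S" for n S
  proof -
    have "(\<lambda>z. ((G ^^ n) z - \<alpha>) / lam ^ n) holomorphic_on S"
      using holomorphic_on_subset[OF entire_iterate] lam_nonzero by (intro holomorphic_intros) auto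
    moreover have "P n = (\<lambda>z. ((G ^^ n) z - \<alpha>) / lam ^ n)" by (simp add: fun_eq_iff P_def)
    ultimately show ?thesis by simp
  qed
  have holL: "L holomorphic_on ball \<alpha> r"
  proof (rule holomorphic_uniform_limit[OF _ uP])
    show "\<forall>\<^sub>F n in sequentially. continuous_on (cball \<alpha> r) (P n) \<and> P n holomorphic_on ball \<alpha> r"
      using holP holomorphic_on_imp_continuous_on by (intro always_eventually) blast
  qed auto
  define \<phi> where "\<phi> z = lim (\<lambda>n. P n z)" for z
  have \<phi>_eq: "(\<lambda>n. P n z) \<longlonglongrightarrow> L ((G ^^ k) z) / lam ^ k" "\<phi> z = L ((G ^^ k) z) / lam ^ k"
    if "(G ^^ k) z \<in> ball \<alpha> r" for k z
  proof -
    have "(\<lambda>n. P n ((G ^^ k) z)) \<longlonglongrightarrow> L ((G ^^ k) z)"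
      by (rule tendsto_uniform_limitI[OF uP]) (use that in auto)
    then have "(\<lambda>n. P n ((G ^^ k) z) / lam ^ k) \<longlonglongrightarrow> L ((G ^^ k) z) / lam ^ k"
      using lam_nonzero by (intro tendsto_divide tendsto_const) auto
    moreover have "P n ((G ^^ k) z) / lam ^ k = P (n + k) z" for n
      using lam_nonzero by (simp add: P_def power_add funpow_add)
    ultimately show *: "(\<lambda>n. P n z) \<longlonglongrightarrow> L ((G ^^ k) z) / lam ^ k"
      by (intro LIMSEQ_offset[of "\<lambda>n. P n z" k]) simp
    show "\<phi> z = L ((G ^^ k) z) / lam ^ k"
      unfolding \<phi>_def by (rule limI[OF *])
  qed
  have enter: "\<exists>k. (G ^^ k) z \<in> ball \<alpha> r" if "z \<in> D" for z
    using enters_ball[OF that r(1)] by metis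
  have \<phi>_lim: "(\<lambda>n. P n z) \<longlonglongrightarrow> \<phi> z" if "z \<in> D" for z
    using enter[OF that] \<phi>_eq by metis
  show ?thesis
  proof (rule that[of \<phi>])
    show "\<phi> holomorphic_on D"
      unfolding holomorphic_on_def
    proof
      fix z assume z: "z \<in> D"
      then obtain k where k: "(G ^^ k) z \<in> ball \<alpha> r" using enter by blast
      define S where "S = (G ^^ k) -` ball \<alpha> r"
      have "open S"
        unfolding S_def using entire_isCont[OF entire_iterate] by (intro continuous_open_vimage) auto
      have "(\<lambda>z. (L \<circ> (G ^^ k)) z / lam ^ k) holomorphic_on S"
        using holL lam_nonzero holomorphic_on_subset[OF entire_iterate]
        by (intro holomorphic_intros holomorphic_on_compose_gen[of _ _ _ "ball \<alpha> r"]) (auto simp: S_def)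
      then have "\<phi> holomorphic_on S"
        by (rule holomorphic_transform) (simp add: S_def \<phi>_eq(2))
      then show "\<phi> field_differentiable at z within D"
        using \<open>open S\<close> k by (metis S_def field_differentiable_at_within holomorphic_on_imp_differentiable_at vimageI)
    qed
    have \<phi>_ball: "\<phi> z = L z" if "z \<in> ball \<alpha> r" for z
      using \<phi>_eq(2)[of 0 z] that by simp
    show \<phi>0: "\<phi> \<alpha> = 0"
      unfolding \<phi>_def P_def by simp
    show "deriv \<phi> \<alpha> = 1"
    proof (rule DERIV_imp_deriv)
      show "(\<phi> has_field_derivative 1) (at \<alpha>)"
        unfolding DERIV_def
      proof (rule Lim_transform_eventually)
        have "(\<lambda>h. (L (\<alpha> + h) - h) / h) \<midarrow>0\<rightarrow> 0"
        proof (rule Lim_null_comparison)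
          have "norm ((L (\<alpha> + h) - h) / h) \<le> K / (1 - q) * norm h" if h: "h \<noteq> 0" "norm h < r" for h
          proof -
            have "L (\<alpha> + h) - h = (\<Sum>i. a i (\<alpha> + h))" by (simp add: L_def)
            also have "norm \<dots> \<le> (\<Sum>n. K * (norm h)\<^sup>2 * q ^ n)"
              using a_le[of "\<alpha> + h"] h by (intro norm_suminf_le sum_q) (simp add: dist_norm)
            also have "\<dots> = K * (norm h)\<^sup>2 / (1 - q)"
              using q by (simp add: suminf_mult suminf_geometric summable_geometric)
            finally show ?thesis
              using h q by (simp add: norm_divide power2_eq_square divide_simps)
          qed
          then show "\<forall>\<^sub>F h in at 0. norm ((L (\<alpha> + h) - h) / h) \<le> K / (1 - q) * norm h"
            unfolding eventually_at using r(1) by (intro exI[of _ r]) simp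
          show "(\<lambda>h. K / (1 - q) * norm h) \<midarrow>0\<rightarrow> 0"
            by (rule tendsto_eq_intros refl | simp)+
        qed
        from tendsto_add[OF this tendsto_const[of 1]]
        show "(\<lambda>h. (L (\<alpha> + h) - h) / h + 1) \<midarrow>0\<rightarrow> 1" by simp
        show "\<forall>\<^sub>F h in at 0. (L (\<alpha> + h) - h) / h + 1 = (\<phi> (\<alpha> + h) - \<phi> \<alpha>) / h"
          unfolding eventually_at using r(1)
          by (intro exI[of _ r]) (simp add: \<phi>_ball \<phi>0 dist_norm divide_simps)
      qed
    qed
    show "\<phi> (G z) = lam * \<phi> z" if z: "z \<in> D" for z
    proof (rule LIMSEQ_unique)
      show "(\<lambda>n. P n (G z)) \<longlonglongrightarrow> \<phi> (G z)"
        using \<phi>_lim z G_D by blast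
      have "(\<lambda>n. P (Suc n) z) \<longlonglongrightarrow> \<phi> z"
        using \<phi>_lim[OF z] by (rule LIMSEQ_Suc)
      then have "(\<lambda>n. lam * P (Suc n) z) \<longlonglongrightarrow> lam * \<phi> z"
        by (intro tendsto_mult tendsto_const)
      moreover have "lam * P (Suc n) z = P n (G z)" for n
        using lam_nonzero by (simp add: P_def funpow_swap1)
      ultimately show "(\<lambda>n. P n (G z)) \<longlonglongrightarrow> lam * \<phi> z" by simp
    qed
  qed
qed

end

locale linearized_domain = attracting_domain +
  fixes \<phi> :: "complex \<Rightarrow> complex"
  assumes \<phi>_holomorphic: "\<phi> holomorphic_on D" and \<phi>_\<alpha> [simp]: "\<phi> \<alpha> = 0"
    and deriv_\<phi>: "deriv \<phi> \<alpha> = 1" and \<phi>_G: "\<And>z. z \<in> D \<Longrightarrow> \<phi> (G z) = lam * \<phi> z"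
begin

lemma \<phi>_iterate: "z \<in> D \<Longrightarrow> \<phi> ((G ^^ n) z) = lam ^ n * \<phi> z"
  by (induction n) (auto simp: \<phi>_G iterate_in_D)

lemma linear_ball:
  obtains r c where "0 < r" "cball \<alpha> r \<subseteq> D" "inj_on \<phi> (cball \<alpha> r)" "0 < c" "c < 1"
    "\<And>z. z \<in> cball \<alpha> r \<Longrightarrow> norm (G z - \<alpha>) \<le> c * norm (z - \<alpha>)"
proof -
  obtain r c C where r: "r > 0" "cball \<alpha> r \<subseteq> D" and c: "0 < c" "c < 1"
    and contr: "\<And>z. z \<in> cball \<alpha> r \<Longrightarrow> norm (G z - \<alpha>) \<le> c * norm (z - \<alpha>)"
    using local_bounds by metis
  obtain s where s: "s > 0" "inj_on \<phi> (ball \<alpha> s)"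
    using has_complex_derivative_locally_injective[OF \<phi>_holomorphic \<alpha>_in_D open_D]
    by (metis deriv_\<phi> zero_neq_one)
  show ?thesis
  proof (rule that[of "min r (s/2)" c])
    show "inj_on \<phi> (cball \<alpha> (min r (s/2)))"
      by (rule inj_on_subset[OF s(2)]) (use s(1) in auto)
    show "norm (G z - \<alpha>) \<le> c * norm (z - \<alpha>)" if "z \<in> cball \<alpha> (min r (s/2))" for z
      using contr that by simp
    show "cball \<alpha> (min r (s / 2)) \<subseteq> D" using r(2) by force
  qed (use r s c in auto)
qed

lemma lim_\<phi>: "((\<lambda>z. \<phi> z / (z - \<alpha>)) \<longlongrightarrow> 1) (at \<alpha>)"
  using holomorphic_derivI[OF \<phi>_holomorphic open_D \<alpha>_in_D] deriv_\<phi>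
  by (simp add: has_field_derivative_iff)

lemma lim_\<phi>_comp:
  assumes K: "K holomorphic_on UNIV" "K \<alpha> = \<alpha>"
  shows "((\<lambda>z. \<phi> (K z) / (z - \<alpha>)) \<longlongrightarrow> deriv K \<alpha>) (at \<alpha>)"
proof -
  have "(\<phi> has_field_derivative 1) (at (K \<alpha>))"
    using holomorphic_derivI[OF \<phi>_holomorphic open_D \<alpha>_in_D] deriv_\<phi> K by simp
  from DERIV_chain2[OF this entire_DERIV[OF K(1)]]
  show ?thesis by (simp add: has_field_derivative_iff K)
qed

end

section \<open>Ping-pong near an attracting fixed point\<close>

text \<open>
  The map \<open>h ^^ d\<close> sends a small disc \<open>U\<close> around \<open>\<delta>\<close> very close to \<open>\<delta>\<close>, while \<open>h ^^ e \<circ> k\<close> sends \<open>U\<close> to a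
  compact subset of \<open>U\<close> that misses \<open>\<delta>\<close>.
\<close>

lemma attracting_ping_pong:
  assumes h: "h holomorphic_on UNIV" and k: "k holomorphic_on UNIV"
    and \<rho>0: "0 < \<rho>0" "inj_on h (ball \<delta> \<rho>0)" and h\<delta>: "h \<delta> = \<delta>"
    and contr: "\<And>x. x \<in> ball \<delta> \<rho>0 \<Longrightarrow> dist \<delta> (h x) \<le> dist \<delta> x / 2"
    and k': "deriv k \<delta> \<noteq> 0" and k\<delta>: "k \<delta> \<in> ball \<delta> \<rho>0" "k \<delta> \<noteq> \<delta>"
  obtains d e where "d \<ge> 1"
    "\<And>v w. word_val (h ^^ d) ((h ^^ e) \<circ> k) v = word_val (h ^^ d) ((h ^^ e) \<circ> k) w \<Longrightarrow> v = w"
proof -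
  have h_n: "dist \<delta> ((h ^^ n) x) \<le> (1/2) ^ n * dist \<delta> x" "(h ^^ n) x \<in> ball \<delta> \<rho>0"
    if "x \<in> ball \<delta> \<rho>0" for n x
  proof -
    have "dist \<delta> ((h ^^ n) x) \<le> (1/2) ^ n * dist \<delta> x \<and> (h ^^ n) x \<in> ball \<delta> \<rho>0"
    proof (induction n)
      case (Suc n)
      then have *: "dist \<delta> ((h ^^ Suc n) x) \<le> dist \<delta> ((h ^^ n) x) / 2"
        using contr by simp
      moreover have "dist \<delta> ((h ^^ n) x) / 2 < \<rho>0"
        using Suc by (simp add: field_simps) (smt (verit) zero_le_dist)
      ultimately show ?case using Suc by simp
    qed (use that in simp)
    then show "dist \<delta> ((h ^^ n) x) \<le> (1/2) ^ n * dist \<delta> x" "(h ^^ n) x \<in> ball \<delta> \<rho>0" by auto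
  qed
  have inj_n: "inj_on (h ^^ n) (ball \<delta> \<rho>0)" for n
  proof (induction n)
    case (Suc n)
    have "inj_on h ((h ^^ n) ` ball \<delta> \<rho>0)"
      using \<rho>0(2) h_n(2) by (meson image_subsetI inj_on_subset)
    then show ?case unfolding funpow.simps(2) by (rule comp_inj_on[OF Suc])
  qed simp
  obtain \<rho>1 where \<rho>1: "0 < \<rho>1" "inj_on k (ball \<delta> \<rho>1)"
    using has_complex_derivative_locally_injective[OF k _ _ k'] by (metis UNIV_I open_UNIV)
  have "open (ball \<delta> \<rho>0 - {\<delta>})" by (intro open_Diff) auto
  then obtain \<eta> where \<eta>: "0 < \<eta>" "cball (k \<delta>) \<eta> \<subseteq> ball \<delta> \<rho>0 - {\<delta>}"
    using k\<delta> open_contains_cball by (metis Diff_iff singletonD)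
  obtain \<rho>2 where \<rho>2: "0 < \<rho>2" "\<And>x. dist x \<delta> < \<rho>2 \<Longrightarrow> dist (k x) (k \<delta>) < \<eta>"
    using entire_isCont[OF k, of \<delta>] \<eta>(1) unfolding continuous_at_eps_delta by metis
  define \<rho> where "\<rho> = min \<rho>0 (min \<rho>1 \<rho>2)"
  have \<rho>: "0 < \<rho>" "\<rho> \<le> \<rho>0" "\<rho> \<le> \<rho>1" "\<rho> \<le> \<rho>2" using \<rho>0 \<rho>1 \<rho>2 by (auto simp: \<rho>_def)
  have k_U: "k x \<in> cball (k \<delta>) \<eta>" if "x \<in> ball \<delta> \<rho>" for x
    using \<rho>2(2)[of x] that \<rho> by (simp add: dist_commute)
  have small: "\<exists>n\<ge>1. (1/2) ^ n * a < b" if "0 < b" "0 < a" for a b :: real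
  proof -
    obtain n where n: "(1/2) ^ n < b / a"
      using real_arch_pow_inv[of "b / a" "1/2"] \<open>0 < a\<close> \<open>0 < b\<close> by auto
    have "(1/2::real) ^ Suc n \<le> (1/2) ^ n" by simp
    then have "(1/2) ^ Suc n < b / a" using n by linarith
    then show ?thesis
      using \<open>0 < a\<close> by (intro exI[of _ "Suc n"]) (simp add: pos_less_divide_eq)
  qed
  obtain e where e: "(1/2) ^ e * \<rho>0 < \<rho>" using small[of \<rho> \<rho>0] \<rho> \<rho>0 by blast
  define Q where "Q = (h ^^ e) ` cball (k \<delta>) \<eta>"
  have "compact Q"
    unfolding Q_def using holomorphic_on_imp_continuous_on[OF entire_funpow[OF h]]
    by (intro compact_continuous_image) (auto intro: continuous_on_subset)
  moreover have "\<delta> \<notin> Q"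
  proof
    assume "\<delta> \<in> Q"
    then obtain x where x: "x \<in> cball (k \<delta>) \<eta>" "(h ^^ e) x = \<delta>" unfolding Q_def by auto
    moreover have "(h ^^ e) \<delta> = \<delta>" using h\<delta> by (induction e) auto
    ultimately have "x = \<delta>"
      using inj_onD[OF inj_n[of e], of x \<delta>] \<eta>(2) \<rho>0(1) by auto
    then show False using x(1) \<eta>(2) by auto
  qed
  ultimately have "open (- Q)" "\<delta> \<in> - Q" by (auto simp: compact_imp_closed open_Compl)
  then obtain \<eta>' where \<eta>': "0 < \<eta>'" "ball \<delta> \<eta>' \<subseteq> - Q" using open_contains_ball by blast
  obtain d where d: "d \<ge> 1" "(1/2) ^ d * \<rho> < \<eta>'" using small[of \<eta>' \<rho>] \<rho> \<eta>' by blast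
  have B_Q: "((h ^^ e) \<circ> k) x \<in> Q" if "x \<in> ball \<delta> \<rho>" for x
    using k_U[OF that] by (simp add: Q_def)
  have A_lt: "dist \<delta> ((h ^^ d) x) < \<eta>'" "dist \<delta> ((h ^^ d) x) < \<rho>" if x: "x \<in> ball \<delta> \<rho>" for x
  proof -
    have *: "dist \<delta> ((h ^^ d) x) \<le> (1/2) ^ d * dist \<delta> x"
      using h_n(1)[of x d] x \<rho> by simp
    also have "\<dots> \<le> (1/2) ^ d * \<rho>" using x by (intro mult_left_mono) auto
    finally show "dist \<delta> ((h ^^ d) x) < \<eta>'" using d by simp
    have "(1/2::real) ^ d * dist \<delta> x \<le> 1 * dist \<delta> x"
      by (intro mult_right_mono power_le_one) auto
    then show "dist \<delta> ((h ^^ d) x) < \<rho>" using * x by simp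
  qed
  show ?thesis
  proof (rule that[OF d(1)])
    fix v w assume eq: "word_val (h ^^ d) ((h ^^ e) \<circ> k) v = word_val (h ^^ d) ((h ^^ e) \<circ> k) w"
    show "v = w"
    proof (rule ping_pong[where U = "ball \<delta> \<rho>" and A = "h ^^ d" and B = "(h ^^ e) \<circ> k"])
      show "ball \<delta> \<rho> \<noteq> {}" using \<rho> by simp
      show "(h ^^ d) ` ball \<delta> \<rho> \<subseteq> ball \<delta> \<rho>" using A_lt(2) by auto
      show "((h ^^ e) \<circ> k) ` ball \<delta> \<rho> \<subseteq> ball \<delta> \<rho>"
      proof clarify
        fix x assume "x \<in> ball \<delta> \<rho>"
        then have kx: "k x \<in> ball \<delta> \<rho>0" using k_U \<eta>(2) by blast
        have "dist \<delta> ((h ^^ e) (k x)) \<le> (1/2) ^ e * dist \<delta> (k x)" by (rule h_n(1)[OF kx])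
        also have "\<dots> \<le> (1/2) ^ e * \<rho>0" using kx by (intro mult_left_mono) auto
        finally show "((h ^^ e) \<circ> k) x \<in> ball \<delta> \<rho>" using e by simp
      qed
      show "inj_on (h ^^ d) (ball \<delta> \<rho>)"
        by (rule inj_on_subset[OF inj_n]) (use \<rho> in auto)
      show "inj_on ((h ^^ e) \<circ> k) (ball \<delta> \<rho>)"
      proof (rule comp_inj_on)
        show "inj_on k (ball \<delta> \<rho>)" by (rule inj_on_subset[OF \<rho>1(2)]) (use \<rho> in auto)
        show "inj_on (h ^^ e) (k ` ball \<delta> \<rho>)"
          by (rule inj_on_subset[OF inj_n]) (use k_U \<eta>(2) in blast)
      qed
      show "(h ^^ d) ` ball \<delta> \<rho> \<inter> ((h ^^ e) \<circ> k) ` ball \<delta> \<rho> = {}"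
        using A_lt(1) B_Q \<eta>'(2) by (fastforce simp: subset_iff)
      show "word_val (h ^^ d) ((h ^^ e) \<circ> k) v x = word_val (h ^^ d) ((h ^^ e) \<circ> k) w x" for x
        using eq by simp
    qed
  qed
qed

context linearized_domain
begin

text \<open>
  For large \<open>a\<close> the map \<open>h = G ^^ a \<circ> F\<close> contracts a disc around \<open>\<alpha>\<close> into itself. Its fixed point \<open>\<delta>\<close> is
  not \<open>\<alpha>\<close>, and this is the point of passing to \<open>h\<close>: even if \<open>F\<close> is critical at \<open>\<alpha>\<close>, it is injective near
  \<open>\<delta>\<close>. The points \<open>(G ^^ j) \<delta>\<close> tend to \<open>\<alpha>\<close>, hence enter the disc, and a fixed iterate \<open>h ^^ m\<close> takes the disc
  close to \<open>\<delta>\<close>. Since the zeros of \<open>h ^^ m - \<delta>\<close> and of its derivative are isolated, for large \<open>j\<close> the map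
  \<open>h ^^ m \<circ> G ^^ j\<close> is regular at \<open>\<delta>\<close> and moves \<open>\<delta>\<close>, and ping-pong applies.
\<close>

lemma free_if_moves_off_fibre:
  assumes F: "F holomorphic_on UNIV" "\<not> F constant_on UNIV" and F\<alpha>: "F \<alpha> \<in> D" "\<phi> (F \<alpha>) \<noteq> 0"
  shows "contains_free {F, G}"
proof -
  obtain r c where r: "0 < r" "cball \<alpha> r \<subseteq> D" "inj_on \<phi> (cball \<alpha> r)" and c: "0 < c" "c < 1"
    and contr: "\<And>z. z \<in> cball \<alpha> r \<Longrightarrow> norm (G z - \<alpha>) \<le> c * norm (z - \<alpha>)"
    using linear_ball by metis
  have inj_G: "inj_on (G ^^ n) (cball \<alpha> r)" for n
  proof (rule inj_onI)
    fix x y assume xy: "x \<in> cball \<alpha> r" "y \<in> cball \<alpha> r" "(G ^^ n) x = (G ^^ n) y"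
    then have "lam ^ n * \<phi> x = lam ^ n * \<phi> y" using r(2) \<phi>_iterate by (metis subsetD)
    then show "x = y" using lam_nonzero xy r(3) by (auto dest: inj_onD)
  qed
  have regular_G: "deriv (G ^^ n) z \<noteq> 0" if "z \<in> ball \<alpha> r" for n z
  proof (rule holomorphic_injective_imp_regular[of _ "ball \<alpha> r"])
    show "inj_on (G ^^ n) (ball \<alpha> r)" by (rule inj_on_subset[OF inj_G]) auto
  qed (use that holomorphic_on_subset[OF entire_iterate] in auto)
  obtain N where N: "(G ^^ N) (F \<alpha>) \<in> ball \<alpha> r"
    using enters_ball[OF F\<alpha>(1) r(1)] .
  define F1 where "F1 = (G ^^ N) \<circ> F"
  have F1: "F1 holomorphic_on UNIV" "\<not> F1 constant_on UNIV"
    unfolding F1_def using entire_comp[OF entire_iterate F(1)]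
      entire_nonconstant_comp[OF entire_iterate F(1) entire_nonconstant_funpow[OF entire nonconstant] F(2)] by auto
  obtain s where s: "0 < s" "s \<le> r" "\<And>z. z \<in> cball \<alpha> s \<Longrightarrow> F1 z \<in> ball \<alpha> r"
    "\<And>z. z \<in> cball \<alpha> s \<Longrightarrow> z \<noteq> \<alpha> \<Longrightarrow> deriv F1 z \<noteq> 0"
  proof -
    have "open (F1 -` ball \<alpha> r)"
      using entire_isCont[OF F1(1)] by (intro continuous_open_vimage) auto
    moreover have "\<alpha> \<in> F1 -` ball \<alpha> r" using N by (simp add: F1_def)
    ultimately obtain s1 where s1: "0 < s1" "cball \<alpha> s1 \<subseteq> F1 -` ball \<alpha> r"
      using open_contains_cball by blast
    obtain s2 where s2: "0 < s2" "\<And>z. z \<noteq> \<alpha> \<Longrightarrow> dist z \<alpha> < s2 \<Longrightarrow> deriv F1 z \<noteq> 0"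
      using entire_eventually_regular[OF F1, of \<alpha>] unfolding eventually_at by blast
    show ?thesis
    proof (rule that[of "min r (min s1 (s2/2))"])
      show "F1 z \<in> ball \<alpha> r" if "z \<in> cball \<alpha> (min r (min s1 (s2/2)))" for z
        using s1(2) that by auto
      show "deriv F1 z \<noteq> 0" if "z \<in> cball \<alpha> (min r (min s1 (s2/2)))" "z \<noteq> \<alpha>" for z
        using s2 that by (simp add: dist_commute)
    qed (use r s1 s2 in auto)
  qed
  \<comment> \<open>With values within \<open>s / 8\<close> of \<open>\<alpha>\<close> on the disc of radius \<open>s\<close>, the Cauchy inequality bounds the derivative on the disc of radius \<open>s / 2\<close> by \<open>1 / 4\<close>.\<close>
  obtain a where a: "c ^ a * r < s / 8"
  proof -
    obtain a where "c ^ a < s / 8 / r"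
      using real_arch_pow_inv[of "s / 8 / r" c] s(1) r(1) c by auto
    then have "c ^ a * r < s / 8" using r(1) by (simp add: pos_less_divide_eq)
    then show ?thesis by (rule that)
  qed
  define h where "h = (G ^^ a) \<circ> F1"
  have h: "h holomorphic_on UNIV" "\<not> h constant_on UNIV"
    unfolding h_def using entire_comp[OF entire_iterate F1(1)]
      entire_nonconstant_comp[OF entire_iterate F1(1) entire_nonconstant_funpow[OF entire nonconstant] F1(2)] by auto
  have h_small: "norm (h z - \<alpha>) < s / 8" if "z \<in> cball \<alpha> s" for z
  proof -
    have F1z: "F1 z \<in> ball \<alpha> r" using s(3) that by blast
    have "norm (h z - \<alpha>) \<le> c ^ a * norm (F1 z - \<alpha>)"
      unfolding h_def o_apply
      by (rule iterate_local[OF contr]) (use c F1z in auto)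
    also have "\<dots> \<le> c ^ a * r"
      using F1z c by (intro mult_left_mono) (auto simp: dist_norm norm_minus_commute)
    finally show ?thesis using a by linarith
  qed
  have h_deriv: "norm (deriv h x) \<le> 1/4" if x: "x \<in> cball \<alpha> (s/2)" for x
  proof -
    have "norm ((deriv ^^ 1) (\<lambda>z. h z - \<alpha>) x) \<le> fact 1 * (s / 8) / (s/2) ^ 1"
    proof (rule Cauchy_inequality)
      show "(\<lambda>z. h z - \<alpha>) holomorphic_on ball x (s/2)"
        using holomorphic_on_subset[OF h(1)] by (intro holomorphic_intros) auto
      show "continuous_on (cball x (s/2)) (\<lambda>z. h z - \<alpha>)"
        using continuous_on_subset[OF holomorphic_on_imp_continuous_on[OF h(1)]]
        by (intro continuous_intros) auto
      show "norm (h z - \<alpha>) \<le> s / 8" if "norm (x - z) = s / 2" for z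
      proof -
        have "dist \<alpha> z \<le> dist \<alpha> x + dist x z" by (rule dist_triangle)
        then have "z \<in> cball \<alpha> s" using that x by (simp add: dist_norm)
        then show ?thesis using h_small[of z] by simp
      qed
    qed (use s(1) in auto)
    moreover have "deriv (\<lambda>z. h z - \<alpha>) x = deriv h x"
      using entire_DERIV[OF h(1), of x] by (intro DERIV_imp_deriv) (auto intro!: derivative_eq_intros)
    ultimately show ?thesis using s(1) by simp
  qed
  have lip: "norm (h x - h y) \<le> 1/4 * norm (x - y)" if "x \<in> cball \<alpha> (s/2)" "y \<in> cball \<alpha> (s/2)" for x y
  proof (rule field_differentiable_bound[of "cball \<alpha> (s/2)" h "deriv h"])
    show "(h has_field_derivative deriv h z) (at z within cball \<alpha> (s / 2))" for z
      using entire_DERIV[OF h(1)] has_field_derivative_at_within by blast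
  qed (use h_deriv that in auto)
  have h_self: "h ` cball \<alpha> (s/2) \<subseteq> cball \<alpha> (s/2)"
  proof
    fix y assume "y \<in> h ` cball \<alpha> (s/2)"
    then obtain x where x: "x \<in> cball \<alpha> (s/2)" "y = h x" by blast
    then have "x \<in> cball \<alpha> s" using s(1) by auto
    then show "y \<in> cball \<alpha> (s/2)" using h_small[of x] x s(1) by (simp add: dist_norm norm_minus_commute)
  qed
  obtain \<delta> where \<delta>: "\<delta> \<in> cball \<alpha> (s/2)" "h \<delta> = \<delta>"
  proof -
    have "\<exists>!x\<in>cball \<alpha> (s/2). h x = x"
    proof (rule Banach_fix[where c = "1/4"])
      show "complete (cball \<alpha> (s/2))" by (simp add: compact_imp_complete)
      show "dist (h x) (h y) \<le> 1/4 * dist x y" if "x \<in> cball \<alpha> (s/2)" "y \<in> cball \<alpha> (s/2)" for x y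
        using lip[OF that] by (simp add: dist_norm)
    qed (use s(1) h_self in auto)
    then show ?thesis using that by blast
  qed
  have \<delta>_near: "dist \<alpha> \<delta> < s / 8"
    using h_small[of \<delta>] \<delta> s(1) by (simp add: dist_norm norm_minus_commute)
  have "h \<alpha> \<noteq> \<alpha>"
  proof
    assume "h \<alpha> = \<alpha>"
    moreover have "\<phi> (h \<alpha>) = lam ^ (a + N) * \<phi> (F \<alpha>)"
      using \<phi>_iterate[OF F\<alpha>(1), of "a + N"] by (simp add: h_def F1_def funpow_add)
    ultimately show False using F\<alpha>(2) lam_nonzero by simp
  qed
  then have "\<delta> \<noteq> \<alpha>" using \<delta>(2) by auto
  have \<delta>_ball: "\<delta> \<in> ball \<alpha> r" "\<delta> \<in> cball \<alpha> s" using \<delta>_near s(1,2) by auto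
  have "\<delta> \<in> D" using \<delta>_ball r(2) by auto
  have \<phi>\<delta>: "\<phi> \<delta> \<noteq> 0"
  proof
    assume "\<phi> \<delta> = 0"
    then have "\<delta> = \<alpha>" using inj_onD[OF r(3), of \<delta> \<alpha>] \<delta>_ball(1) r(1) by auto
    then show False using \<open>\<delta> \<noteq> \<alpha>\<close> by blast
  qed
  have "deriv h \<delta> = deriv (G ^^ a) (F1 \<delta>) * deriv F1 \<delta>"
    unfolding h_def by (rule entire_deriv_comp[OF entire_iterate F1(1)])
  then have "deriv h \<delta> \<noteq> 0"
    using regular_G[OF s(3)[OF \<delta>_ball(2)]] s(4)[OF \<delta>_ball(2) \<open>\<delta> \<noteq> \<alpha>\<close>] by simp
  then obtain \<rho>' where \<rho>': "0 < \<rho>'" "inj_on h (ball \<delta> \<rho>')"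
    using has_complex_derivative_locally_injective[OF h(1) UNIV_I open_UNIV] by metis
  define \<rho>0 where "\<rho>0 = min \<rho>' (s/4)"
  have \<rho>0: "0 < \<rho>0" "inj_on h (ball \<delta> \<rho>0)"
  proof -
    show "0 < \<rho>0" using \<rho>' s(1) by (simp add: \<rho>0_def)
    show "inj_on h (ball \<delta> \<rho>0)" by (rule inj_on_subset[OF \<rho>'(2)]) (simp add: \<rho>0_def subset_ball)
  qed
  have ball_sub: "ball \<delta> \<rho>0 \<subseteq> cball \<alpha> (s/2)"
  proof
    fix x assume "x \<in> ball \<delta> \<rho>0"
    then have "dist \<delta> x < s/4" by (simp add: \<rho>0_def)
    then show "x \<in> cball \<alpha> (s/2)" using \<delta>_near dist_triangle[of \<alpha> x \<delta>] s(1) by simp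
  qed
  have to_\<delta>: "dist \<delta> (h x) \<le> dist \<delta> x / 4" if "x \<in> cball \<alpha> (s/2)" for x
    using lip[OF \<delta>(1) that] \<delta>(2) by (simp add: dist_norm)
  have to_\<delta>_n: "dist \<delta> ((h ^^ n) x) \<le> (1/4) ^ n * s" if x: "x \<in> cball \<alpha> (s/2)" for n x
  proof -
    have "dist \<delta> ((h ^^ n) x) \<le> (1/4) ^ n * dist \<delta> x \<and> (h ^^ n) x \<in> cball \<alpha> (s/2)"
    proof (induction n)
      case (Suc n)
      then show ?case
        using to_\<delta>[of "(h ^^ n) x"] h_self by (auto simp del: mem_cball)
    qed (use x in simp)
    moreover have "dist \<delta> x \<le> s"
      using dist_triangle[of \<delta> x \<alpha>] x \<delta>_near s(1) by (simp add: dist_commute)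
    then have "(1/4) ^ n * dist \<delta> x \<le> (1/4) ^ n * s" by (intro mult_left_mono) auto
    ultimately show ?thesis by linarith
  qed
  obtain m where m: "(1/4) ^ m * s < \<rho>0"
  proof -
    obtain m where "(1/4) ^ m < \<rho>0 / s"
      using real_arch_pow_inv[of "\<rho>0 / s" "1/4"] \<rho>0(1) s(1) by auto
    then show ?thesis using that s(1) by (simp add: pos_less_divide_eq)
  qed
  define P where "P = h ^^ m"
  have P: "P holomorphic_on UNIV" "\<not> P constant_on UNIV"
    unfolding P_def using entire_funpow[OF h(1)] entire_nonconstant_funpow[OF h] by auto
  have "filterlim (\<lambda>j. (G ^^ j) \<delta>) (at \<alpha>) sequentially"
    unfolding filterlim_at
  proof
    have "(G ^^ j) \<delta> \<noteq> \<alpha>" for j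
    proof
      assume "(G ^^ j) \<delta> = \<alpha>"
      then show False using \<phi>_iterate[OF \<open>\<delta> \<in> D\<close>, of j] \<phi>\<delta> lam_nonzero by simp
    qed
    then show "\<forall>\<^sub>F j in sequentially. (G ^^ j) \<delta> \<in> UNIV \<and> (G ^^ j) \<delta> \<noteq> \<alpha>" by simp
  qed (rule convergence[OF \<open>\<delta> \<in> D\<close>])
  moreover have "\<forall>\<^sub>F z in at \<alpha>. z \<in> cball \<alpha> (s/2) \<and> P z \<noteq> \<delta> \<and> deriv P z \<noteq> 0"
  proof (intro eventually_conj)
    show "\<forall>\<^sub>F z in at \<alpha>. z \<in> cball \<alpha> (s/2)"
      unfolding eventually_at using s(1) by (intro exI[of _ "s/2"]) (auto simp: dist_commute)
  qed (rule entire_eventually_ne[OF P] entire_eventually_regular[OF P])+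
  ultimately have "\<forall>\<^sub>F j in sequentially. (G ^^ j) \<delta> \<in> cball \<alpha> (s/2) \<and> P ((G ^^ j) \<delta>) \<noteq> \<delta> \<and> deriv P ((G ^^ j) \<delta>) \<noteq> 0"
    unfolding filterlim_iff by blast
  then have "\<forall>\<^sub>F j in sequentially. ((G ^^ j) \<delta> \<in> cball \<alpha> (s/2) \<and> P ((G ^^ j) \<delta>) \<noteq> \<delta> \<and> deriv P ((G ^^ j) \<delta>) \<noteq> 0) \<and> j \<ge> 1"
    by (rule eventually_conj) (rule eventually_ge_at_top)
  then obtain j where j: "(G ^^ j) \<delta> \<in> cball \<alpha> (s/2)" "P ((G ^^ j) \<delta>) \<noteq> \<delta>" "deriv P ((G ^^ j) \<delta>) \<noteq> 0" "j \<ge> 1"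
    using eventually_happens'[OF sequentially_bot] by blast
  define k where "k = P \<circ> (G ^^ j)"
  have k: "k holomorphic_on UNIV" unfolding k_def by (rule entire_comp[OF P(1) entire_iterate])
  obtain d e where de: "d \<ge> 1"
    "\<And>v w. word_val (h ^^ d) ((h ^^ e) \<circ> k) v = word_val (h ^^ d) ((h ^^ e) \<circ> k) w \<Longrightarrow> v = w"
  proof (rule attracting_ping_pong[OF h(1) k \<rho>0 \<delta>(2)])
    show "dist \<delta> (h x) \<le> dist \<delta> x / 2" if "x \<in> ball \<delta> \<rho>0" for x
    proof -
      have "dist \<delta> (h x) \<le> dist \<delta> x / 4" using to_\<delta> ball_sub that by blast
      then show ?thesis using zero_le_dist[of \<delta> x] by linarith
    qed
    show "deriv k \<delta> \<noteq> 0"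
      unfolding k_def entire_deriv_comp[OF P(1) entire_iterate] using j(3) regular_G[OF \<delta>_ball(1)] by simp
    show "k \<delta> \<noteq> \<delta>" unfolding k_def using j(2) by simp
    show "k \<delta> \<in> ball \<delta> \<rho>0"
      unfolding k_def P_def using to_\<delta>_n[OF j(1), of m] m by simp
  qed blast
  have gen: "F \<in> generated_semigroup {F, G}" "G \<in> generated_semigroup {F, G}"
    by (auto intro: generated_semigroup.generator)
  have h_gen: "h \<in> generated_semigroup {F, G}"
    unfolding h_def F1_def by (intro funpow_comp_in_generated_semigroup gen)
  show ?thesis
  proof (rule contains_freeI)
    show "h ^^ d \<in> generated_semigroup {F, G}"
      by (rule funpow_in_generated_semigroup[OF h_gen de(1)])
    show "(h ^^ e) \<circ> k \<in> generated_semigroup {F, G}"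
      unfolding k_def P_def
      by (intro funpow_comp_in_generated_semigroup h_gen funpow_in_generated_semigroup gen j(4))
  qed (rule de(2))
qed

end

section \<open>Germs at a common fixed point\<close>

text \<open>
  The map \<open>h\<close> fixes \<open>a\<close> and has the expansion \<open>h z = a + A (z - a) ^ n + \<dots>\<close> at \<open>a\<close>.
\<close>

definition leading_term :: "complex \<Rightarrow> (complex \<Rightarrow> complex) \<Rightarrow> nat \<Rightarrow> complex \<Rightarrow> bool" where
  "leading_term a h n A \<longleftrightarrow> A \<noteq> 0 \<and> (h \<longlongrightarrow> a) (at a) \<and>
     ((\<lambda>z. (h z - a) / (z - a) ^ n) \<longlongrightarrow> A) (at a)"

lemma leading_term_id: "leading_term a id 1 1"
proof -
  have "((\<lambda>z. (z - a) / (z - a) ^ 1) \<longlongrightarrow> 1) (at a)"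
    by (rule Lim_transform_eventually[OF tendsto_const]) (simp add: eventually_at_filter)
  then show ?thesis by (simp add: leading_term_def tendsto_ident_at id_def)
qed

lemma leading_term_comp:
  assumes h: "leading_term a h n A" and k: "leading_term a k m B"
  shows "leading_term a (h \<circ> k) (m * n) (A * B ^ n)"
proof -
  have AB: "A \<noteq> 0" "B \<noteq> 0" using h k by (auto simp: leading_term_def)
  have lim_k: "((\<lambda>z. (k z - a) / (z - a) ^ m) \<longlongrightarrow> B) (at a)" using k by (simp add: leading_term_def)
  have k_ne: "\<forall>\<^sub>F z in at a. k z \<noteq> a"
    using tendsto_imp_eventually_ne[OF lim_k AB(2)] by (rule eventually_mono) auto
  then have fk: "filterlim k (at a) (at a)"
    using k by (simp add: filterlim_at leading_term_def)
  have "((\<lambda>z. (h (k z) - a) / (k z - a) ^ n * ((k z - a) / (z - a) ^ m) ^ n) \<longlongrightarrow> A * B ^ n) (at a)"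
  proof (intro tendsto_mult tendsto_power lim_k)
    have "((\<lambda>w. (h w - a) / (w - a) ^ n) \<longlongrightarrow> A) (at a)" using h by (simp add: leading_term_def)
    then show "((\<lambda>z. (h (k z) - a) / (k z - a) ^ n) \<longlongrightarrow> A) (at a)"
      by (rule filterlim_compose[OF _ fk])
  qed
  moreover have "\<forall>\<^sub>F z in at a. (h (k z) - a) / (k z - a) ^ n * ((k z - a) / (z - a) ^ m) ^ n
      = ((h \<circ> k) z - a) / (z - a) ^ (m * n)"
    using k_ne by (rule eventually_mono) (simp add: power_divide power_mult)
  ultimately have "((\<lambda>z. ((h \<circ> k) z - a) / (z - a) ^ (m * n)) \<longlongrightarrow> A * B ^ n) (at a)"
    by (rule Lim_transform_eventually)
  moreover have "((h \<circ> k) \<longlongrightarrow> a) (at a)"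
    unfolding o_def by (rule filterlim_compose[OF _ fk]) (use h in \<open>simp add: leading_term_def\<close>)
  ultimately show ?thesis using AB by (simp add: leading_term_def)
qed

lemma leading_term_unique:
  assumes "leading_term a h n A" and "leading_term a h m B"
  shows "n = m \<and> A = B"
proof -
  have *: "n = m" if h: "leading_term a h n A" "leading_term a h m B" and "n \<le> m" for n m A B
  proof (rule ccontr)
    assume "n \<noteq> m"
    then have "m - n > 0" using \<open>n \<le> m\<close> by simp
    have "((\<lambda>z. (h z - a) / (z - a) ^ m * (z - a) ^ (m - n)) \<longlongrightarrow> B * (a - a) ^ (m - n)) (at a)"
      by (intro tendsto_mult tendsto_power tendsto_diff tendsto_ident_at tendsto_const)
         (use h(2) in \<open>simp add: leading_term_def\<close>)
    moreover have "\<forall>\<^sub>F z in at a. (h z - a) / (z - a) ^ m * (z - a) ^ (m - n) = (h z - a) / (z - a) ^ n"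
    proof -
      have "(h z - a) / (z - a) ^ m * (z - a) ^ (m - n) = (h z - a) / (z - a) ^ n" if "z \<noteq> a" for z
      proof -
        have "(z - a) ^ m = (z - a) ^ n * (z - a) ^ (m - n)"
          using \<open>n \<le> m\<close> by (simp flip: power_add)
        then show ?thesis using that by simp
      qed
      then show ?thesis by (simp add: eventually_at_filter)
    qed
    ultimately have "((\<lambda>z. (h z - a) / (z - a) ^ n) \<longlongrightarrow> B * (a - a) ^ (m - n)) (at a)"
      by (rule Lim_transform_eventually)
    then have "((\<lambda>z. (h z - a) / (z - a) ^ n) \<longlongrightarrow> 0) (at a)"
      using \<open>m - n > 0\<close> by (simp add: zero_power)
    then show False
      using h(1) tendsto_unique[of "at a"] unfolding leading_term_def by force
  qed
  have "n = m" using *[OF assms] *[OF assms(2,1)] by linarith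
  moreover have "A = B"
    by (rule tendsto_unique[of "at a" "\<lambda>z. (h z - a) / (z - a) ^ n"])
       (use assms \<open>n = m\<close> in \<open>simp_all add: leading_term_def\<close>)
  ultimately show ?thesis ..
qed

lemma leading_term_entire:
  assumes K: "K holomorphic_on UNIV" "\<not> K constant_on UNIV" and "K a = a"
  obtains n A where "n \<ge> 1" "leading_term a K n A"
proof -
  have nc: "\<not> (\<lambda>z. K z - a) constant_on UNIV"
    using K(2) unfolding constant_on_def by (metis diff_add_cancel)
  have hol: "(\<lambda>z. K z - a) holomorphic_on UNIV"
    using K(1) by (intro holomorphic_intros)
  obtain g r n where n: "0 < n" and r: "0 < r" and g: "g holomorphic_on ball a r"
    "\<And>w. w \<in> ball a r \<Longrightarrow> K w - a = (w - a) ^ n * g w" "\<And>w. w \<in> ball a r \<Longrightarrow> g w \<noteq> 0"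
    by (rule holomorphic_factor_zero_nonconstant[OF hol open_UNIV connected_UNIV UNIV_I _ nc])
       (use assms(3) in auto)
  have "(g \<longlongrightarrow> g a) (at a)"
    using g(1) r by (metis at_within_open centre_in_ball continuous_on holomorphic_on_imp_continuous_on open_ball)
  moreover have "\<forall>\<^sub>F z in at a. g z = (K z - a) / (z - a) ^ n"
    unfolding eventually_at using r g(2) by (intro exI[of _ r]) (simp add: dist_commute)
  ultimately have "((\<lambda>z. (K z - a) / (z - a) ^ n) \<longlongrightarrow> g a) (at a)"
    by (rule Lim_transform_eventually)
  moreover have "(K \<longlongrightarrow> a) (at a)"
    using entire_isCont[OF K(1), of a] assms(3) by (simp add: isCont_def)
  ultimately show ?thesis
    using that[of n "g a"] n g(3)[of a] r by (simp add: leading_term_def)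
qed

lemma leading_term_1_iff:
  assumes "h holomorphic_on UNIV" "h a = a"
  shows "leading_term a h 1 A \<longleftrightarrow> A \<noteq> 0 \<and> deriv h a = A"
proof -
  have "(h \<longlongrightarrow> a) (at a)"
    using entire_isCont[OF assms(1), of a] assms(2) by (simp add: isCont_def)
  moreover have "((\<lambda>z. (h z - a) / (z - a)) \<longlongrightarrow> deriv h a) (at a)"
    using entire_DERIV[OF assms(1), of a] assms(2) by (simp add: has_field_derivative_iff)
  ultimately show ?thesis
    unfolding leading_term_def using tendsto_unique[of "at a"] by (auto simp: eventually_at_filter)
qed

text \<open>
  The number whose base \<open>s\<close> digits, least significant first, are given by the word; \<open>True\<close> stands for
  the digit \<open>0\<close>.
\<close>

fun digit_sum :: "nat \<Rightarrow> bool list \<Rightarrow> nat" where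
  "digit_sum s [] = 0"
| "digit_sum s (b # w) = (if b then 0 else 1) + s * digit_sum s w"

lemma digit_sum_inj:
  assumes "s \<ge> 2" "length v = length w" "digit_sum s v = digit_sum s w"
  shows "v = w"
  using assms(2,3)
proof (induction v w rule: list_induct2)
  case (Cons b v c w)
  have "digit_sum s (b # v) mod s = (if b then 0 else 1)" for b v
    using assms(1) by simp
  then have "b = c" using Cons.prems by (metis zero_neq_one)
  then have "digit_sum s v = digit_sum s w" using Cons.prems assms(1) by simp
  then show ?case using Cons.IH \<open>b = c\<close> by simp
qed simp

context attracting_domain
begin

text \<open>
  If \<open>K\<close> has local degree \<open>s \<ge> 2\<close> at \<open>\<alpha>\<close>, a word of length \<open>k\<close> in \<open>K\<close> and \<open>G \<circ> K\<close> has local degree \<open>s ^ k\<close>,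
  which determines \<open>k\<close>. Its leading coefficient is that of \<open>K ^^ k\<close> times \<open>lam ^ e\<close>: a letter \<open>G \<circ> K\<close>
  contributes \<open>s ^ i\<close> to \<open>e\<close>, where \<open>i\<close> is the number of letters to its left. As \<open>lam\<close> is not a root of
  unity, the base \<open>s\<close> digits of \<open>e\<close> recover the word.
\<close>

lemma free_if_superattracting:
  assumes K: "K holomorphic_on UNIV" "\<not> K constant_on UNIV" and "K \<alpha> = \<alpha>" and K': "deriv K \<alpha> = 0"
  shows "contains_free {K, G}"
proof -
  obtain s A where s: "s \<ge> 1" and lead_K: "leading_term \<alpha> K s A"
    using leading_term_entire[OF K assms(3)] .
  have "s \<noteq> 1"
    using leading_term_1_iff[OF K(1) assms(3)] lead_K K' by auto
  then have "s \<ge> 2" using s by simp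
  have lead_G: "leading_term \<alpha> G 1 lam"
    using leading_term_1_iff[OF entire fixed] deriv_G lam_nonzero by simp
  have lead_GK: "leading_term \<alpha> (G \<circ> K) s (lam * A)"
    using leading_term_comp[OF lead_G lead_K] by simp
  define C where "C n = rec_nat 1 (\<lambda>_ x. A * x ^ s) n" for n
  have C: "C 0 = 1" "\<And>n. C (Suc n) = A * C n ^ s" by (simp_all add: C_def)
  define H where "H = G \<circ> K"
  have lead: "leading_term \<alpha> (word_val K H w) (s ^ length w) (lam ^ digit_sum s w * C (length w))" for w
  proof (induction w)
    case Nil
    show ?case
      unfolding word_val_Nil list.size(3) power_0 digit_sum.simps C mult_1 by (rule leading_term_id)
  next
    case (Cons b w)
    have lead_b: "leading_term \<alpha> (if b then K else H) s (lam ^ (if b then 0 else 1) * A)"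
      using lead_K lead_GK unfolding H_def by (cases b) simp_all
    have e1: "s ^ length w * s = s ^ length (b # w)" by simp
    have e2: "lam ^ (if b then 0 else 1) * A * (lam ^ digit_sum s w * C (length w)) ^ s
        = lam ^ digit_sum s (b # w) * C (length (b # w))"
      by (simp add: C power_mult_distrib power_add mult_ac flip: power_mult)
    show ?case
      using leading_term_comp[OF lead_b Cons.IH] unfolding e1 e2 word_val_Cons .
  qed
  have gen: "K \<in> generated_semigroup {K, G}" "G \<in> generated_semigroup {K, G}"
    by (auto intro: generated_semigroup.generator)
  show ?thesis
  proof (rule contains_freeI[OF gen(1) generated_semigroup.composition[OF gen(2,1)]])
    fix v w assume "word_val K (G \<circ> K) v = word_val K (G \<circ> K) w"
    then have eq: "word_val K H v = word_val K H w" unfolding H_def .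
    have *: "s ^ length v = s ^ length w"
      "lam ^ digit_sum s v * C (length v) = lam ^ digit_sum s w * C (length w)"
      using leading_term_unique[OF lead[of v, unfolded eq] lead[of w]] by auto
    have len: "length v = length w" using *(1) \<open>s \<ge> 2\<close> by (simp add: power_inject_exp)
    have "C (length w) \<noteq> 0" using lead[of w] by (simp add: leading_term_def)
    then have "norm lam ^ digit_sum s v = norm lam ^ digit_sum s w"
      using *(2) len by (simp flip: norm_power)
    then have "digit_sum s v = digit_sum s w"
      using power_strict_decreasing_iff[of "norm lam"] lam_nonzero lam_less_1
      by (metis linorder_neqE_nat order_less_irrefl zero_less_norm_iff)
    then show "v = w" by (rule digit_sum_inj[OF \<open>s \<ge> 2\<close> len])
  qed
qed

end

text \<open>
  The two functions below follow the jet, in the sense defined further on, of a word in two maps with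
  jets \<open>(A, 0)\<close> and \<open>(B, \<tau>)\<close>. The letters are listed from right to left, because composing on the right
  with a map of jet \<open>(L, s)\<close> acts on the second coordinate by the affine map \<open>x \<mapsto> s + L ^ p * x\<close>.
\<close>

fun jet_mult :: "complex \<Rightarrow> complex \<Rightarrow> bool list \<Rightarrow> complex" where
  "jet_mult A B [] = 1"
| "jet_mult A B (b # u) = jet_mult A B u * (if b then A else B)"

fun jet_shift :: "nat \<Rightarrow> complex \<Rightarrow> complex \<Rightarrow> complex \<Rightarrow> bool list \<Rightarrow> complex" where
  "jet_shift p A B \<tau> [] = 0"
| "jet_shift p A B \<tau> (b # u) = (if b then 0 else \<tau>) + (if b then A else B) ^ p * jet_shift p A B \<tau> u"

text \<open>
  Ping-pong for the affine maps \<open>x \<mapsto> A ^ p * x\<close> and \<open>x \<mapsto> \<tau> + B ^ p * x\<close>: they contract the disc of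
  radius \<open>2 * norm \<tau>\<close> around \<open>0\<close> into disjoint discs around \<open>0\<close> and \<open>\<tau>\<close>. The first coordinate separates
  the empty word from the others.
\<close>

lemma jets_inj:
  assumes AB: "A \<noteq> 0" "B \<noteq> 0" "norm A < 1/4" "norm B < 1/4" and "p \<ge> 1" "\<tau> \<noteq> 0"
    and "jet_mult A B u = jet_mult A B v" "jet_shift p A B \<tau> u = jet_shift p A B \<tau> v"
  shows "u = v"
  using assms(7,8)
proof (induction u arbitrary: v)
  define L where "L b = (if b then A else B)" for b
  define T where "T b = (if b then 0 else \<tau>)" for b
  have L: "L b \<noteq> 0" "norm (L b ^ p) < 1/4" for b
  proof -
    show "L b \<noteq> 0" using AB by (simp add: L_def)
    have "norm (L b) < 1/4" using AB by (simp add: L_def)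
    then have "norm (L b) ^ p \<le> norm (L b) ^ 1" using \<open>p \<ge> 1\<close> by (intro power_decreasing) auto
    then show "norm (L b ^ p) < 1/4" using \<open>norm (L b) < 1/4\<close> by (simp add: norm_power)
  qed
  have mult: "jet_mult A B (b # u) = jet_mult A B u * L b" for b u by (simp add: L_def)
  have shift: "jet_shift p A B \<tau> (b # u) = T b + L b ^ p * jet_shift p A B \<tau> u" for b u
    by (simp add: L_def T_def)
  have bound: "norm (jet_shift p A B \<tau> u) \<le> 2 * norm \<tau>" for u
  proof (induction u)
    case (Cons b u)
    have "norm (L b ^ p * jet_shift p A B \<tau> u) \<le> 1/4 * (2 * norm \<tau>)"
      unfolding norm_mult using L[of b] Cons by (intro mult_mono) auto
    moreover have "norm (T b) \<le> norm \<tau>" by (simp add: T_def)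
    ultimately show ?case unfolding shift
      using norm_triangle_ineq[of "T b" "L b ^ p * jet_shift p A B \<tau> u"] norm_ge_zero[of \<tau>] by linarith
  qed simp
  have small: "norm (L b ^ p * jet_shift p A B \<tau> u) < norm \<tau> / 2" for b u
  proof (cases "jet_shift p A B \<tau> u = 0")
    case True then show ?thesis using \<open>\<tau> \<noteq> 0\<close> by simp
  next
    case False
    then have "norm (L b ^ p * jet_shift p A B \<tau> u) < 1/4 * norm (jet_shift p A B \<tau> u)"
      unfolding norm_mult using L[of b] by (intro mult_strict_right_mono) auto
    then show ?thesis using bound[of u] by simp
  qed
  have mult_bound: "norm (jet_mult A B u) \<le> 1" for u
  proof (induction u)
    case (Cons b u)
    have "norm (L b) \<le> 1" using AB by (simp add: L_def)
    then show ?case unfolding mult norm_mult using Cons by (intro mult_le_one) auto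
  qed simp
  have not_1: "jet_mult A B (b # u) \<noteq> 1" for b u
  proof
    assume "jet_mult A B (b # u) = 1"
    then have "norm (jet_mult A B u) * norm (L b) = 1" unfolding mult by (metis norm_mult norm_one)
    moreover have "norm (jet_mult A B u) * norm (L b) \<le> 1 * norm (L b)"
      using mult_bound by (intro mult_right_mono) auto
    moreover have "norm (L b) < 1" using AB by (simp add: L_def)
    ultimately show False by simp
  qed
  {
    case Nil
    show ?case
    proof (cases v)
      case (Cons c v')
      then show ?thesis using not_1[of c v'] Nil.prems(1) by (simp only: jet_mult.simps(1))
    qed simp
  next
    case (Cons b u)
    obtain c v' where v: "v = c # v'"
      using Cons.prems(1) not_1 by (cases v) auto
    have "b = c"
    proof (rule ccontr)
      assume "b \<noteq> c"
      have "T b - T c = L c ^ p * jet_shift p A B \<tau> v' - L b ^ p * jet_shift p A B \<tau> u"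
        using Cons.prems(2) unfolding v shift by (simp add: algebra_simps)
      then have "norm (T b - T c) < norm \<tau>"
        using norm_triangle_ineq4[of "L c ^ p * jet_shift p A B \<tau> v'" "L b ^ p * jet_shift p A B \<tau> u"]
          small[of c v'] small[of b u] by simp
      moreover have "norm (T b - T c) = norm \<tau>" using \<open>b \<noteq> c\<close> by (cases b) (auto simp: T_def)
      ultimately show False by simp
    qed
    moreover have "u = v'"
    proof (rule Cons.IH)
      show "jet_mult A B u = jet_mult A B v'"
        using Cons.prems(1) L(1)[of b] unfolding v mult \<open>b = c\<close> by simp
      show "jet_shift p A B \<tau> u = jet_shift p A B \<tau> v'"
        using Cons.prems(2) L(1)[of b] unfolding v shift \<open>b = c\<close> by simp
    qed
    ultimately show ?case using v by simp
  }
qed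

context linearized_domain
begin

text \<open>
  In the coordinate \<open>\<phi>\<close> the map \<open>h\<close> is \<open>x \<mapsto> A * x + A * t * x ^ (p + 1)\<close> up to terms of higher order. The
  coefficient is normalized by \<open>A\<close> so that \<open>t\<close> transforms affinely under composition.
\<close>

definition jet :: "nat \<Rightarrow> (complex \<Rightarrow> complex) \<Rightarrow> complex \<Rightarrow> complex \<Rightarrow> bool" where
  "jet p h A t \<longleftrightarrow> A \<noteq> 0 \<and> (h \<longlongrightarrow> \<alpha>) (at \<alpha>) \<and> ((\<lambda>z. \<phi> (h z) / \<phi> z) \<longlongrightarrow> A) (at \<alpha>) \<and>
     ((\<lambda>z. (\<phi> (h z) - A * \<phi> z) / \<phi> z ^ Suc p) \<longlongrightarrow> A * t) (at \<alpha>)"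

lemma \<phi>_nonzero_near: "\<forall>\<^sub>F z in at \<alpha>. \<phi> z \<noteq> 0"
proof -
  obtain r where r: "0 < r" "cball \<alpha> r \<subseteq> D" "inj_on \<phi> (cball \<alpha> r)" using linear_ball by metis
  have "\<phi> z \<noteq> 0" if "z \<noteq> \<alpha>" "dist z \<alpha> < r" for z
  proof
    assume "\<phi> z = 0"
    then have "z = \<alpha>" using inj_onD[OF r(3), of z \<alpha>] that(2) r(1) by (simp add: dist_commute)
    then show False using that(1) by simp
  qed
  then show ?thesis unfolding eventually_at using r(1) by blast
qed

lemma jet_unique:
  assumes "jet p h A t" and "jet p h A' t'"
  shows "A = A' \<and> t = t'"
proof -
  have "A = A'"
    using assms tendsto_unique[of "at \<alpha>" "\<lambda>z. \<phi> (h z) / \<phi> z" A A'] unfolding jet_def by simp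
  moreover have "A * t = A * t'"
    by (rule tendsto_unique[of "at \<alpha>" "\<lambda>z. (\<phi> (h z) - A * \<phi> z) / \<phi> z ^ Suc p"])
       (use assms \<open>A = A'\<close> in \<open>simp_all add: jet_def\<close>)
  ultimately show ?thesis using assms(1) by (simp add: jet_def)
qed

lemma jet_comp:
  assumes h: "jet p h A t" and k: "jet p k B s"
  shows "jet p (h \<circ> k) (A * B) (s + B ^ p * t)"
proof -
  have AB: "A \<noteq> 0" "B \<noteq> 0" using h k by (auto simp: jet_def)
  have lim_k: "((\<lambda>z. \<phi> (k z) / \<phi> z) \<longlongrightarrow> B) (at \<alpha>)" using k by (simp add: jet_def)
  have k_ne: "\<forall>\<^sub>F z in at \<alpha>. \<phi> (k z) \<noteq> 0 \<and> \<phi> z \<noteq> 0"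
    using tendsto_imp_eventually_ne[OF lim_k AB(2)] by (rule eventually_mono) auto
  have fk: "filterlim k (at \<alpha>) (at \<alpha>)"
    unfolding filterlim_at
  proof
    show "\<forall>\<^sub>F z in at \<alpha>. k z \<in> UNIV \<and> k z \<noteq> \<alpha>"
      using k_ne by (rule eventually_mono) (metis UNIV_I \<phi>_\<alpha>)
    show "(k \<longlongrightarrow> \<alpha>) (at \<alpha>)" using k by (simp add: jet_def)
  qed
  have "((\<lambda>z. \<phi> (h (k z)) / \<phi> (k z) * (\<phi> (k z) / \<phi> z)) \<longlongrightarrow> A * B) (at \<alpha>)"
  proof (intro tendsto_mult lim_k)
    have "((\<lambda>w. \<phi> (h w) / \<phi> w) \<longlongrightarrow> A) (at \<alpha>)" using h by (simp add: jet_def)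
    then show "((\<lambda>z. \<phi> (h (k z)) / \<phi> (k z)) \<longlongrightarrow> A) (at \<alpha>)" by (rule filterlim_compose[OF _ fk])
  qed
  moreover have "\<forall>\<^sub>F z in at \<alpha>. \<phi> (h (k z)) / \<phi> (k z) * (\<phi> (k z) / \<phi> z) = \<phi> ((h \<circ> k) z) / \<phi> z"
    using k_ne by (rule eventually_mono) simp
  ultimately have 1: "((\<lambda>z. \<phi> ((h \<circ> k) z) / \<phi> z) \<longlongrightarrow> A * B) (at \<alpha>)"
    by (rule Lim_transform_eventually)
  have "((\<lambda>z. (\<phi> (h (k z)) - A * \<phi> (k z)) / \<phi> (k z) ^ Suc p * (\<phi> (k z) / \<phi> z) ^ Suc p
      + A * ((\<phi> (k z) - B * \<phi> z) / \<phi> z ^ Suc p)) \<longlongrightarrow> A * t * B ^ Suc p + A * (B * s)) (at \<alpha>)"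
  proof (intro tendsto_add tendsto_mult tendsto_power tendsto_const lim_k)
    have "((\<lambda>w. (\<phi> (h w) - A * \<phi> w) / \<phi> w ^ Suc p) \<longlongrightarrow> A * t) (at \<alpha>)" using h by (simp add: jet_def)
    then show "((\<lambda>z. (\<phi> (h (k z)) - A * \<phi> (k z)) / \<phi> (k z) ^ Suc p) \<longlongrightarrow> A * t) (at \<alpha>)"
      by (rule filterlim_compose[OF _ fk])
    show "((\<lambda>z. (\<phi> (k z) - B * \<phi> z) / \<phi> z ^ Suc p) \<longlongrightarrow> B * s) (at \<alpha>)"
      using k by (simp add: jet_def)
  qed
  moreover have "\<forall>\<^sub>F z in at \<alpha>. (\<phi> (h (k z)) - A * \<phi> (k z)) / \<phi> (k z) ^ Suc p * (\<phi> (k z) / \<phi> z) ^ Suc p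
      + A * ((\<phi> (k z) - B * \<phi> z) / \<phi> z ^ Suc p) = (\<phi> ((h \<circ> k) z) - A * B * \<phi> z) / \<phi> z ^ Suc p"
    using k_ne
  proof (rule eventually_mono)
    fix z assume ne: "\<phi> (k z) \<noteq> 0 \<and> \<phi> z \<noteq> 0"
    have "(\<phi> (h (k z)) - A * \<phi> (k z)) / \<phi> (k z) ^ Suc p * (\<phi> (k z) / \<phi> z) ^ Suc p
        = (\<phi> (h (k z)) - A * \<phi> (k z)) / \<phi> z ^ Suc p"
      using ne by (simp only: power_divide) simp
    then show "(\<phi> (h (k z)) - A * \<phi> (k z)) / \<phi> (k z) ^ Suc p * (\<phi> (k z) / \<phi> z) ^ Suc p
        + A * ((\<phi> (k z) - B * \<phi> z) / \<phi> z ^ Suc p) = (\<phi> ((h \<circ> k) z) - A * B * \<phi> z) / \<phi> z ^ Suc p"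
      by (simp only: o_apply) (simp add: add_divide_distrib diff_divide_distrib algebra_simps)
  qed
  ultimately have "((\<lambda>z. (\<phi> ((h \<circ> k) z) - A * B * \<phi> z) / \<phi> z ^ Suc p) \<longlongrightarrow> A * t * B ^ Suc p + A * (B * s)) (at \<alpha>)"
    by (rule Lim_transform_eventually)
  moreover have "A * t * B ^ Suc p + A * (B * s) = A * B * (s + B ^ p * t)"
    by (simp add: algebra_simps)
  moreover have "((h \<circ> k) \<longlongrightarrow> \<alpha>) (at \<alpha>)"
    unfolding o_def by (rule filterlim_compose[OF _ fk]) (use h in \<open>simp add: jet_def\<close>)
  ultimately show ?thesis using 1 AB unfolding jet_def by simp
qed

lemma jet_id: "jet p id 1 0"
proof -
  have "((\<lambda>z. \<phi> z / \<phi> z) \<longlongrightarrow> 1) (at \<alpha>)"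
    by (rule Lim_transform_eventually[OF tendsto_const])
       (use \<phi>_nonzero_near in \<open>auto elim: eventually_mono\<close>)
  then show ?thesis by (simp add: jet_def tendsto_ident_at id_def)
qed

lemma jet_G: "jet p G lam 0"
proof -
  have D_near: "\<forall>\<^sub>F z in at \<alpha>. z \<in> D"
    using open_D \<alpha>_in_D eventually_at_in_open' by blast
  have "((\<lambda>z. \<phi> (G z) / \<phi> z) \<longlongrightarrow> lam) (at \<alpha>)"
    by (rule Lim_transform_eventually[OF tendsto_const], use D_near \<phi>_nonzero_near in eventually_elim)
       (simp add: \<phi>_G)
  moreover have "((\<lambda>z. (\<phi> (G z) - lam * \<phi> z) / \<phi> z ^ Suc p) \<longlongrightarrow> 0) (at \<alpha>)"
    by (rule Lim_transform_eventually[OF tendsto_const], use D_near in eventually_elim)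
       (simp add: \<phi>_G)
  moreover have "(G \<longlongrightarrow> \<alpha>) (at \<alpha>)"
    using entire_isCont[OF entire, of \<alpha>] fixed by (simp add: isCont_def)
  ultimately show ?thesis using lam_nonzero by (simp add: jet_def)
qed

lemma jet_iterate: "jet p (G ^^ n) (lam ^ n) 0"
proof (induction n)
  case 0
  show ?case unfolding funpow.simps(1) power_0 by (rule jet_id)
next
  case (Suc n)
  show ?case
    using jet_comp[OF jet_G Suc] unfolding funpow.simps(2) power_Suc mult_zero_right add_0_left .
qed

lemma jet_word_val:
  assumes "jet p P A 0" and "jet p Q B \<tau>"
  shows "jet p (word_val P Q (rev u)) (jet_mult A B u) (jet_shift p A B \<tau> u)"
proof (induction u)
  case Nil
  show ?case unfolding rev.simps word_val_Nil jet_mult.simps jet_shift.simps by (rule jet_id)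
next
  case (Cons b u)
  have b: "jet p (if b then P else Q) (if b then A else B) (if b then 0 else \<tau>)" using assms by simp
  have "word_val P Q (rev (b # u)) = word_val P Q (rev u) \<circ> (if b then P else Q)"
    unfolding rev.simps word_val_append by (simp only: word_val_Cons word_val_Nil comp_id)
  then show ?case
    using jet_comp[OF Cons b] by (simp only: jet_mult.simps jet_shift.simps)
qed

lemma commute_if_linear_near:
  assumes K: "K holomorphic_on UNIV" "K \<alpha> = \<alpha>" and "0 < \<rho>"
    and lin: "\<And>z. z \<in> ball \<alpha> \<rho> \<Longrightarrow> \<phi> (K z) = mu * \<phi> z"
  shows "K \<circ> G = G \<circ> K"
proof -
  obtain r where r: "0 < r" "cball \<alpha> r \<subseteq> D" "inj_on \<phi> (cball \<alpha> r)" using linear_ball by metis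
  define S where "S = ball \<alpha> (min r \<rho>) \<inter> G -` ball \<alpha> \<rho> \<inter> K -` ball \<alpha> r
    \<inter> (K \<circ> G) -` ball \<alpha> r \<inter> (G \<circ> K) -` ball \<alpha> r"
  have KG: "K \<circ> G holomorphic_on UNIV" "G \<circ> K holomorphic_on UNIV"
    using entire_comp entire K by auto
  show ?thesis
  proof (rule entire_eqI[OF KG])
    show "open S"
      unfolding S_def using entire_isCont[OF KG(1)] entire_isCont[OF KG(2)] entire_isCont[OF entire] entire_isCont[OF K(1)]
      by (intro open_Int continuous_open_vimage open_ball) auto
    have "\<alpha> \<in> S" unfolding S_def using r(1) \<open>0 < \<rho>\<close> K fixed by simp
    then show "S \<noteq> {}" by blast
    fix z assume z: "z \<in> S"
    then have zD: "z \<in> D" "K z \<in> D" using r(2) by (auto simp: S_def)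
    have "\<phi> (K (G z)) = mu * \<phi> (G z)" using lin z by (simp add: S_def)
    also have "\<dots> = \<phi> (G (K z))" using lin[of z] z \<phi>_G zD by (simp add: S_def)
    finally show "(K \<circ> G) z = (G \<circ> K) z"
      using inj_onD[OF r(3), of "K (G z)" "G (K z)"] z by (simp add: S_def)
  qed
qed

text \<open>
  In the coordinate \<open>\<phi>\<close> the map \<open>G\<close> is linear and \<open>K\<close> is not, since a linear \<open>K\<close> would commute with \<open>G\<close>. Let
  \<open>p + 1\<close> be the order of the first nonlinear term of \<open>K\<close>. Then the jet of \<open>K\<close> has shift \<open>\<tau> \<noteq> 0\<close> and that of \<open>G\<close>
  has shift \<open>0\<close>, and for large \<open>m\<close> the multipliers of \<open>G ^^ m\<close> and \<open>G ^^ m \<circ> K\<close> are small enough to separate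
  the jets of all words.
\<close>

lemma free_if_not_commuting:
  assumes K: "K holomorphic_on UNIV" "K \<alpha> = \<alpha>" and K': "deriv K \<alpha> \<noteq> 0" and nc: "K \<circ> G \<noteq> G \<circ> K"
  shows "contains_free {K, G}"
proof -
  define mu where "mu = deriv K \<alpha>"
  have "mu \<noteq> 0" using K' by (simp add: mu_def)
  have "open (D \<inter> K -` D)"
    using open_D entire_isCont[OF K(1)] by (intro open_Int continuous_open_vimage) auto
  moreover have "\<alpha> \<in> D \<inter> K -` D" using \<alpha>_in_D K by simp
  ultimately obtain \<rho> where \<rho>: "0 < \<rho>" "ball \<alpha> \<rho> \<subseteq> D \<inter> K -` D"
    using open_contains_ball by blast
  define \<psi> where "\<psi> z = \<phi> (K z) - mu * \<phi> z" for z
  have hol_\<phi>: "\<phi> holomorphic_on ball \<alpha> \<rho>" using \<phi>_holomorphic \<rho>(2) holomorphic_on_subset by blast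
  have hol_\<phi>K: "(\<lambda>z. \<phi> (K z)) holomorphic_on ball \<alpha> \<rho>"
    using holomorphic_on_compose_gen[of K "ball \<alpha> \<rho>" \<phi> D] holomorphic_on_subset[OF K(1)] \<phi>_holomorphic \<rho>(2)
    by (auto simp: o_def)
  have hol: "\<psi> holomorphic_on ball \<alpha> \<rho>"
    unfolding \<psi>_def[abs_def] using hol_\<phi> hol_\<phi>K by (intro holomorphic_intros)
  have \<psi>\<alpha>: "\<psi> \<alpha> = 0" by (simp add: \<psi>_def K)
  have "\<not> \<psi> constant_on ball \<alpha> \<rho>"
  proof
    assume "\<psi> constant_on ball \<alpha> \<rho>"
    then have "\<psi> z = 0" if "z \<in> ball \<alpha> \<rho>" for z
      using \<psi>\<alpha> that \<rho>(1) unfolding constant_on_def by (metis centre_in_ball)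
    then have "K \<circ> G = G \<circ> K"
      by (intro commute_if_linear_near[OF K \<rho>(1), of mu]) (simp add: \<psi>_def)
    then show False using nc by contradiction
  qed
  then obtain g r n where n: "0 < n" and r: "0 < r" and g: "g holomorphic_on ball \<alpha> r"
    "\<And>w. w \<in> ball \<alpha> r \<Longrightarrow> \<psi> w = (w - \<alpha>) ^ n * g w" "\<And>w. w \<in> ball \<alpha> r \<Longrightarrow> g w \<noteq> 0"
    using holomorphic_factor_zero_nonconstant[OF hol open_ball connected_ball _ \<psi>\<alpha>] \<rho>(1)
    by (metis centre_in_ball)
  have g_lim: "(g \<longlongrightarrow> g \<alpha>) (at \<alpha>)"
    using g(1) r by (metis at_within_open centre_in_ball continuous_on holomorphic_on_imp_continuous_on open_ball)
  have ball_near: "\<forall>\<^sub>F z in at \<alpha>. z \<in> ball \<alpha> r \<and> z \<noteq> \<alpha>"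
    unfolding eventually_at using r by (intro exI[of _ r]) (simp add: dist_commute)
  have lim_\<phi>K: "((\<lambda>z. \<phi> (K z) / (z - \<alpha>)) \<longlongrightarrow> mu) (at \<alpha>)"
    unfolding mu_def by (rule lim_\<phi>_comp) (use K in auto)
  have lim_\<psi>: "((\<lambda>z. \<psi> z / (z - \<alpha>)) \<longlongrightarrow> 0) (at \<alpha>)"
  proof -
    have "((\<lambda>z. \<phi> (K z) / (z - \<alpha>) - mu * (\<phi> z / (z - \<alpha>))) \<longlongrightarrow> mu - mu * 1) (at \<alpha>)"
      by (intro tendsto_diff tendsto_mult tendsto_const lim_\<phi> lim_\<phi>K)
    then show ?thesis by (simp add: \<psi>_def diff_divide_distrib)
  qed
  have "n \<noteq> 1"
  proof
    assume "n = 1"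
    then have "\<forall>\<^sub>F z in at \<alpha>. g z = \<psi> z / (z - \<alpha>)"
      using ball_near g(2) by (auto elim!: eventually_mono)
    from Lim_transform_eventually[OF g_lim this] have "g \<alpha> = 0"
      by (rule tendsto_unique[OF trivial_limit_at _ lim_\<psi>])
    then show False using g(3)[of \<alpha>] r by simp
  qed
  define p where "p = n - 1"
  have p: "n = Suc p" "p \<ge> 1" using n \<open>n \<noteq> 1\<close> by (auto simp: p_def)
  define c where "c = g \<alpha>"
  have "c \<noteq> 0" using g(3) r by (simp add: c_def)
  have lim_c: "((\<lambda>z. (\<phi> (K z) - mu * \<phi> z) / \<phi> z ^ Suc p) \<longlongrightarrow> c) (at \<alpha>)"
  proof -
    have "((\<lambda>z. g z / (\<phi> z / (z - \<alpha>)) ^ Suc p) \<longlongrightarrow> c / 1 ^ Suc p) (at \<alpha>)"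
      unfolding c_def by (intro tendsto_divide tendsto_power g_lim lim_\<phi>) simp
    moreover have "\<forall>\<^sub>F z in at \<alpha>. g z / (\<phi> z / (z - \<alpha>)) ^ Suc p = (\<phi> (K z) - mu * \<phi> z) / \<phi> z ^ Suc p"
      using ball_near
    proof (rule eventually_mono)
      fix z assume z: "z \<in> ball \<alpha> r \<and> z \<noteq> \<alpha>"
      have "\<phi> (K z) - mu * \<phi> z = (z - \<alpha>) ^ Suc p * g z"
        using g(2)[of z] z by (simp only: \<psi>_def p(1))
      then show "g z / (\<phi> z / (z - \<alpha>)) ^ Suc p = (\<phi> (K z) - mu * \<phi> z) / \<phi> z ^ Suc p"
        by (simp only: power_divide) simp
    qed
    ultimately have "((\<lambda>z. (\<phi> (K z) - mu * \<phi> z) / \<phi> z ^ Suc p) \<longlongrightarrow> c / 1 ^ Suc p) (at \<alpha>)"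
      by (rule Lim_transform_eventually)
    then show ?thesis by simp
  qed
  define \<tau> where "\<tau> = c / mu"
  have "\<tau> \<noteq> 0" using \<open>c \<noteq> 0\<close> \<open>mu \<noteq> 0\<close> by (simp add: \<tau>_def)
  have jet_K: "jet p K mu \<tau>"
    unfolding jet_def
  proof (intro conjI)
    show "mu \<noteq> 0" by fact
    show "(K \<longlongrightarrow> \<alpha>) (at \<alpha>)" using entire_isCont[OF K(1), of \<alpha>] K(2) by (simp add: isCont_def)
    have "((\<lambda>z. \<phi> (K z) / (z - \<alpha>) / (\<phi> z / (z - \<alpha>))) \<longlongrightarrow> mu / 1) (at \<alpha>)"
      by (intro tendsto_divide lim_\<phi> lim_\<phi>K) simp
    moreover have "\<forall>\<^sub>F z in at \<alpha>. \<phi> (K z) / (z - \<alpha>) / (\<phi> z / (z - \<alpha>)) = \<phi> (K z) / \<phi> z"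
      using ball_near by (rule eventually_mono) simp
    ultimately have "((\<lambda>z. \<phi> (K z) / \<phi> z) \<longlongrightarrow> mu / 1) (at \<alpha>)" by (rule Lim_transform_eventually)
    then show "((\<lambda>z. \<phi> (K z) / \<phi> z) \<longlongrightarrow> mu) (at \<alpha>)" by simp
    show "((\<lambda>z. (\<phi> (K z) - mu * \<phi> z) / \<phi> z ^ Suc p) \<longlongrightarrow> mu * \<tau>) (at \<alpha>)"
      using lim_c \<open>mu \<noteq> 0\<close> by (simp add: \<tau>_def)
  qed
  \<comment> \<open>Makes both \<open>norm (lam ^ m)\<close> and \<open>norm (lam ^ m * mu)\<close> smaller than \<open>1 / 4\<close>.\<close>
  obtain N where N: "norm lam ^ N < 1/4 / (1 + norm mu)"
    using real_arch_pow_inv[of "1/4 / (1 + norm mu)" "norm lam"] lam_less_1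
    by (metis add_pos_nonneg divide_pos_pos norm_ge_zero zero_less_numeral zero_less_one)
  define m where "m = Suc N"
  have m: "m \<ge> 1" "norm lam ^ m * (1 + norm mu) < 1/4"
  proof -
    have "norm lam ^ m \<le> norm lam ^ N" unfolding m_def using lam_less_1 by (intro power_decreasing) auto
    then have "norm lam ^ m < 1/4 / (1 + norm mu)" using N by linarith
    moreover have "0 < 1 + norm mu" using norm_ge_zero[of mu] by linarith
    ultimately show "norm lam ^ m * (1 + norm mu) < 1/4" by (simp only: pos_less_divide_eq)
  qed (simp add: m_def)
  define A where "A = lam ^ m"
  define B where "B = lam ^ m * mu"
  define Q where "Q = (G ^^ m) \<circ> K"
  have jet_Q: "jet p Q B \<tau>"
    using jet_comp[OF jet_iterate jet_K] unfolding Q_def B_def by simp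
  have AB: "A \<noteq> 0" "B \<noteq> 0" "norm A < 1/4" "norm B < 1/4"
  proof -
    have "norm A + norm B < 1/4" using m(2) by (simp add: A_def B_def norm_mult norm_power algebra_simps)
    then show "norm A < 1/4" "norm B < 1/4" using norm_ge_zero[of A] norm_ge_zero[of B] by linarith+
  qed (use lam_nonzero \<open>mu \<noteq> 0\<close> in \<open>simp_all add: A_def B_def\<close>)
  have gen: "K \<in> generated_semigroup {K, G}" "G \<in> generated_semigroup {K, G}"
    by (auto intro: generated_semigroup.generator)
  show ?thesis
  proof (rule contains_freeI)
    show "G ^^ m \<in> generated_semigroup {K, G}" by (rule funpow_in_generated_semigroup[OF gen(2) m(1)])
    show "Q \<in> generated_semigroup {K, G}"
      unfolding Q_def by (rule funpow_comp_in_generated_semigroup[OF gen(2,1)])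
    fix v w assume eq: "word_val (G ^^ m) Q v = word_val (G ^^ m) Q w"
    have jets: "jet p (word_val (G ^^ m) Q u) (jet_mult A B (rev u)) (jet_shift p A B \<tau> (rev u))" for u
      using jet_word_val[OF jet_iterate jet_Q, where u = "rev u"] unfolding A_def rev_rev_ident .
    have "rev v = rev w"
      using jet_unique[OF jets[of v, unfolded eq] jets[of w]]
      by (intro jets_inj[OF AB p(2) \<open>\<tau> \<noteq> 0\<close>]) auto
    then show "v = w" by simp
  qed
qed

end

section \<open>A critical point of the linearization\<close>

lemma holomorphic_glue:
  fixes U :: "'i \<Rightarrow> complex set" and \<sigma> :: "'i \<Rightarrow> complex \<Rightarrow> complex"
  assumes "\<And>i. i \<in> I \<Longrightarrow> open (U i)" and hol: "\<And>i. i \<in> I \<Longrightarrow> \<sigma> i holomorphic_on U i"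
    and agree: "\<And>i j w. i \<in> I \<Longrightarrow> j \<in> I \<Longrightarrow> w \<in> U i \<Longrightarrow> w \<in> U j \<Longrightarrow> \<sigma> i w = \<sigma> j w"
  obtains \<psi> where "\<psi> holomorphic_on (\<Union>i\<in>I. U i)" "\<And>i w. i \<in> I \<Longrightarrow> w \<in> U i \<Longrightarrow> \<psi> w = \<sigma> i w"
proof -
  define \<psi> where "\<psi> w = \<sigma> (SOME i. i \<in> I \<and> w \<in> U i) w" for w
  have \<psi>: "\<psi> w = \<sigma> i w" if "i \<in> I" "w \<in> U i" for i w
  proof -
    have "(SOME i. i \<in> I \<and> w \<in> U i) \<in> I \<and> w \<in> U (SOME i. i \<in> I \<and> w \<in> U i)"
      by (rule someI[of "\<lambda>i. i \<in> I \<and> w \<in> U i"]) (use that in simp)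
    then show ?thesis unfolding \<psi>_def using agree that by blast
  qed
  have "\<psi> holomorphic_on U i" if "i \<in> I" for i
    by (rule holomorphic_transform[OF hol[OF that]]) (use \<psi> that in simp)
  then have "\<psi> holomorphic_on (\<Union>i\<in>I. U i)"
    using assms(1) by (intro holomorphic_on_UN_open) auto
  then show ?thesis using that \<psi> by blast
qed

text \<open>
  Two overlapping discs share a point of the segment between their centres, and the open segment
  between two points of a circle lies inside the circle.
\<close>

lemma sphere_balls_meet_inside:
  fixes v w :: complex
  assumes "norm v = R" "norm w = R" "v \<noteq> w" "0 < d" "0 < e" "ball v d \<inter> ball w e \<noteq> {}"
  obtains p where "p \<in> ball v d" "p \<in> ball w e" "norm p < R"
proof -
  have lt: "dist v w < d + e"
  proof -
    obtain x where "x \<in> ball v d" "x \<in> ball w e" using assms(6) by blast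
    then show ?thesis using dist_triangle[of v w x] by (simp add: dist_commute)
  qed
  define s where "s = d / (d + e)"
  have s: "0 < s" "s < 1" "1 - s = e / (d + e)" using assms(4,5) by (auto simp: s_def field_simps)
  define p where "p = v + s *\<^sub>R (w - v)"
  have "dist v p = s * dist v w"
    using s by (simp add: p_def dist_norm norm_minus_commute)
  also have "\<dots> < s * (d + e)" using lt s by simp
  also have "\<dots> = d" using assms(4,5) by (simp add: s_def)
  finally have pv: "p \<in> ball v d" by simp
  have "w - p = (1 - s) *\<^sub>R (w - v)" by (simp add: p_def algebra_simps)
  then have "dist w p = norm ((1 - s) *\<^sub>R (w - v))" by (simp only: dist_norm)
  then have "dist w p = (1 - s) * dist v w"
    using s(2) by (simp add: dist_norm norm_minus_commute)
  also have "\<dots> < (1 - s) * (d + e)" using lt s(2) by simp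
  also have "\<dots> = e" using assms(4,5) unfolding s(3) by simp
  finally have pw: "p \<in> ball w e" by simp
  have "p \<in> open_segment v w"
    unfolding in_segment using assms(3) s by (intro conjI exI[of _ s]) (auto simp: p_def algebra_simps)
  then have "norm p < R"
    using dist_decreases_open_segment[of p v w 0] assms(1,2) by (auto simp: dist_norm)
  then show ?thesis using that pv pw by blast
qed

lemma ball_around_cball:
  fixes S :: "complex set"
  assumes "open S" "cball 0 R \<subseteq> S" "0 \<le> R"
  obtains e where "0 < e" "ball 0 (R + e) \<subseteq> S"
proof -
  obtain e where e: "e > 0" "(\<Union>x\<in>cball 0 R. ball x e) \<subseteq> S"
    using compact_subset_open_imp_ball_epsilon_subset[OF compact_cball assms(1,2)] .
  have "ball 0 (R + e) \<subseteq> (\<Union>x\<in>cball 0 R. ball x e :: complex set)"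
  proof
    fix w :: complex assume w: "w \<in> ball 0 (R + e)"
    show "w \<in> (\<Union>x\<in>cball 0 R. ball x e)"
    proof (cases "norm w \<le> R")
      case True
      then show ?thesis using e(1) by force
    next
      case False
      define x where "x = (R / norm w) *\<^sub>R w"
      have nw: "norm w > 0" using False assms(3) by linarith
      have "norm x = R" using assms(3) nw by (simp add: x_def)
      have "w - x = (1 - R / norm w) *\<^sub>R w" by (simp add: x_def algebra_simps)
      then have "norm (w - x) = \<bar>1 - R / norm w\<bar> * norm w" by simp
      also have "\<dots> = norm w - R" using False nw by (simp add: abs_if field_simps)
      finally have "dist x w < e" using w by (simp add: dist_norm norm_minus_commute)
      then show ?thesis using \<open>norm x = R\<close> by (intro UN_I[of x]) auto
    qed
  qed
  then show ?thesis using that e by blast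
qed

context linearized_domain
begin

definition inverse_branch :: "complex set \<Rightarrow> (complex \<Rightarrow> complex) \<Rightarrow> bool" where
  "inverse_branch A \<psi> \<longleftrightarrow> \<psi> holomorphic_on A \<and> \<psi> ` A \<subseteq> D \<and> (\<forall>w\<in>A. \<phi> (\<psi> w) = w)"

lemma inverse_branch_subset: "inverse_branch A \<psi> \<Longrightarrow> B \<subseteq> A \<Longrightarrow> inverse_branch B \<psi>"
  unfolding inverse_branch_def using holomorphic_on_subset by blast

lemma local_inverse:
  assumes "z \<in> D" "deriv \<phi> z \<noteq> 0"
  obtains r \<epsilon> \<sigma> where "0 < r" "0 < \<epsilon>" "inverse_branch (ball (\<phi> z) \<epsilon>) \<sigma>"
    "\<And>x. x \<in> ball z r \<Longrightarrow> \<sigma> (\<phi> x) = x"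
proof -
  obtain r where r: "0 < r" "ball z r \<subseteq> D" "inj_on \<phi> (ball z r)"
    using has_complex_derivative_locally_injective[OF \<phi>_holomorphic assms(1) open_D assms(2)] .
  have hol: "\<phi> holomorphic_on ball z r" using \<phi>_holomorphic r(2) holomorphic_on_subset by blast
  obtain \<sigma> where \<sigma>: "\<sigma> holomorphic_on (\<phi> ` ball z r)" "\<And>x. x \<in> ball z r \<Longrightarrow> \<sigma> (\<phi> x) = x"
    using holomorphic_has_inverse[OF hol open_ball r(3)] by metis
  have "open (\<phi> ` ball z r)" by (rule open_mapping_thm3[OF hol open_ball r(3)])
  moreover have "\<phi> z \<in> \<phi> ` ball z r" using r(1) by simp
  ultimately obtain \<epsilon> where \<epsilon>: "0 < \<epsilon>" "ball (\<phi> z) \<epsilon> \<subseteq> \<phi> ` ball z r"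
    using open_contains_ball by blast
  have im: "\<sigma> w \<in> ball z r \<and> \<phi> (\<sigma> w) = w" if "w \<in> ball (\<phi> z) \<epsilon>" for w
  proof -
    have "w \<in> \<phi> ` ball z r" using \<epsilon>(2) that by blast
    then obtain x where "x \<in> ball z r" "w = \<phi> x" by blast
    then show ?thesis using \<sigma>(2) by simp
  qed
  have "inverse_branch (ball (\<phi> z) \<epsilon>) \<sigma>"
    unfolding inverse_branch_def
    using holomorphic_on_subset[OF \<sigma>(1) \<epsilon>(2)] im r(2) by blast
  then show ?thesis using that r(1) \<epsilon>(1) \<sigma>(2) by blast
qed

lemma inverse_branches_agree:
  assumes A: "open A" "connected A" and b: "inverse_branch A \<psi>1" "inverse_branch A \<psi>2"
    and w0: "w0 \<in> A" "\<psi>1 w0 = \<psi>2 w0" "deriv \<phi> (\<psi>1 w0) \<noteq> 0" and "w \<in> A"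
  shows "\<psi>1 w = \<psi>2 w"
proof -
  have D: "\<psi>1 w0 \<in> D" using b(1) w0(1) by (auto simp: inverse_branch_def)
  obtain r where r: "0 < r" "inj_on \<phi> (ball (\<psi>1 w0) r)"
    using has_complex_derivative_locally_injective[OF \<phi>_holomorphic D open_D w0(3)] by metis
  define S where "S = (A \<inter> \<psi>1 -` ball (\<psi>1 w0) r) \<inter> (A \<inter> \<psi>2 -` ball (\<psi>1 w0) r)"
  have hol: "\<psi>1 holomorphic_on A" "\<psi>2 holomorphic_on A" using b by (auto simp: inverse_branch_def)
  show ?thesis
  proof (rule analytic_continuation_open[of S A \<psi>1 \<psi>2])
    show "open S"
      unfolding S_def using hol[THEN holomorphic_on_imp_continuous_on] A(1)
      by (intro open_Int[of "A \<inter> _"] continuous_open_preimage) auto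
    have "w0 \<in> S" using w0 r(1) by (simp add: S_def)
    then show "S \<noteq> {}" by blast
    show "S \<subseteq> A" by (auto simp: S_def)
    show "\<psi>1 v = \<psi>2 v" if "v \<in> S" for v
      using that b inj_onD[OF r(2), of "\<psi>1 v" "\<psi>2 v"] by (auto simp: S_def inverse_branch_def)
  qed (use A hol \<open>w \<in> A\<close> in auto)
qed

text \<open>
  Both sides, as functions of \<open>lam * w\<close>, are inverse branches with value \<open>\<alpha>\<close> at \<open>0\<close>.
\<close>

lemma inverse_branch_conjugate:
  assumes "inverse_branch (ball 0 R) \<psi>" "\<psi> 0 = \<alpha>" "w \<in> ball 0 R"
  shows "G (\<psi> w) = \<psi> (lam * w)"
proof -
  have R: "R > 0" using assms(3) by (metis ball_eq_empty empty_iff linorder_not_less)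
  let ?B = "ball 0 (norm lam * R) :: complex set"
  have sub: "?B \<subseteq> ball 0 R" using lam_less_1 R by (intro subset_ball) (simp add: mult_le_cancel_right1)
  have div: "v / lam \<in> ball 0 R" if "v \<in> ?B" for v
    using that lam_nonzero by (simp add: norm_divide field_simps)
  have hol: "\<psi> holomorphic_on ball 0 R" and im: "\<psi> ` ball 0 R \<subseteq> D" and inv: "\<And>w. w \<in> ball 0 R \<Longrightarrow> \<phi> (\<psi> w) = w"
    using assms(1) by (auto simp: inverse_branch_def)
  have "inverse_branch ?B (\<lambda>v. G (\<psi> (v / lam)))"
    unfolding inverse_branch_def
  proof (intro conjI ballI)
    have "(\<psi> \<circ> (\<lambda>v. v / lam)) holomorphic_on ?B"
      using div lam_nonzero hol by (intro holomorphic_on_compose_gen[of _ _ _ "ball 0 R"] holomorphic_intros) auto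
    then have "(G \<circ> (\<psi> \<circ> (\<lambda>v. v / lam))) holomorphic_on ?B"
      by (rule holomorphic_on_compose) (rule holomorphic_on_subset[OF entire], simp)
    then show "(\<lambda>v. G (\<psi> (v / lam))) holomorphic_on ?B" by (simp add: o_def)
    show "(\<lambda>v. G (\<psi> (v / lam))) ` ?B \<subseteq> D" using div im G_D by blast
    show "\<phi> (G (\<psi> (v / lam))) = v" if "v \<in> ?B" for v
      using div[OF that] im inv \<phi>_G lam_nonzero by (auto simp: image_subset_iff)
  qed
  moreover have "lam * w \<in> ?B" using assms(3) lam_nonzero by (simp add: norm_mult)
  ultimately have "G (\<psi> (lam * w / lam)) = \<psi> (lam * w)"
    using inverse_branches_agree[of ?B "\<lambda>v. G (\<psi> (v / lam))" \<psi> 0 "lam * w"]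
      inverse_branch_subset[OF assms(1) sub] R lam_nonzero assms(2) fixed deriv_\<phi> by simp
  then show ?thesis using lam_nonzero by simp
qed

text \<open>
  The branch has derivative \<open>1\<close> at \<open>0\<close>, which the Cauchy inequality bounds by a multiple of the inverse
  radius, because the values lie in \<open>D\<close>.
\<close>

lemma inverse_branch_radius_bounded:
  obtains B where "\<And>R \<psi>. inverse_branch (ball 0 R) \<psi> \<Longrightarrow> \<psi> 0 = \<alpha> \<Longrightarrow> R \<le> B"
proof -
  obtain C where C: "\<And>z. z \<in> D \<Longrightarrow> norm z \<le> C" using bounded_D bounded_iff by blast
  have "C \<ge> 0" using C[OF \<alpha>_in_D] norm_ge_zero order_trans by blast
  have "R \<le> 2 * C" if \<psi>: "inverse_branch (ball 0 R) \<psi>" "\<psi> 0 = \<alpha>" for R \<psi>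
  proof (rule ccontr)
    assume "\<not> R \<le> 2 * C"
    then have R: "R > 0" "R > 2 * C" using \<open>C \<ge> 0\<close> by auto
    have hol: "\<psi> holomorphic_on ball 0 R" and im: "\<psi> ` ball 0 R \<subseteq> D" and inv: "\<And>w. w \<in> ball 0 R \<Longrightarrow> \<phi> (\<psi> w) = w"
      using \<psi>(1) by (auto simp: inverse_branch_def)
    have "norm ((deriv ^^ 1) \<psi> 0) \<le> fact 1 * C / (R/2) ^ 1"
    proof (rule Cauchy_inequality)
      show "\<psi> holomorphic_on ball 0 (R/2)" using R by (intro holomorphic_on_subset[OF hol]) auto
      show "continuous_on (cball 0 (R/2)) \<psi>"
        using R by (intro continuous_on_subset[OF holomorphic_on_imp_continuous_on[OF hol]]) auto
      show "norm (\<psi> x) \<le> C" if "norm (0 - x) = R/2" for x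
        using that R C im by (auto simp: image_subset_iff)
    qed (use R in auto)
    moreover have "deriv \<psi> 0 = 1"
    proof -
      have D\<psi>: "(\<psi> has_field_derivative deriv \<psi> 0) (at 0)"
        using holomorphic_derivI[OF hol open_ball] R by simp
      have D\<phi>: "(\<phi> has_field_derivative 1) (at (\<psi> 0))"
        using holomorphic_derivI[OF \<phi>_holomorphic open_D \<alpha>_in_D] deriv_\<phi> \<psi>(2) by simp
      have "((\<lambda>w. \<phi> (\<psi> w)) has_field_derivative 1 * deriv \<psi> 0) (at 0)"
        by (rule DERIV_chain2[OF D\<phi> D\<psi>])
      moreover have "((\<lambda>w. \<phi> (\<psi> w)) has_field_derivative 1) (at 0)"
        by (rule has_field_derivative_transform_within_open[OF DERIV_ident open_ball[of 0 R]])
           (use R inv in auto)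
      ultimately show ?thesis using DERIV_unique by fastforce
    qed
    ultimately have "1 \<le> C / (R / 2)" by simp
    then show False using R by (simp add: field_simps)
  qed
  then show ?thesis using that by blast
qed

text \<open>
  Suppose that \<open>\<phi>\<close> has no critical value other than \<open>0\<close>, and continue the inverse branch \<open>\<psi>\<close> with
  \<open>\<psi> 0 = \<alpha>\<close> to the largest possible disc. Its radius \<open>Rm\<close> is finite. Let \<open>w\<close> tend to a boundary point \<open>w0\<close>.
  Then \<open>\<psi> w\<close> accumulates at some \<open>z0\<close> in \<open>closure D\<close>, and \<open>G z0 = \<psi> (lam * w0)\<close> lies in \<open>D\<close>, so that \<open>z0\<close> is
  in \<open>D\<close> by the boundary condition. As \<open>\<phi>\<close> is regular at \<open>z0\<close>, the branch continues across \<open>w0\<close>. The local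
  continuations agree with each other, because any two overlapping ones overlap inside the disc, so
  they extend \<open>\<psi>\<close> to a larger disc.
\<close>

lemma critical_point_exists:
  obtains z where "z \<in> D" "\<phi> z \<noteq> 0" "deriv \<phi> z = 0"
proof (rule ccontr)
  assume "\<not> thesis"
  then have regular: "deriv \<phi> z \<noteq> 0" if "z \<in> D" "z = \<alpha> \<or> \<phi> z \<noteq> 0" for z
    using that deriv_\<phi> \<open>\<And>z. z \<in> D \<Longrightarrow> \<phi> z \<noteq> 0 \<Longrightarrow> deriv \<phi> z = 0 \<Longrightarrow> thesis\<close> by auto
  define branch where "branch R \<psi> \<longleftrightarrow> inverse_branch (ball 0 R) \<psi> \<and> \<psi> 0 = \<alpha>" for R \<psi>
  define Rs where "Rs = {R. 0 < R \<and> (\<exists>\<psi>. branch R \<psi>)}"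
  have "Rs \<noteq> {}"
  proof -
    have "deriv \<phi> \<alpha> \<noteq> 0" using deriv_\<phi> by simp
    then obtain r \<epsilon> \<sigma> where "0 < r" "0 < \<epsilon>" "inverse_branch (ball (\<phi> \<alpha>) \<epsilon>) \<sigma>" "\<And>x. x \<in> ball \<alpha> r \<Longrightarrow> \<sigma> (\<phi> x) = x"
      using local_inverse[OF \<alpha>_in_D] by metis
    then have "branch \<epsilon> \<sigma>" unfolding branch_def by (metis \<phi>_\<alpha> centre_in_ball)
    then show ?thesis using \<open>0 < \<epsilon>\<close> by (auto simp: Rs_def)
  qed
  have bdd: "bdd_above Rs"
  proof -
    obtain B where "\<And>R \<psi>. inverse_branch (ball 0 R) \<psi> \<Longrightarrow> \<psi> 0 = \<alpha> \<Longrightarrow> R \<le> B"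
      using inverse_branch_radius_bounded by metis
    then show ?thesis by (intro bdd_aboveI[of _ B]) (auto simp: Rs_def branch_def)
  qed
  define Rm where "Rm = Sup Rs"
  have Rm_upper: "R \<le> Rm" if "R \<in> Rs" for R unfolding Rm_def by (rule cSup_upper[OF that bdd])
  have Rm_pos: "0 < Rm"
  proof -
    obtain R where "R \<in> Rs" using \<open>Rs \<noteq> {}\<close> by blast
    then have "0 < R" "R \<le> Rm" using Rm_upper by (auto simp: Rs_def)
    then show ?thesis by linarith
  qed
  have cover: "ball 0 Rm = (\<Union>R\<in>Rs. ball 0 R :: complex set)"
  proof
    show "ball 0 Rm \<subseteq> (\<Union>R\<in>Rs. ball 0 R :: complex set)"
    proof
      fix w :: complex assume "w \<in> ball 0 Rm"
      then have "norm w < Sup Rs" by (simp add: Rm_def)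
      then obtain R where "R \<in> Rs" "norm w < R" using less_cSup_iff[OF \<open>Rs \<noteq> {}\<close> bdd] by blast
      then show "w \<in> (\<Union>R\<in>Rs. ball 0 R)" by auto
    qed
    show "(\<Union>R\<in>Rs. ball 0 R :: complex set) \<subseteq> ball 0 Rm" using Rm_upper by force
  qed
  obtain \<Psi> where \<Psi>: "\<And>R. R \<in> Rs \<Longrightarrow> branch R (\<Psi> R)"
  proof -
    have "\<forall>R\<in>Rs. \<exists>\<psi>. branch R \<psi>" by (simp add: Rs_def)
    then show ?thesis using that by metis
  qed
  obtain \<psi> where \<psi>: "branch Rm \<psi>"
  proof -
    have agree: "\<Psi> R w = \<Psi> R' w" if "R \<in> Rs" "R' \<in> Rs" "w \<in> ball 0 R" "w \<in> ball 0 R'" for R R' w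
    proof (rule inverse_branches_agree[of "ball 0 R \<inter> ball 0 R'" "\<Psi> R" "\<Psi> R'" 0])
      show "connected (ball 0 R \<inter> ball 0 R' :: complex set)"
        by (intro convex_connected convex_Int convex_ball)
      show "inverse_branch (ball 0 R \<inter> ball 0 R') (\<Psi> R)" "inverse_branch (ball 0 R \<inter> ball 0 R') (\<Psi> R')"
        using \<Psi>[OF that(1)] \<Psi>[OF that(2)] inverse_branch_subset unfolding branch_def by (meson Int_lower1 Int_lower2)+
      have 0: "\<Psi> R 0 = \<alpha>" "\<Psi> R' 0 = \<alpha>"
        using \<Psi>[OF that(1)] \<Psi>[OF that(2)] by (simp_all add: branch_def)
      then show "\<Psi> R 0 = \<Psi> R' 0" "deriv \<phi> (\<Psi> R 0) \<noteq> 0" using deriv_\<phi> by simp_all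
      show "0 \<in> ball 0 R \<inter> ball 0 R'" using that(1,2) by (simp add: Rs_def)
      show "open (ball 0 R \<inter> ball 0 R')" by (intro open_Int open_ball)
      show "w \<in> ball 0 R \<inter> ball 0 R'" using that(3,4) by simp
    qed
    have hol_\<Psi>: "\<Psi> R holomorphic_on ball 0 R" if "R \<in> Rs" for R
      using \<Psi>[OF that] by (simp add: branch_def inverse_branch_def)
    obtain \<psi> where \<psi>: "\<psi> holomorphic_on (\<Union>R\<in>Rs. ball 0 R)" "\<And>R w. R \<in> Rs \<Longrightarrow> w \<in> ball 0 R \<Longrightarrow> \<psi> w = \<Psi> R w"
    proof -
      show thesis by (rule holomorphic_glue[of Rs "ball 0" \<Psi>, OF open_ball hol_\<Psi> agree that])
    qed
    have "branch Rm \<psi>"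
      unfolding branch_def inverse_branch_def
    proof (intro conjI ballI)
      show "\<psi> holomorphic_on ball 0 Rm" unfolding cover by (rule \<psi>(1))
      have *: "\<psi> w \<in> D \<and> \<phi> (\<psi> w) = w" if w: "w \<in> ball 0 Rm" for w
      proof -
        obtain R where R: "R \<in> Rs" "w \<in> ball 0 R" using w unfolding cover by blast
        then show ?thesis using \<psi>(2)[OF R] \<Psi>[OF R(1)] by (auto simp: branch_def inverse_branch_def)
      qed
      show "\<psi> ` ball 0 Rm \<subseteq> D" using * by blast
      show "\<phi> (\<psi> w) = w" if "w \<in> ball 0 Rm" for w using * that by blast
      obtain R where R: "R \<in> Rs" using \<open>Rs \<noteq> {}\<close> by blast
      then have "0 \<in> ball 0 R" by (simp add: Rs_def)
      then show "\<psi> 0 = \<alpha>" using \<psi>(2)[OF R] \<Psi>[OF R] by (simp add: branch_def)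
    qed
    then show ?thesis using that by blast
  qed
  have hol: "\<psi> holomorphic_on ball 0 Rm" and im: "\<And>w. w \<in> ball 0 Rm \<Longrightarrow> \<psi> w \<in> D"
    and inv: "\<And>w. w \<in> ball 0 Rm \<Longrightarrow> \<phi> (\<psi> w) = w" and \<psi>0: "\<psi> 0 = \<alpha>"
    and branch_\<psi>: "inverse_branch (ball 0 Rm) \<psi>"
    using \<psi> by (auto simp: branch_def inverse_branch_def)
  have reg_\<psi>: "deriv \<phi> (\<psi> w) \<noteq> 0" if "w \<in> ball 0 Rm" for w
    using regular[OF im[OF that]] inv[OF that] \<psi>0 by (cases "w = 0") auto
  have ext: "\<exists>\<epsilon> \<sigma>. 0 < \<epsilon> \<and> inverse_branch (ball w0 \<epsilon>) \<sigma> \<and> (\<forall>w \<in> ball w0 \<epsilon> \<inter> ball 0 Rm. \<sigma> w = \<psi> w)"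
    if w0: "norm w0 = Rm" for w0
  proof -
    \<comment> \<open>A radial sequence in the open disc; the shift by \<open>2\<close> avoids the centre and division by \<open>0\<close>.\<close>
    define w where "w n = (1 - inverse (real (n + 2))) *\<^sub>R w0" for n
    have fac: "0 \<le> 1 - inverse (real (n + 2))" "1 - inverse (real (n + 2)) < 1" for n
      by (simp_all add: field_simps)
    have w_in: "w n \<in> ball 0 Rm" for n
      using fac[of n] w0 Rm_pos by (simp add: w_def)
    have "(\<lambda>n. inverse (real (n + 2))) \<longlonglongrightarrow> 0"
      using LIMSEQ_ignore_initial_segment[OF lim_inverse_n, of 2] by simp
    then have "w \<longlonglongrightarrow> (1 - 0) *\<^sub>R w0"
      unfolding w_def[abs_def] by (intro tendsto_scaleR tendsto_diff tendsto_const)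
    then have w_lim: "w \<longlonglongrightarrow> w0" by simp
    have "seq_compact (closure D)" using bounded_D by (simp add: compact_closure flip: compact_eq_seq_compact_metric)
    moreover have "\<psi> (w n) \<in> closure D" for n using im[OF w_in[of n]] closure_subset by blast
    ultimately obtain z0 k where z0: "z0 \<in> closure D" and k: "strict_mono (k :: nat \<Rightarrow> nat)"
      and lim_o: "((\<lambda>n. \<psi> (w n)) \<circ> k) \<longlonglongrightarrow> z0"
      using seq_compactE[of "closure D" "\<lambda>n. \<psi> (w n)"] by metis
    have lim: "(\<lambda>n. \<psi> (w (k n))) \<longlonglongrightarrow> z0" using lim_o by (simp add: o_def)
    have wk_lim: "(\<lambda>n. w (k n)) \<longlonglongrightarrow> w0" using LIMSEQ_subseq_LIMSEQ[OF w_lim k] by (simp add: o_def)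
    have lam_w0: "lam * w0 \<in> ball 0 Rm" using w0 Rm_pos lam_less_1 by (simp add: norm_mult)
    have "(\<lambda>n. G (\<psi> (w (k n)))) \<longlonglongrightarrow> G z0"
      by (rule isCont_tendsto_compose[OF entire_isCont[OF entire] lim])
    moreover have "(\<lambda>n. \<psi> (lam * w (k n))) \<longlonglongrightarrow> \<psi> (lam * w0)"
    proof (rule isCont_tendsto_compose[where g = \<psi>])
      show "isCont \<psi> (lam * w0)"
        using holomorphic_on_imp_continuous_on[OF hol] lam_w0 continuous_on_eq_continuous_at[OF open_ball] by blast
      show "(\<lambda>n. lam * w (k n)) \<longlonglongrightarrow> lam * w0" by (intro tendsto_mult tendsto_const wk_lim)
    qed
    then have "(\<lambda>n. G (\<psi> (w (k n)))) \<longlonglongrightarrow> \<psi> (lam * w0)"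
      by (simp only: inverse_branch_conjugate[OF branch_\<psi> \<psi>0 w_in])
    ultimately have "G z0 = \<psi> (lam * w0)" by (rule LIMSEQ_unique)
    then have "G z0 \<in> D" using im[OF lam_w0] by simp
    then have "z0 \<in> D" using boundary[of z0] z0 open_D by (auto simp: frontier_def interior_open)
    have "(\<lambda>n. \<phi> (\<psi> (w (k n)))) \<longlonglongrightarrow> \<phi> z0"
    proof (rule isCont_tendsto_compose[OF _ lim])
      show "isCont \<phi> z0"
        using holomorphic_on_imp_continuous_on[OF \<phi>_holomorphic] \<open>z0 \<in> D\<close> continuous_on_eq_continuous_at[OF open_D] by blast
    qed
    then have "(\<lambda>n. w (k n)) \<longlonglongrightarrow> \<phi> z0" using inv[OF w_in] by simp
    then have \<phi>z0: "\<phi> z0 = w0" using wk_lim LIMSEQ_unique by blast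
    have "w0 \<noteq> 0" using w0 Rm_pos by auto
    then have "deriv \<phi> z0 \<noteq> 0" using regular[OF \<open>z0 \<in> D\<close>] \<phi>z0 by simp
    then obtain r \<epsilon> \<sigma> where r: "0 < r" and \<epsilon>: "0 < \<epsilon>" and \<sigma>: "inverse_branch (ball w0 \<epsilon>) \<sigma>"
      "\<And>x. x \<in> ball z0 r \<Longrightarrow> \<sigma> (\<phi> x) = x"
      using local_inverse[OF \<open>z0 \<in> D\<close>] \<phi>z0 by metis
    have "\<forall>\<^sub>F n in sequentially. dist (\<psi> (w (k n))) z0 < r" using lim r tendstoD by blast
    moreover have "\<forall>\<^sub>F n in sequentially. dist (w (k n)) w0 < \<epsilon>" using wk_lim \<epsilon> tendstoD by blast
    ultimately have "\<forall>\<^sub>F n in sequentially. dist (\<psi> (w (k n))) z0 < r \<and> dist (w (k n)) w0 < \<epsilon>"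
      by (rule eventually_conj)
    then obtain n where n: "dist (\<psi> (w (k n))) z0 < r" "dist (w (k n)) w0 < \<epsilon>"
      using eventually_happens'[OF sequentially_bot] by blast
    have eq: "\<sigma> (w (k n)) = \<psi> (w (k n))"
      using \<sigma>(2)[of "\<psi> (w (k n))"] n(1) inv[OF w_in] by (simp add: dist_commute)
    have "\<sigma> v = \<psi> v" if v: "v \<in> ball w0 \<epsilon> \<inter> ball 0 Rm" for v
    proof (rule inverse_branches_agree[OF _ _ _ _ _ _ _ v, of _ _ "w (k n)"])
      show "connected (ball w0 \<epsilon> \<inter> ball 0 Rm)" by (intro convex_connected convex_Int convex_ball)
      show "inverse_branch (ball w0 \<epsilon> \<inter> ball 0 Rm) \<sigma>" by (rule inverse_branch_subset[OF \<sigma>(1)]) simp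
      show "inverse_branch (ball w0 \<epsilon> \<inter> ball 0 Rm) \<psi>" by (rule inverse_branch_subset[OF branch_\<psi>]) simp
      show "w (k n) \<in> ball w0 \<epsilon> \<inter> ball 0 Rm" using n(2) w_in by (simp add: dist_commute)
      show "deriv \<phi> (\<sigma> (w (k n))) \<noteq> 0" unfolding eq by (rule reg_\<psi>[OF w_in])
    qed (use eq in auto)
    then show ?thesis using \<epsilon> \<sigma>(1) by blast
  qed
  then obtain \<epsilon> X where \<epsilon>: "\<And>w0. norm w0 = Rm \<Longrightarrow> 0 < \<epsilon> w0" and X: "\<And>w0. norm w0 = Rm \<Longrightarrow> inverse_branch (ball w0 (\<epsilon> w0)) (X w0)"
    and X_eq: "\<And>w0 w. norm w0 = Rm \<Longrightarrow> w \<in> ball w0 (\<epsilon> w0) \<Longrightarrow> w \<in> ball 0 Rm \<Longrightarrow> X w0 w = \<psi> w"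
    by (metis IntI)
  \<comment> \<open>The index \<open>0\<close>, which is not on the circle, stands for the disc itself.\<close>
  define I where "I = insert 0 (sphere (0::complex) Rm)"
  define U where "U v = (if v = 0 then ball 0 Rm else ball v (\<epsilon> v))" for v
  define H where "H v = (if v = 0 then \<psi> else X v)" for v
  have branch_H: "inverse_branch (U v) (H v)" if "v \<in> I" for v
    using that X branch_\<psi> by (auto simp: I_def U_def H_def)
  have H_eq: "H v w = \<psi> w" if "v \<in> I" "w \<in> U v" "w \<in> ball 0 Rm" for v w
    using that X_eq by (auto simp: I_def U_def H_def)
  have H_agree: "H u x = H v x" if uv: "u \<in> I" "v \<in> I" "x \<in> U u" "x \<in> U v" for u v x
  proof (cases "u = v")
    case False
    have "\<exists>p. p \<in> U u \<and> p \<in> U v \<and> p \<in> ball 0 Rm"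
    proof (cases "u = 0 \<or> v = 0")
      case True
      then show ?thesis using uv by (auto simp: U_def)
    next
      case nz: False
      then have n: "norm u = Rm" "norm v = Rm" using uv by (auto simp: I_def)
      have "ball u (\<epsilon> u) \<inter> ball v (\<epsilon> v) \<noteq> {}" using uv nz by (auto simp: U_def)
      then obtain p where "p \<in> ball u (\<epsilon> u)" "p \<in> ball v (\<epsilon> v)" "norm p < Rm"
        using sphere_balls_meet_inside[OF n False \<epsilon>[OF n(1)] \<epsilon>[OF n(2)]] by blast
      then show ?thesis using nz by (auto simp: U_def)
    qed
    then obtain p where p: "p \<in> U u" "p \<in> U v" "p \<in> ball 0 Rm" by blast
    show ?thesis
    proof (rule inverse_branches_agree[of "U u \<inter> U v" "H u" "H v" p])
      show "open (U u \<inter> U v)" by (simp add: U_def open_Int)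
      show "connected (U u \<inter> U v)" by (intro convex_connected convex_Int) (auto simp: U_def)
      show "inverse_branch (U u \<inter> U v) (H u)" by (rule inverse_branch_subset[OF branch_H[OF uv(1)]]) simp
      show "inverse_branch (U u \<inter> U v) (H v)" by (rule inverse_branch_subset[OF branch_H[OF uv(2)]]) simp
      show "H u p = H v p" using H_eq uv p by simp
      show "deriv \<phi> (H u p) \<noteq> 0" using H_eq[OF uv(1) p(1,3)] reg_\<psi>[OF p(3)] by simp
    qed (use p uv in auto)
  qed simp
  obtain \<Phi> where \<Phi>: "\<Phi> holomorphic_on (\<Union>v\<in>I. U v)" "\<And>v x. v \<in> I \<Longrightarrow> x \<in> U v \<Longrightarrow> \<Phi> x = H v x"
  proof -
    have hol_H: "H v holomorphic_on U v" if "v \<in> I" for v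
      using branch_H[OF that] by (simp add: inverse_branch_def)
    have open_U: "open (U v)" for v by (simp add: U_def)
    show thesis by (rule holomorphic_glue[of I U H, OF open_U hol_H H_agree that])
  qed
  have "inverse_branch (\<Union>v\<in>I. U v) \<Phi>"
    unfolding inverse_branch_def
  proof (intro conjI ballI)
    have *: "\<Phi> x \<in> D \<and> \<phi> (\<Phi> x) = x" if x: "x \<in> (\<Union>v\<in>I. U v)" for x
    proof -
      obtain v where v: "v \<in> I" "x \<in> U v" using x by blast
      then show ?thesis using \<Phi>(2)[OF v] branch_H[OF v(1)] by (auto simp: inverse_branch_def)
    qed
    show "\<Phi> ` (\<Union>v\<in>I. U v) \<subseteq> D" using * by blast
    show "\<phi> (\<Phi> x) = x" if "x \<in> (\<Union>v\<in>I. U v)" for x using * that by blast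
  qed (rule \<Phi>(1))
  moreover obtain e where e: "0 < e" "ball 0 (Rm + e) \<subseteq> (\<Union>v\<in>I. U v)"
  proof (rule ball_around_cball[of "\<Union>v\<in>I. U v" Rm])
    show "open (\<Union>v\<in>I. U v)" by (auto simp: U_def)
    show "cball 0 Rm \<subseteq> (\<Union>v\<in>I. U v)"
    proof
      fix x :: complex assume x: "x \<in> cball 0 Rm"
      show "x \<in> (\<Union>v\<in>I. U v)"
      proof (cases "norm x = Rm")
        case True
        then have "x \<in> I" "x \<noteq> 0" using Rm_pos by (auto simp: I_def)
        then show ?thesis using \<epsilon>[OF True] by (intro UN_I[of x]) (auto simp: U_def)
      next
        case False
        then show ?thesis using x by (intro UN_I[of 0]) (auto simp: U_def I_def)
      qed
    qed
  qed (use Rm_pos in auto)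
  ultimately have "inverse_branch (ball 0 (Rm + e)) \<Phi>" using inverse_branch_subset by blast
  moreover have "\<Phi> 0 = \<alpha>"
    using \<Phi>(2)[of 0 0] Rm_pos \<psi>0 by (simp add: I_def U_def H_def)
  ultimately have "Rm + e \<in> Rs" using Rm_pos e(1) by (auto simp: Rs_def branch_def)
  then show False using Rm_upper e(1) by fastforce
qed

end

section \<open>Commuting maps\<close>

context linearized_domain
begin

lemma entire_eq_if_conjugate:
  assumes H: "H1 holomorphic_on UNIV" "H2 holomorphic_on UNIV" and "H1 \<alpha> = \<alpha>" "H2 \<alpha> = \<alpha>"
    and eq: "\<And>z. z \<in> D \<Longrightarrow> \<phi> (H1 z) = \<phi> (H2 z)"
  shows "H1 = H2"
proof -
  obtain r where r: "0 < r" "cball \<alpha> r \<subseteq> D" "inj_on \<phi> (cball \<alpha> r)" using linear_ball by metis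
  define S where "S = ball \<alpha> r \<inter> H1 -` ball \<alpha> r \<inter> H2 -` ball \<alpha> r"
  show ?thesis
  proof (rule entire_eqI[OF H])
    show "open S"
      unfolding S_def using entire_isCont[OF H(1)] entire_isCont[OF H(2)]
      by (intro open_Int continuous_open_vimage open_ball) auto
    have "\<alpha> \<in> S" unfolding S_def using r(1) assms(3,4) by simp
    then show "S \<noteq> {}" by blast
    fix z assume z: "z \<in> S"
    then have "z \<in> D" using r(2) by (auto simp: S_def)
    then show "H1 z = H2 z"
      using inj_onD[OF r(3), of "H1 z" "H2 z"] eq z by (simp add: S_def)
  qed
qed

text \<open>
  The function \<open>\<psi> = \<phi> \<circ> K - mu * \<phi>\<close> also satisfies \<open>\<psi> \<circ> G = lam * \<psi>\<close>, so \<open>\<psi> / \<phi>\<close> is constant on orbits of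
  \<open>G\<close>. These tend to \<open>\<alpha>\<close>, where \<open>\<psi> / \<phi>\<close> has the limit \<open>0\<close>.
\<close>

lemma commuting_map_linear:
  assumes K: "K holomorphic_on UNIV" "K \<alpha> = \<alpha>" "K ` D \<subseteq> D" and comm: "K \<circ> G = G \<circ> K" and "z \<in> D"
  shows "\<phi> (K z) = deriv K \<alpha> * \<phi> z"
proof -
  define mu where "mu = deriv K \<alpha>"
  define \<psi> where "\<psi> z = \<phi> (K z) - mu * \<phi> z" for z
  have hol_\<phi>K: "(\<lambda>z. \<phi> (K z)) holomorphic_on D"
    using holomorphic_on_compose_gen[of K D \<phi> D] holomorphic_on_subset[OF K(1)] \<phi>_holomorphic K(3)
    by (auto simp: o_def)
  have hol: "\<psi> holomorphic_on D"
    unfolding \<psi>_def[abs_def] using \<phi>_holomorphic hol_\<phi>K by (intro holomorphic_intros)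
  have \<psi>_G: "\<psi> (G z) = lam * \<psi> z" if "z \<in> D" for z
  proof -
    have "K (G z) = G (K z)" using comm by (metis o_apply)
    then show ?thesis using that K(3) \<phi>_G by (simp add: \<psi>_def image_subset_iff algebra_simps)
  qed
  have \<psi>_iter: "\<psi> ((G ^^ n) z) = lam ^ n * \<psi> z" if "z \<in> D" for n z
    using that by (induction n) (auto simp: \<psi>_G iterate_in_D)
  have lim_\<phi>K: "((\<lambda>z. \<phi> (K z) / (z - \<alpha>)) \<longlongrightarrow> mu) (at \<alpha>)"
    unfolding mu_def by (rule lim_\<phi>_comp) (use K in auto)
  have "((\<lambda>z. (\<phi> (K z) / (z - \<alpha>) - mu * (\<phi> z / (z - \<alpha>))) / (\<phi> z / (z - \<alpha>))) \<longlongrightarrow> (mu - mu * 1) / 1) (at \<alpha>)"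
    by (intro tendsto_divide tendsto_diff tendsto_mult tendsto_const lim_\<phi> lim_\<phi>K) simp
  moreover have "\<forall>\<^sub>F z in at \<alpha>. (\<phi> (K z) / (z - \<alpha>) - mu * (\<phi> z / (z - \<alpha>))) / (\<phi> z / (z - \<alpha>)) = \<psi> z / \<phi> z"
    unfolding eventually_at_filter
    by (intro always_eventually allI impI) (simp add: \<psi>_def divide_simps)
  ultimately have lim_\<psi>: "((\<lambda>z. \<psi> z / \<phi> z) \<longlongrightarrow> 0) (at \<alpha>)"
    using Lim_transform_eventually by fastforce
  have zero: "\<psi> z = 0" if z: "z \<in> D" "\<phi> z \<noteq> 0" for z
  proof -
    have "filterlim (\<lambda>n. (G ^^ n) z) (at \<alpha>) sequentially"
      unfolding filterlim_at
    proof
      have "(G ^^ n) z \<noteq> \<alpha>" for n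
      proof
        assume "(G ^^ n) z = \<alpha>"
        then show False using \<phi>_iterate[OF z(1), of n] z(2) lam_nonzero by simp
      qed
      then show "\<forall>\<^sub>F n in sequentially. (G ^^ n) z \<in> UNIV \<and> (G ^^ n) z \<noteq> \<alpha>" by simp
    qed (rule convergence[OF z(1)])
    from filterlim_compose[OF lim_\<psi> this]
    have "(\<lambda>n. \<psi> ((G ^^ n) z) / \<phi> ((G ^^ n) z)) \<longlonglongrightarrow> 0" .
    then have "(\<lambda>n::nat. \<psi> z / \<phi> z) \<longlonglongrightarrow> 0"
      using lam_nonzero by (simp add: \<psi>_iter[OF z(1)] \<phi>_iterate[OF z(1)])
    then show ?thesis using z(2) by (simp add: LIMSEQ_const_iff)
  qed
  obtain r where r: "0 < r" "cball \<alpha> r \<subseteq> D" "inj_on \<phi> (cball \<alpha> r)" using linear_ball by metis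
  have "\<psi> z = 0"
  proof (rule analytic_continuation_open[of "ball \<alpha> r - {\<alpha>}" D \<psi> "\<lambda>_. 0"])
    show "open (ball \<alpha> r - {\<alpha>})" by (intro open_Diff) auto
    show "ball \<alpha> r - {\<alpha>} \<noteq> {}"
    proof -
      have "\<alpha> + of_real (r/2) \<in> ball \<alpha> r - {\<alpha>}" using r(1) by (simp add: dist_norm)
      then show ?thesis by blast
    qed
    show "ball \<alpha> r - {\<alpha>} \<subseteq> D" using r(2) ball_subset_cball by blast
    show "\<psi> z = 0" if z: "z \<in> ball \<alpha> r - {\<alpha>}" for z
    proof (rule zero)
      show "\<phi> z \<noteq> 0"
      proof
        assume "\<phi> z = 0"
        then have "z = \<alpha>" using inj_onD[OF r(3), of z \<alpha>] z r(1) by simp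
        then show False using z by simp
      qed
      show "z \<in> D" using z r(2) by auto
    qed
  qed (use open_D connected_D hol \<open>z \<in> D\<close> in auto)
  then show ?thesis by (simp add: \<psi>_def mu_def)
qed

text \<open>
  Differentiate \<open>\<phi> \<circ> G ^^ n = lam ^ n * \<phi>\<close>: as \<open>\<phi>\<close> is regular near \<open>\<alpha>\<close>, for large \<open>n\<close> a critical point of \<open>\<phi>\<close>
  is one of \<open>G ^^ n\<close>, so its orbit meets a critical point of \<open>G\<close>.
\<close>

lemma critical_values_descend:
  assumes "z \<in> D" "deriv \<phi> z = 0"
  obtains i c where "c \<in> D" "deriv G c = 0" "\<phi> c = lam ^ i * \<phi> z"
proof -
  have D_deriv: "deriv \<phi> ((G ^^ n) z) * deriv (G ^^ n) z = lam ^ n * deriv \<phi> z" for n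
  proof -
    have "(\<phi> has_field_derivative deriv \<phi> ((G ^^ n) z)) (at ((G ^^ n) z))"
      using holomorphic_derivI[OF \<phi>_holomorphic open_D iterate_in_D[OF assms(1)]] by simp
    from DERIV_chain2[OF this entire_DERIV[OF entire_iterate]]
    have "((\<lambda>z. \<phi> ((G ^^ n) z)) has_field_derivative deriv \<phi> ((G ^^ n) z) * deriv (G ^^ n) z) (at z)" .
    moreover have "((\<lambda>z. \<phi> ((G ^^ n) z)) has_field_derivative lam ^ n * deriv \<phi> z) (at z)"
    proof (rule has_field_derivative_transform_within_open[OF _ open_D assms(1)])
      show "((\<lambda>z. lam ^ n * \<phi> z) has_field_derivative lam ^ n * deriv \<phi> z) (at z)"
        using holomorphic_derivI[OF \<phi>_holomorphic open_D assms(1)] by (rule DERIV_cmult)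
    qed (simp add: \<phi>_iterate)
    ultimately show ?thesis by (rule DERIV_unique)
  qed
  obtain r where r: "0 < r" "cball \<alpha> r \<subseteq> D" "inj_on \<phi> (cball \<alpha> r)" using linear_ball by metis
  obtain n where n: "(G ^^ n) z \<in> ball \<alpha> r"
    using enters_ball[OF assms(1) r(1)] .
  have "deriv \<phi> ((G ^^ n) z) \<noteq> 0"
  proof (rule holomorphic_injective_imp_regular[of _ "ball \<alpha> r"])
    show "\<phi> holomorphic_on ball \<alpha> r" by (rule holomorphic_on_subset[OF \<phi>_holomorphic]) (use r(2) in auto)
    show "inj_on \<phi> (ball \<alpha> r)" by (rule inj_on_subset[OF r(3)]) auto
  qed (use n in simp_all)
  then have "deriv (G ^^ n) z = 0" using D_deriv[of n] assms(2) by simp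
  then have "\<exists>i. deriv G ((G ^^ i) z) = 0"
  proof (induction n)
    case 0
    then show ?case by (simp add: id_def)
  next
    case (Suc n)
    have "deriv (G ^^ Suc n) z = deriv G ((G ^^ n) z) * deriv (G ^^ n) z"
      unfolding funpow.simps(2) by (rule entire_deriv_comp[OF entire entire_iterate])
    then have "deriv G ((G ^^ n) z) = 0 \<or> deriv (G ^^ n) z = 0"
      unfolding Suc.prems by (metis mult_eq_0_iff)
    then show ?case using Suc.IH by blast
  qed
  then obtain i where "deriv G ((G ^^ i) z) = 0" ..
  then show ?thesis
    using that[of "(G ^^ i) z" i] iterate_in_D[OF assms(1)] \<phi>_iterate[OF assms(1)] by simp
qed

lemma finite_critical_points: "finite {c \<in> D. deriv G c = 0}"
proof (cases "deriv G constant_on UNIV")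
  case True
  then have "deriv G c = lam" for c using deriv_G unfolding constant_on_def by (metis UNIV_I)
  then show ?thesis using lam_nonzero by simp
next
  case False
  then show ?thesis
    using entire_finite_fibre[OF holomorphic_deriv[OF entire open_UNIV] _ bounded_D] by blast
qed

text \<open>
  Let \<open>z0\<close> be a critical point of \<open>\<phi>\<close> with \<open>\<phi> z0 \<noteq> 0\<close>. Its preimages under the iterates of \<open>K\<close> are critical
  points of \<open>\<phi>\<close> with values \<open>\<phi> z0 / mu ^ j\<close>. Each value is, up to a power of \<open>lam\<close>, the value at one of
  finitely many points, and two exponents \<open>j\<close> must share that point.
\<close>

lemma multipliers_dependent:
  assumes K: "K holomorphic_on UNIV" "K ` D = D" and lin: "\<And>z. z \<in> D \<Longrightarrow> \<phi> (K z) = mu * \<phi> z"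
    and "mu \<noteq> 0"
  obtains a i l where "a \<ge> 1" "mu ^ a * lam ^ i = lam ^ l"
proof -
  obtain z0 where z0: "z0 \<in> D" "\<phi> z0 \<noteq> 0" "deriv \<phi> z0 = 0" using critical_point_exists .
  define C where "C = {c \<in> D. deriv G c = 0}"
  have K_iter: "(K ^^ j) z \<in> D \<and> \<phi> ((K ^^ j) z) = mu ^ j * \<phi> z" if "z \<in> D" for j z
    using that K(2) lin by (induction j) auto
  have "\<exists>i c. c \<in> C \<and> \<phi> z0 * lam ^ i = mu ^ j * \<phi> c" for j
  proof -
    have "(K ^^ j) ` D = D"
    proof (induction j)
      case (Suc j)
      show ?case unfolding funpow.simps(2) image_comp[symmetric] Suc by (rule K(2))
    qed simp
    then obtain z where z: "z \<in> D" "(K ^^ j) z = z0" using z0(1) by (metis imageE)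
    have "(\<phi> has_field_derivative deriv \<phi> z0) (at ((K ^^ j) z))"
      using holomorphic_derivI[OF \<phi>_holomorphic open_D z0(1)] z(2) by simp
    from DERIV_chain2[OF this entire_DERIV[OF entire_funpow[OF K(1)]]]
    have "((\<lambda>z. \<phi> ((K ^^ j) z)) has_field_derivative 0) (at z)" using z0(3) by simp
    moreover have "((\<lambda>z. \<phi> ((K ^^ j) z)) has_field_derivative mu ^ j * deriv \<phi> z) (at z)"
    proof (rule has_field_derivative_transform_within_open[OF _ open_D z(1)])
      show "((\<lambda>z. mu ^ j * \<phi> z) has_field_derivative mu ^ j * deriv \<phi> z) (at z)"
        using holomorphic_derivI[OF \<phi>_holomorphic open_D z(1)] by (rule DERIV_cmult)
    qed (simp add: K_iter)
    ultimately have "mu ^ j * deriv \<phi> z = 0" using DERIV_unique by blast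
    then have "deriv \<phi> z = 0" using \<open>mu \<noteq> 0\<close> by simp
    then obtain i c where c: "c \<in> C" "\<phi> c = lam ^ i * \<phi> z"
      using critical_values_descend[OF z(1)] unfolding C_def by blast
    have "\<phi> z0 = mu ^ j * \<phi> z" using K_iter[OF z(1), of j] z(2) by simp
    then show ?thesis using c by (intro exI[of _ i] exI[of _ c]) simp
  qed
  then obtain i c where ic: "\<And>j. c j \<in> C" "\<And>j. \<phi> z0 * lam ^ i j = mu ^ j * \<phi> (c j)"
    by metis
  have "finite (range c)"
    using finite_critical_points ic(1) by (intro finite_subset[of "range c" C]) (auto simp: C_def)
  then have "\<not> inj c" using finite_imageD by blast
  then obtain j k where jk: "j < k" "c j = c k"
    unfolding inj_on_def by (metis linorder_neqE_nat)
  have "mu ^ (k - j) * lam ^ i j * \<phi> z0 = mu ^ (k - j) * mu ^ j * \<phi> (c k)"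
    using ic(2)[of j] jk(2) by (simp add: mult.assoc mult.commute[of "\<phi> z0"])
  also have "\<dots> = lam ^ i k * \<phi> z0"
    using ic(2)[of k] jk(1) by (simp add: mult.commute flip: power_add)
  finally have "mu ^ (k - j) * lam ^ i j = lam ^ i k" using z0(2) by simp
  then show ?thesis using that[of "k - j" "i j" "i k"] jk(1) by simp
qed

lemma iterates_coincide:
  assumes K: "K holomorphic_on UNIV" "K \<alpha> = \<alpha>" "K ` D = D" and comm: "K \<circ> G = G \<circ> K" and "deriv K \<alpha> \<noteq> 0"
  obtains a i l where "a \<ge> 1" "(K ^^ a) \<circ> (G ^^ i) = G ^^ l"
proof -
  have lin: "\<phi> (K z) = deriv K \<alpha> * \<phi> z" if "z \<in> D" for z
    using commuting_map_linear[OF K(1,2) _ comm that] K(3) by simp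
  obtain a i l where a: "a \<ge> 1" and eq: "deriv K \<alpha> ^ a * lam ^ i = lam ^ l"
    using multipliers_dependent[OF K(1,3) lin assms(5)] .
  have lin_iter: "(K ^^ j) z \<in> D \<and> \<phi> ((K ^^ j) z) = deriv K \<alpha> ^ j * \<phi> z" if "z \<in> D" for j z
    using that K(3) lin by (induction j) auto
  have "(K ^^ a) \<circ> (G ^^ i) = G ^^ l"
  proof (rule entire_eq_if_conjugate)
    show "(K ^^ a) \<circ> (G ^^ i) holomorphic_on UNIV" by (rule entire_comp[OF entire_funpow[OF K(1)] entire_iterate])
    have "(K ^^ a) \<alpha> = \<alpha>" using K(2) by (induction a) auto
    then show "((K ^^ a) \<circ> (G ^^ i)) \<alpha> = \<alpha>" by simp
    show "\<phi> (((K ^^ a) \<circ> (G ^^ i)) z) = \<phi> ((G ^^ l) z)" if "z \<in> D" for z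
      using lin_iter[OF iterate_in_D[OF that, of i], of a] \<phi>_iterate[OF that, of i] \<phi>_iterate[OF that, of l]
      by (simp add: eq[symmetric])
  qed (simp_all add: entire_iterate)
  then show ?thesis using that a by blast
qed

end


section \<open>The relation between the two maps\<close>

lemma funpow_comp_commute:
  assumes "f \<circ> g = g \<circ> f"
  shows "(f ^^ n) \<circ> g = g \<circ> (f ^^ n)"
proof (induction n)
  case (Suc n)
  have "(f ^^ Suc n) \<circ> g = f \<circ> ((f ^^ n) \<circ> g)" by (simp add: comp_assoc)
  also have "\<dots> = (f \<circ> g) \<circ> (f ^^ n)" unfolding Suc by (simp only: comp_assoc)
  also have "\<dots> = g \<circ> (f ^^ Suc n)" unfolding assms by (simp add: comp_assoc)
  finally show ?case .
qed simp

lemma funpow_comp_commute2: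
  assumes "f \<circ> g = g \<circ> f"
  shows "(f ^^ n) \<circ> (g ^^ m) = (g ^^ m) \<circ> (f ^^ n)"
  by (rule funpow_comp_commute, rule funpow_comp_commute[symmetric, of g f], rule assms[symmetric])

text \<open>
  The image is open in \<open>D\<close>, and it is closed in \<open>D\<close>, because a point of \<open>closure D\<close> that is mapped into \<open>D\<close>
  lies in \<open>D\<close>.
\<close>

lemma surjective_on_domain:
  assumes H: "H holomorphic_on UNIV" "\<not> H constant_on UNIV" and "H ` D \<subseteq> D"
    and D: "open D" "connected D" "bounded D" and boundary: "\<And>z. z \<in> frontier D \<Longrightarrow> H z \<notin> D"
  shows "H ` D = D"
proof (cases "D = {}")
  case False
  have "closedin (top_of_set D) (H ` D)"
    unfolding closedin_limpt
  proof (intro conjI allI impI)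
    fix y assume y: "y islimpt H ` D \<and> y \<in> D"
    have "y \<in> closure (H ` D)" using y by (simp add: closure_def)
    also have "\<dots> \<subseteq> H ` closure D"
    proof (rule closure_minimal)
      show "H ` D \<subseteq> H ` closure D" using closure_subset by blast
      have "compact (H ` closure D)"
        using D(3) holomorphic_on_imp_continuous_on[OF H(1)]
        by (intro compact_continuous_image) (auto intro: continuous_on_subset simp: compact_closure)
      then show "closed (H ` closure D)" by (rule compact_imp_closed)
    qed
    finally obtain x where x: "x \<in> closure D" "y = H x" by blast
    have "x \<in> D"
    proof (rule ccontr)
      assume "x \<notin> D"
      then have "x \<in> frontier D" using x(1) D(1) by (simp add: frontier_def interior_open)
      then show False using boundary x(2) y by blast
    qed
    then show "y \<in> H ` D" using x(2) by blast
  qed (rule assms(3))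
  moreover have "openin (top_of_set D) (H ` D)"
    using entire_open_image[OF H D(1)] assms(3) by (simp add: openin_open_eq D(1))
  ultimately have "H ` D = {} \<or> H ` D = D"
    using D(2) unfolding connected_clopen by blast
  then show ?thesis using False by blast
qed simp

context attracting_domain
begin

lemma linearized: obtains \<phi> where "linearized_domain G D \<alpha> lam \<phi>"
proof (rule Koenigs)
  fix \<phi> assume "\<phi> holomorphic_on D" "\<phi> \<alpha> = 0" "deriv \<phi> \<alpha> = 1" "\<And>z. z \<in> D \<Longrightarrow> \<phi> (G z) = lam * \<phi> z"
  then have "linearized_domain G D \<alpha> lam \<phi>" by unfold_locales auto
  then show thesis by (rule that)
qed

text \<open>
  Some \<open>K = G ^^ m \<circ> F\<close> fixes \<open>\<alpha>\<close>, is regular there and commutes with \<open>G\<close>; the alternatives yield free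
  pairs. From \<open>K ^^ a \<circ> G ^^ i = G ^^ l\<close> and \<open>K ^^ a = G ^^ (a * m) \<circ> F ^^ a\<close>, which uses that \<open>K\<close> and \<open>G\<close> commute,
  the relation follows with \<open>M = i + a * m\<close> and \<open>c = l - M\<close>.
\<close>

lemma iterates_eventually_agree:
  assumes F: "F holomorphic_on UNIV" "\<not> inj F" and FD: "F ` D \<subseteq> D"
    and boundary_F: "\<And>z. z \<in> frontier D \<Longrightarrow> F z \<notin> D" and no_free: "\<not> contains_free {F, G}"
  obtains M a c where "a \<ge> 1" "c \<ge> 1" "(G ^^ M) \<circ> (F ^^ a) = G ^^ (M + c)"
proof -
  obtain \<phi> where "linearized_domain G D \<alpha> lam \<phi>" using linearized .
  then interpret linearized_domain G D \<alpha> lam \<phi> .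
  have F_nc: "\<not> F constant_on UNIV"
  proof
    assume "F constant_on UNIV"
    then obtain c where c: "\<And>z. F z = c" unfolding constant_on_def by auto
    have "D \<noteq> UNIV" using bounded_D not_bounded_UNIV by metis
    then have "frontier D \<noteq> {}" using frontier_eq_empty \<alpha>_in_D by blast
    then obtain z where "z \<in> frontier D" by blast
    then show False using boundary_F[of z] c FD \<alpha>_in_D by (metis image_subset_iff)
  qed
  have F\<alpha>: "F \<alpha> \<in> D" using FD \<alpha>_in_D by blast
  have "\<phi> (F \<alpha>) = 0" using free_if_moves_off_fibre[OF F(1) F_nc F\<alpha>] no_free by blast
  obtain m where m: "(G ^^ m) (F \<alpha>) = \<alpha>"
  proof -
    obtain r where r: "0 < r" "cball \<alpha> r \<subseteq> D" "inj_on \<phi> (cball \<alpha> r)" using linear_ball by metis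
    obtain m where m: "(G ^^ m) (F \<alpha>) \<in> ball \<alpha> r"
      using enters_ball[OF F\<alpha> r(1)] .
    have "(G ^^ m) (F \<alpha>) = \<alpha>"
      by (rule inj_onD[OF r(3)]) (use \<phi>_iterate[OF F\<alpha>] \<open>\<phi> (F \<alpha>) = 0\<close> m r(1) in simp_all)
    then show ?thesis by (rule that)
  qed
  define K where "K = (G ^^ m) \<circ> F"
  have G_nc: "\<not> (G ^^ n) constant_on UNIV" for n by (rule entire_nonconstant_funpow[OF entire nonconstant])
  have K: "K holomorphic_on UNIV" "\<not> K constant_on UNIV" "K \<alpha> = \<alpha>"
    unfolding K_def using entire_comp[OF entire_iterate F(1)] entire_nonconstant_comp[OF entire_iterate F(1) G_nc F_nc] m
    by auto
  have KD: "K ` D \<subseteq> D" unfolding K_def using FD iterate_in_D by auto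
  have "K ` D = D"
  proof (rule surjective_on_domain[OF K(1,2) KD open_D connected_D bounded_D])
    fix z assume z: "z \<in> frontier D"
    have step: "G w \<in> closure D - D" if "G w \<in> closure D" "w \<in> closure D - D" for w
      using that boundary[of w] open_D by (simp add: frontier_def interior_open)
    have cl: "h w \<in> closure D" if h: "h holomorphic_on UNIV" "h ` D \<subseteq> D" and w: "w \<in> closure D" for h w
    proof -
      have "h ` closure D \<subseteq> closure D"
      proof (rule image_closure_subset)
        show "continuous_on (closure D) h" using holomorphic_on_imp_continuous_on[OF h(1)] continuous_on_subset by blast
        show "h ` D \<subseteq> closure D" using h(2) closure_subset by blast
      qed simp
      then show ?thesis using w by blast
    qed
    have zc: "z \<in> closure D" using z by (simp add: frontier_def)
    have "(G ^^ n) (F z) \<in> closure D - D" for n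
    proof (induction n)
      case 0
      show ?case using cl[OF F(1) FD zc] boundary_F[OF z] by simp
    next
      case (Suc n)
      then show ?case using step cl[OF entire G_D] by simp
    qed
    then show "K z \<notin> D" by (simp add: K_def)
  qed
  have gen: "F \<in> generated_semigroup {F, G}" "G \<in> generated_semigroup {F, G}"
    by (auto intro: generated_semigroup.generator)
  have "{K, G} \<subseteq> generated_semigroup {F, G}"
    unfolding K_def using gen funpow_comp_in_generated_semigroup[OF gen(2,1)] by blast
  then have no_free_K: "\<not> contains_free {K, G}" using contains_free_mono no_free by blast
  have K': "deriv K \<alpha> \<noteq> 0" using free_if_superattracting[OF K] no_free_K by blast
  have comm: "K \<circ> G = G \<circ> K" using free_if_not_commuting[OF K(1,3) K'] no_free_K by blast
  obtain a i l where a: "a \<ge> 1" and rel: "(K ^^ a) \<circ> (G ^^ i) = G ^^ l"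
    using iterates_coincide[OF K(1,3) \<open>K ` D = D\<close> comm K'] .
  have K_pow: "K ^^ n = (G ^^ (n * m)) \<circ> (F ^^ n)" for n
  proof (induction n)
    case (Suc n)
    have "K ^^ Suc n = K \<circ> (G ^^ (n * m)) \<circ> (F ^^ n)" by (simp only: funpow.simps(2) Suc comp_assoc)
    also have "K \<circ> (G ^^ (n * m)) = (G ^^ (n * m)) \<circ> K" using funpow_comp_commute2[OF comm, of 1] by simp
    also have "(G ^^ (n * m)) \<circ> K \<circ> (F ^^ n) = (G ^^ (n * m)) \<circ> (G ^^ m) \<circ> (F \<circ> (F ^^ n))"
      unfolding K_def by (simp only: comp_assoc)
    also have "\<dots> = (G ^^ (Suc n * m)) \<circ> (F ^^ Suc n)"
      by (simp only: funpow.simps(2) funpow_add[symmetric] mult_Suc add.commute)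
    finally show ?case .
  qed simp
  define M where "M = i + a * m"
  have rel': "(G ^^ M) \<circ> (F ^^ a) = G ^^ l"
  proof -
    have "G ^^ l = (G ^^ i) \<circ> (K ^^ a)" using rel funpow_comp_commute2[OF comm, of a i] by simp
    then show ?thesis by (simp only: K_pow M_def funpow_add comp_assoc)
  qed
  have "l > M"
  proof (rule ccontr)
    assume "\<not> l > M"
    \<comment> \<open>Here \<open>G ^^ l\<close> would be invariant under \<open>E\<close>, although \<open>F\<close>, and with it \<open>E\<close>, is not injective.\<close>
    define E where "E = (G ^^ (M - l)) \<circ> (F ^^ a)"
    have "M = l + (M - l)" using \<open>\<not> l > M\<close> by simp
    then have "(G ^^ l) \<circ> E = (G ^^ M) \<circ> (F ^^ a)" unfolding E_def by (metis comp_assoc funpow_add)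
    then have inv: "(G ^^ l) (E z) = (G ^^ l) z" for z using rel' by (metis o_apply)
    have FaD: "(F ^^ a) z \<in> D" if "z \<in> D" for z using that FD by (induction a) auto
    have "inj E"
    proof (rule inj_of_invariant_function[OF entire_iterate G_nc _ open_D _ bounded_D _ inv])
      show "E holomorphic_on UNIV" unfolding E_def by (rule entire_comp[OF entire_iterate entire_funpow[OF F(1)]])
      show "D \<noteq> {}" using \<alpha>_in_D by blast
      show "E ` D \<subseteq> D" unfolding E_def using FaD iterate_in_D by auto
    qed
    obtain a' where "a = Suc a'" using a by (cases a) auto
    then have "E = ((G ^^ (M - l)) \<circ> (F ^^ a')) \<circ> F" unfolding E_def by (metis comp_assoc funpow_Suc_right)
    then have "inj F" using \<open>inj E\<close> by (metis inj_on_imageI2)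
    then show False using F(2) by contradiction
  qed
  then have "(G ^^ M) \<circ> (F ^^ a) = G ^^ (M + (l - M))" "l - M \<ge> 1" using rel' by auto
  then show ?thesis using that a by blast
qed

end

section \<open>Preperiodic points\<close>

lemma preperiodic_point_iff_eventually:
  "z \<in> preperiodic_points f \<longleftrightarrow> (f ^^ m) z \<in> preperiodic_points f"
proof -
  have split: "range (\<lambda>n. (f ^^ n) z) = (\<lambda>n. (f ^^ n) z) ` {..<m} \<union> range (\<lambda>n. (f ^^ n) ((f ^^ m) z))"
  proof (intro set_eqI iffI)
    fix x assume "x \<in> range (\<lambda>n. (f ^^ n) z)"
    then obtain n where n: "x = (f ^^ n) z" by blast
    show "x \<in> (\<lambda>n. (f ^^ n) z) ` {..<m} \<union> range (\<lambda>n. (f ^^ n) ((f ^^ m) z))"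
    proof (cases "n < m")
      case False
      then have "n = (n - m) + m" by simp
      then have "x = (f ^^ (n - m)) ((f ^^ m) z)" using n by (metis funpow_add o_apply)
      then show ?thesis by blast
    qed (use n in blast)
  next
    fix x assume "x \<in> (\<lambda>n. (f ^^ n) z) ` {..<m} \<union> range (\<lambda>n. (f ^^ n) ((f ^^ m) z))"
    then consider n where "x = (f ^^ n) z" | n where "x = (f ^^ n) ((f ^^ m) z)" by blast
    then show "x \<in> range (\<lambda>n. (f ^^ n) z)"
    proof cases
      case (2 n)
      then have "x = (f ^^ (n + m)) z" by (simp add: funpow_add)
      then show ?thesis by blast
    qed blast
  qed
  show ?thesis unfolding preperiodic_points_def mem_Collect_eq split by simp
qed

lemma preperiodic_points_funpow:
  assumes "p \<ge> 1"
  shows "preperiodic_points (f ^^ p) = preperiodic_points f"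
proof (intro set_eqI iffI)
  fix z assume "z \<in> preperiodic_points f"
  then have "finite (range (\<lambda>n. (f ^^ n) z))" by (simp add: preperiodic_points_def)
  moreover have "range (\<lambda>n. ((f ^^ p) ^^ n) z) \<subseteq> range (\<lambda>n. (f ^^ n) z)"
    unfolding funpow_mult by blast
  ultimately show "z \<in> preperiodic_points (f ^^ p)"
    unfolding preperiodic_points_def by (simp add: finite_subset)
next
  fix z assume "z \<in> preperiodic_points (f ^^ p)"
  then have "finite (range (\<lambda>n. ((f ^^ p) ^^ n) z))" by (simp add: preperiodic_points_def)
  then have "finite (\<Union>r<p. (f ^^ r) ` range (\<lambda>n. ((f ^^ p) ^^ n) z))" by blast
  moreover have "range (\<lambda>n. (f ^^ n) z) \<subseteq> (\<Union>r<p. (f ^^ r) ` range (\<lambda>n. ((f ^^ p) ^^ n) z))"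
  proof
    fix x assume "x \<in> range (\<lambda>n. (f ^^ n) z)"
    then obtain n where n: "x = (f ^^ n) z" by blast
    have "n = n mod p + p * (n div p)" by simp
    then have "x = (f ^^ (n mod p)) (((f ^^ p) ^^ (n div p)) z)"
      unfolding funpow_mult n by (metis funpow_add o_apply)
    moreover have "n mod p < p" using assms by simp
    ultimately show "x \<in> (\<Union>r<p. (f ^^ r) ` range (\<lambda>n. ((f ^^ p) ^^ n) z))" by blast
  qed
  ultimately show "z \<in> preperiodic_points f"
    unfolding preperiodic_points_def by (simp add: finite_subset)
qed

lemma preperiodic_points_semiconjugate:
  assumes "P \<circ> f = g \<circ> P" and "z \<in> preperiodic_points f"
  shows "P z \<in> preperiodic_points g"
proof -
  have eq: "(g ^^ n) (P z) = P ((f ^^ n) z)" for n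
  proof (induction n)
    case (Suc n)
    then show ?case using assms(1) by (simp add: fun_eq_iff)
  qed simp
  have "finite (range (\<lambda>n. (f ^^ n) z))" using assms(2) by (simp add: preperiodic_points_def)
  then have "finite (P ` range (\<lambda>n. (f ^^ n) z))" by (rule finite_imageI)
  then show ?thesis by (simp add: preperiodic_points_def eq image_image)
qed

lemma preperiodic_points_subset:
  assumes "(g ^^ M) \<circ> (f ^^ a) = g ^^ (M + c)" and "a \<ge> 1" "c \<ge> 1"
  shows "preperiodic_points f \<subseteq> preperiodic_points g"
proof
  fix z assume "z \<in> preperiodic_points f"
  then have "z \<in> preperiodic_points (f ^^ a)" by (simp add: preperiodic_points_funpow[OF assms(2)])
  moreover have "(g ^^ M) \<circ> (f ^^ a) = (g ^^ c) \<circ> (g ^^ M)"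
    using assms(1) by (simp only: add.commute[of M] funpow_add)
  ultimately have "(g ^^ M) z \<in> preperiodic_points (g ^^ c)"
    using preperiodic_points_semiconjugate by metis
  then show "z \<in> preperiodic_points g"
    unfolding preperiodic_points_funpow[OF assms(3)] preperiodic_point_iff_eventually[symmetric] .
qed


section \<open>Exchanging the roles of the two maps\<close>

lemma deriv_funpow_fixed:
  assumes "f holomorphic_on UNIV" and "f a = a"
  shows "deriv (f ^^ n) a = deriv f a ^ n"
proof (induction n)
  case 0
  show ?case by (simp add: id_def)
next
  case (Suc n)
  have "(f ^^ n) a = a" using assms(2) by (induction n) auto
  then show ?case
    unfolding funpow.simps(2) entire_deriv_comp[OF assms(1) entire_funpow[OF assms(1)]] Suc by simp
qed

text \<open>
  If \<open>P\<close> has local degree \<open>s\<close> at \<open>b\<close>, comparing the leading coefficients in \<open>P \<circ> f = g \<circ> P\<close> gives the claim.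
  Translations move \<open>b\<close> to \<open>a\<close>, so that all maps involved fix one point.
\<close>

lemma semiconjugate_multiplier:
  assumes P: "P holomorphic_on UNIV" "\<not> P constant_on UNIV" and f: "f holomorphic_on UNIV" "\<not> f constant_on UNIV"
    and g: "g holomorphic_on UNIV" and semi: "P \<circ> f = g \<circ> P"
    and "f b = b" "P b = a" "g a = a" "deriv g a \<noteq> 0"
  obtains s where "s \<ge> 1" "deriv f b ^ s = deriv g a"
proof -
  define T where "T z = z + (b - a)" for z
  define T' where "T' z = z - (b - a)" for z :: complex
  have T: "T holomorphic_on UNIV" "T' holomorphic_on UNIV"
    unfolding T_def[abs_def] T'_def[abs_def] by (auto intro!: holomorphic_intros)
  have T_nc: "\<not> T constant_on UNIV" "\<not> T' constant_on UNIV"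
    unfolding T_def[abs_def] T'_def[abs_def] constant_on_def
    by (metis UNIV_I add_right_cancel zero_neq_one) (metis UNIV_I diff_add_cancel zero_neq_one)
  have Ta: "T a = b" "T' b = a" "T (T' z) = z" for z by (simp_all add: T_def T'_def)
  define Q where "Q = P \<circ> T"
  define F where "F = T' \<circ> (f \<circ> T)"
  have Q: "Q holomorphic_on UNIV" "\<not> Q constant_on UNIV" "Q a = a"
    unfolding Q_def using entire_comp[OF P(1) T(1)] entire_nonconstant_comp[OF P(1) T(1) P(2) T_nc(1)] assms(8) Ta by auto
  have fT: "f \<circ> T holomorphic_on UNIV" "\<not> (f \<circ> T) constant_on UNIV"
    using entire_comp[OF f(1) T(1)] entire_nonconstant_comp[OF f(1) T(1) f(2) T_nc(1)] by auto
  have F: "F holomorphic_on UNIV" "\<not> F constant_on UNIV" "F a = a"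
    unfolding F_def using entire_comp[OF T(2) fT(1)] entire_nonconstant_comp[OF T(2) fT(1) T_nc(2) fT(2)] assms(7) Ta by auto
  have QF: "Q \<circ> F = g \<circ> Q"
    using semi by (auto simp: Q_def F_def Ta fun_eq_iff)
  obtain s A where s: "s \<ge> 1" and lead_Q: "leading_term a Q s A" using leading_term_entire[OF Q] .
  obtain n B where n: "n \<ge> 1" and lead_F: "leading_term a F n B" using leading_term_entire[OF F] .
  have lead_g: "leading_term a g 1 (deriv g a)"
    using leading_term_1_iff[OF g assms(9)] assms(10) by simp
  have eq: "n * s = s * 1 \<and> A * B ^ s = deriv g a * A ^ 1"
    using leading_term_unique[OF leading_term_comp[OF lead_Q lead_F, unfolded QF] leading_term_comp[OF lead_g lead_Q]] .
  then have "n = 1" using s by simp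
  then have "deriv F a = B" using leading_term_1_iff[OF F(1,3)] lead_F by simp
  moreover have "deriv F a = deriv f b"
  proof (rule DERIV_imp_deriv)
    have "(f has_field_derivative deriv f b) (at (a + (b - a)))" using entire_DERIV[OF f(1), of b] by simp
    then have "((\<lambda>z. f (z + (b - a))) has_field_derivative deriv f b) (at a)"
      by (simp only: DERIV_shift)
    from DERIV_diff[OF this DERIV_const[of "b - a"]]
    have "((\<lambda>z. f (z + (b - a)) - (b - a)) has_field_derivative deriv f b) (at a)" by simp
    then show "(F has_field_derivative deriv f b) (at a)" by (simp add: F_def T_def[abs_def] T'_def o_def)
  qed
  moreover have "A \<noteq> 0" using lead_Q by (simp add: leading_term_def)
  then have "B ^ s = deriv g a" using eq by simp
  ultimately show ?thesis using that s by simp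
qed

text \<open>
  By the relation, \<open>P = G ^^ M\<close> semiconjugates \<open>F1 = F ^^ a\<close> to \<open>G ^^ c\<close>. So \<open>F1\<close> maps the finite set of points of
  \<open>D\<close> that \<open>P\<close> sends to \<open>\<alpha>\<close> into itself, the orbit of \<open>\<alpha>\<close> under \<open>F1\<close> runs into a cycle, and an iterate \<open>F2\<close> of \<open>F1\<close> has a fixed
  point \<open>\<beta>\<close> with \<open>P \<beta> = \<alpha>\<close>. A power of the multiplier at \<open>\<beta>\<close> equals \<open>lam ^ (c * k)\<close>, so \<open>\<beta>\<close> is attracting but not
  superattracting, and \<open>F2\<close> can take the place of \<open>G\<close>.
\<close>

lemma preperiodic_points_eq_self_maps:
  assumes "attracting_domain G D \<alpha> lam"
    and F: "F holomorphic_on UNIV" "\<not> inj F" "F ` D \<subseteq> D" and "\<not> inj G"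
    and boundary_iter: "\<And>n z. z \<in> frontier D \<Longrightarrow> (F ^^ n) z \<notin> D"
    and no_free: "\<not> contains_free {F, G}"
  shows "preperiodic_points F = preperiodic_points G"
proof
  interpret attracting_domain G D \<alpha> lam by fact
  obtain M a c where a: "a \<ge> 1" and c: "c \<ge> 1" and rel: "(G ^^ M) \<circ> (F ^^ a) = G ^^ (M + c)"
    using iterates_eventually_agree[OF F boundary_iter[of _ 1, simplified] no_free] .
  show "preperiodic_points F \<subseteq> preperiodic_points G" by (rule preperiodic_points_subset[OF rel a c])
  define P where "P = G ^^ M"
  define F1 where "F1 = F ^^ a"
  have P: "P holomorphic_on UNIV" "\<not> P constant_on UNIV"
    unfolding P_def using entire_iterate entire_nonconstant_funpow[OF entire nonconstant] by auto
  have semi: "P \<circ> F1 = (G ^^ c) \<circ> P"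
    using rel unfolding P_def F1_def by (simp only: add.commute[of M] funpow_add)
  have F1_D: "(F1 ^^ n) z \<in> D" if "z \<in> D" for n z
  proof -
    have "(F ^^ k) z \<in> D" for k using that F(3) by (induction k) auto
    then show ?thesis unfolding F1_def funpow_mult by blast
  qed
  have semi_iter: "P \<circ> (F1 ^^ n) = (G ^^ (c * n)) \<circ> P" for n
  proof (induction n)
    case (Suc n)
    have "P \<circ> (F1 ^^ Suc n) = (P \<circ> F1) \<circ> (F1 ^^ n)" by (simp only: funpow.simps(2) comp_assoc)
    also have "\<dots> = (G ^^ c) \<circ> (P \<circ> (F1 ^^ n))" unfolding semi by (simp only: comp_assoc)
    also have "\<dots> = (G ^^ (c * Suc n)) \<circ> P" unfolding Suc by (simp only: mult_Suc_right funpow_add comp_assoc)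
    finally show ?case .
  qed simp
  have P\<alpha>: "P \<alpha> = \<alpha>" by (simp add: P_def)
  have fibre: "P ((F1 ^^ n) \<alpha>) = \<alpha>" for n
    using fun_cong[OF semi_iter[of n], of \<alpha>] P\<alpha> by simp
  have "finite (range (\<lambda>n. (F1 ^^ n) \<alpha>))"
    by (rule finite_subset[OF _ entire_finite_fibre[OF P bounded_D, of \<alpha>]]) (use fibre F1_D[OF \<alpha>_in_D] in auto)
  then have "\<not> inj (\<lambda>n. (F1 ^^ n) \<alpha>)" using finite_imageD by blast
  then obtain i j where ij: "i < j" "(F1 ^^ i) \<alpha> = (F1 ^^ j) \<alpha>"
    unfolding inj_on_def by (metis linorder_neqE_nat)
  define \<beta> where "\<beta> = (F1 ^^ i) \<alpha>"
  define k where "k = j - i"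
  have k: "k \<ge> 1" using ij by (simp add: k_def)
  define F2 where "F2 = F1 ^^ k"
  have F2_\<beta>: "F2 \<beta> = \<beta>"
  proof -
    have "(F1 ^^ k) ((F1 ^^ i) \<alpha>) = (F1 ^^ (k + i)) \<alpha>" by (simp add: funpow_add)
    then show ?thesis using ij by (simp add: F2_def \<beta>_def k_def)
  qed
  have F2_eq: "F2 = F ^^ (a * k)" unfolding F2_def F1_def by (simp add: funpow_mult)
  have ak: "a * k \<ge> 1" using a k by simp
  have F_nc: "\<not> F2 constant_on UNIV"
  proof
    assume "F2 constant_on UNIV"
    then have "(P \<circ> F2) constant_on UNIV" unfolding constant_on_def by auto
    then have "((G ^^ (c * k)) \<circ> P) constant_on UNIV" unfolding F2_def semi_iter .
    then show False
      using entire_nonconstant_comp[OF entire_iterate P(1) entire_nonconstant_funpow[OF entire nonconstant] P(2)] by blast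
  qed
  have F2: "F2 holomorphic_on UNIV" unfolding F2_eq by (rule entire_funpow[OF F(1)])
  have dG: "deriv (G ^^ (c * k)) \<alpha> = lam ^ (c * k)" using deriv_funpow_fixed[OF entire fixed] deriv_G by simp
  obtain s where s: "s \<ge> 1" "deriv F2 \<beta> ^ s = lam ^ (c * k)"
  proof (rule semiconjugate_multiplier[OF P F2 F_nc entire_iterate _ F2_\<beta>])
    show "P \<circ> F2 = (G ^^ (c * k)) \<circ> P" unfolding F2_def by (rule semi_iter)
    show "P \<beta> = \<alpha>" unfolding \<beta>_def by (rule fibre)
    show "deriv (G ^^ (c * k)) \<alpha> \<noteq> 0" using dG lam_nonzero by simp
  qed (use dG in auto)
  have F2_regular: "deriv F2 \<beta> \<noteq> 0" using s lam_nonzero by (metis not_one_le_zero power_not_zero zero_power neq0_conv)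
  have F2_contracts: "norm (deriv F2 \<beta>) < 1"
  proof (rule ccontr)
    assume "\<not> norm (deriv F2 \<beta>) < 1"
    then have "1 \<le> norm (deriv F2 \<beta> ^ s)" by (simp add: norm_power one_le_power)
    moreover have "norm (lam ^ (c * k)) < 1"
      using lam_less_1 c k by (simp add: norm_power power_less_one_iff)
    ultimately show False unfolding s(2) by simp
  qed
  interpret F2: attracting_domain F2 D \<beta> "deriv F2 \<beta>"
  proof
    show "\<beta> \<in> D" unfolding \<beta>_def by (rule F1_D[OF \<alpha>_in_D])
    show "F2 ` D \<subseteq> D" unfolding F2_def using F1_D by blast
    show "F2 z \<notin> D" if "z \<in> frontier D" for z unfolding F2_eq by (rule boundary_iter[OF that])
  qed (rule F2 open_D connected_D bounded_D F2_\<beta> refl F2_regular F2_contracts)+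
  have no_free_2: "\<not> contains_free {G, F2}"
  proof
    assume "contains_free {G, F2}"
    moreover have "{G, F2} \<subseteq> generated_semigroup {F, G}"
      unfolding F2_eq using funpow_in_generated_semigroup[OF generated_semigroup.generator ak, of F "{F, G}"]
        generated_semigroup.generator[of G "{F, G}"] by blast
    ultimately show False using contains_free_mono no_free by blast
  qed
  obtain M' a' c' where a': "a' \<ge> 1" "c' \<ge> 1" and rel': "(F2 ^^ M') \<circ> (G ^^ a') = F2 ^^ (M' + c')"
    using F2.iterates_eventually_agree[OF entire \<open>\<not> inj G\<close> G_D boundary no_free_2] .
  have "preperiodic_points G \<subseteq> preperiodic_points F2" by (rule preperiodic_points_subset[OF rel' a'])
  then show "preperiodic_points G \<subseteq> preperiodic_points F"
    unfolding F2_eq preperiodic_points_funpow[OF ak] .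
qed


section \<open>Bounded periodic Fatou components\<close>

lemma open_fatou_set: "open (fatou_set f)"
proof (subst open_subopen, rule ballI)
  fix z assume "z \<in> fatou_set f"
  then obtain U where U: "open U" "connected U" "z \<in> U" "normal_on (range (\<lambda>n. f ^^ n)) U"
    unfolding fatou_set_def by blast
  then have "U \<subseteq> fatou_set f" unfolding fatou_set_def by blast
  then show "\<exists>T. open T \<and> z \<in> T \<and> T \<subseteq> fatou_set f" using U by blast
qed

text \<open>
  Near \<open>z\<close>, a sequence of iterates of positive order is a sequence of iterates near \<open>f z\<close> composed with
  \<open>f\<close>, and \<open>f\<close> maps compact sets to compact sets. If the order is \<open>0\<close> infinitely often, the identity is the limit of a subsequence.
\<close>

lemma fatou_set_preimage:
  assumes f: "f holomorphic_on UNIV" and "f z \<in> fatou_set f"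
  shows "z \<in> fatou_set f"
proof -
  obtain U where U: "open U" "f z \<in> U" "normal_on (range (\<lambda>n. f ^^ n)) U"
    using assms(2) unfolding fatou_set_def by blast
  have "open (f -` U)" using U(1) entire_isCont[OF f] by (intro continuous_open_vimage) auto
  then obtain e where e: "0 < e" "ball z e \<subseteq> f -` U" using U(2) open_contains_ball by blast
  have "normal_on (range (\<lambda>n. f ^^ n)) (ball z e)"
    unfolding normal_on_def
  proof (intro allI impI)
    fix h :: "nat \<Rightarrow> complex \<Rightarrow> complex" assume "range h \<subseteq> range (\<lambda>n. f ^^ n)"
    then have "\<forall>n. \<exists>k. h n = f ^^ k" by blast
    then obtain k where k: "\<And>n. h n = f ^^ k n" by metis
    show "\<exists>r. strict_mono r \<and>
        ((\<exists>l. \<forall>K. compact K \<and> K \<subseteq> ball z e \<longrightarrow> uniform_limit K (h \<circ> r) l sequentially) \<or>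
         (\<forall>K. compact K \<and> K \<subseteq> ball z e \<longrightarrow>
            (\<forall>B. \<forall>\<^sub>F n in sequentially. \<forall>z\<in>K. B < norm (h (r n) z))))"
    proof (cases "\<exists>\<^sub>\<infinity>n. k n = 0")
      case True
      then obtain r :: "nat \<Rightarrow> nat" where r: "strict_mono r" "\<And>n. k (r n) = 0"
        using infinite_enumerate[of "{n. k n = 0}"] by (auto simp: INFM_iff_infinite)
      have "uniform_limit K (h \<circ> r) id sequentially" for K
        unfolding uniform_limit_iff by (simp add: k r(2) o_def)
      then show ?thesis using r(1) by blast
    next
      case False
      then obtain N where N: "\<And>n. n \<ge> N \<Longrightarrow> k n \<noteq> 0"
        by (auto simp: INFM_nat_le)
      define h' where "h' n = f ^^ (k (n + N) - 1)" for n
      have hh': "h (n + N) = h' n \<circ> f" for n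
      proof -
        have "k (n + N) \<noteq> 0" using N[of "n + N"] by simp
        then obtain m where "k (n + N) = Suc m" using not0_implies_Suc by blast
        then show ?thesis by (simp add: k h'_def funpow_Suc_right del: funpow.simps(2))
      qed
      have "range h' \<subseteq> range (\<lambda>n. f ^^ n)" unfolding h'_def by blast
      then obtain r :: "nat \<Rightarrow> nat" where r: "strict_mono r" and
        alt: "(\<exists>l. \<forall>K. compact K \<and> K \<subseteq> U \<longrightarrow> uniform_limit K (h' \<circ> r) l sequentially) \<or>
         (\<forall>K. compact K \<and> K \<subseteq> U \<longrightarrow> (\<forall>B. \<forall>\<^sub>F n in sequentially. \<forall>z\<in>K. B < norm (h' (r n) z)))"
        using U(3) unfolding normal_on_def by blast
      define r' where "r' n = r n + N" for n
      have r': "strict_mono r'" using r by (simp add: r'_def strict_mono_def)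
      have im: "compact (f ` K)" "f ` K \<subseteq> U" if "compact K" "K \<subseteq> ball z e" for K
      proof -
        show "compact (f ` K)"
          using that(1) holomorphic_on_imp_continuous_on[OF f]
          by (intro compact_continuous_image) (auto intro: continuous_on_subset)
        show "f ` K \<subseteq> U" using that(2) e(2) by blast
      qed
      from alt show ?thesis
      proof
        assume "\<exists>l. \<forall>K. compact K \<and> K \<subseteq> U \<longrightarrow> uniform_limit K (h' \<circ> r) l sequentially"
        then obtain l where l: "\<And>K. compact K \<Longrightarrow> K \<subseteq> U \<Longrightarrow> uniform_limit K (h' \<circ> r) l sequentially" by blast
        have "uniform_limit K (h \<circ> r') (l \<circ> f) sequentially" if "compact K" "K \<subseteq> ball z e" for K
          using l[OF im[OF that]] unfolding uniform_limit_iff by (simp add: r'_def hh' o_def)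
        then show ?thesis using r' by blast
      next
        assume "\<forall>K. compact K \<and> K \<subseteq> U \<longrightarrow> (\<forall>B. \<forall>\<^sub>F n in sequentially. \<forall>z\<in>K. B < norm (h' (r n) z))"
        then have l: "\<And>K B. compact K \<Longrightarrow> K \<subseteq> U \<Longrightarrow> \<forall>\<^sub>F n in sequentially. \<forall>z\<in>K. B < norm (h' (r n) z)" by blast
        have "\<forall>\<^sub>F n in sequentially. \<forall>z\<in>K. B < norm (h (r' n) z)" if "compact K" "K \<subseteq> ball z e" for K B
          using l[OF im[OF that], of B] by (simp add: r'_def hh')
        then show ?thesis using r' by blast
      qed
    qed
  qed
  then show ?thesis
    unfolding fatou_set_def mem_Collect_eq using e(1) by (intro exI[of _ "ball z e"]) simp
qed

lemma fatou_component_boundary: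
  assumes "f holomorphic_on UNIV" and D: "fatou_component f D" and z: "z \<in> frontier D"
  shows "(f ^^ n) z \<notin> D"
proof
  assume "(f ^^ n) z \<in> D"
  have comp: "D \<in> components (fatou_set f)" using D by (simp add: fatou_component_def)
  have "(f ^^ n) z \<in> fatou_set f" using \<open>(f ^^ n) z \<in> D\<close> in_components_subset[OF comp] by blast
  then have "z \<in> fatou_set f"
  proof (induction n)
    case (Suc n)
    then show ?case using fatou_set_preimage[OF assms(1), of "(f ^^ n) z"] by simp
  qed simp
  then obtain e where e: "0 < e" "ball z e \<subseteq> fatou_set f" using open_fatou_set open_contains_ball by blast
  have "z \<in> closure D" "z \<notin> D"
    using z open_components[OF open_fatou_set comp] by (auto simp: frontier_def interior_open)
  then obtain y where y: "y \<in> D" "dist y z < e" using e(1) closure_approachable by blast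
  have "ball z e \<subseteq> D"
  proof (rule components_maximal[OF comp connected_ball e(2)])
    show "D \<inter> ball z e \<noteq> {}" using y by (auto simp: dist_commute)
  qed
  moreover have "z \<in> ball z e" using e(1) by simp
  ultimately show False using \<open>z \<notin> D\<close> by blast
qed

lemma not_inj_funpow:
  fixes f :: "'a \<Rightarrow> 'a"
  assumes "\<not> inj f" "n \<ge> 1"
  shows "\<not> inj (f ^^ n)"
proof -
  obtain m where "n = Suc m" using assms(2) by (cases n) auto
  then have "f ^^ n = (f ^^ m) \<circ> f" by (simp add: funpow_Suc_right del: funpow.simps)
  then show ?thesis using assms(1) by (metis inj_on_imageI2)
qed

text \<open>
  The exponent \<open>n\<close> is a multiple both of the exact period of the attracting point and of a period of \<open>D\<close>.
\<close>

lemma attracting_component_iterate: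
  assumes g: "g holomorphic_on UNIV" and bd: "bounded D" and att: "attracting_not_superattracting g D"
  obtains n \<alpha> where "n \<ge> 1" "attracting_domain (g ^^ n) D \<alpha> (deriv (g ^^ n) \<alpha>)"
proof -
  obtain q where q: "q \<ge> 1" "(g ^^ q) ` D \<subseteq> D" and comp: "fatou_component g D"
    using att unfolding attracting_not_superattracting_def periodic_fatou_component_def by blast
  obtain \<alpha> where \<alpha>: "\<alpha> \<in> D" "periodic_point g \<alpha>" "norm (multiplier g \<alpha>) < 1" "multiplier g \<alpha> \<noteq> 0"
    using att unfolding attracting_not_superattracting_def attracting_periodic_point_def by blast
  define e where "e = exact_period g \<alpha>"
  have e: "e \<ge> 1 \<and> (g ^^ e) \<alpha> = \<alpha>"
    unfolding e_def exact_period_def using \<alpha>(2) unfolding periodic_point_def by (rule LeastI_ex)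
  define n where "n = e * q"
  have n: "n \<ge> 1" using e q by (simp add: n_def)
  have n_eq: "g ^^ n = (g ^^ e) ^^ q" "g ^^ n = (g ^^ q) ^^ e" by (simp_all add: n_def funpow_mult mult.commute)
  have deriv_n: "deriv (g ^^ n) \<alpha> = multiplier g \<alpha> ^ q"
    unfolding n_eq(1) using deriv_funpow_fixed[OF entire_funpow[OF g]] e by (simp add: multiplier_def e_def)
  have comp': "D \<in> components (fatou_set g)" using comp by (simp add: fatou_component_def)
  have "attracting_domain (g ^^ n) D \<alpha> (deriv (g ^^ n) \<alpha>)"
  proof
    show "(g ^^ n) ` D \<subseteq> D"
    proof -
      have "((g ^^ q) ^^ k) z \<in> D" if "z \<in> D" for k z using that q(2) by (induction k) auto
      then show ?thesis unfolding n_eq(2) by blast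
    qed
    show "(g ^^ n) \<alpha> = \<alpha>" unfolding n_eq(1) using e by (induction q) auto
    show "deriv (g ^^ n) \<alpha> \<noteq> 0" unfolding deriv_n using \<alpha>(4) by simp
    show "norm (deriv (g ^^ n) \<alpha>) < 1"
      unfolding deriv_n norm_power using \<alpha>(3) q(1) by (simp add: power_less_one_iff)
  qed (use entire_funpow[OF g] open_components[OF open_fatou_set comp'] in_components_connected[OF comp'] bd \<alpha>(1)
      fatou_component_boundary[OF g comp] in auto)
  then show ?thesis using that n by blast
qed

theorem corollary12:
  fixes f g :: "complex \<Rightarrow> complex" and D :: "complex set"
  assumes "f holomorphic_on UNIV" and "g holomorphic_on UNIV"
    and "\<not> inj f" and "\<not> inj g"
    and "bounded D"
    and "periodic_fatou_component f D" and "periodic_fatou_component g D"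
    and "attracting_not_superattracting g D"
    and "\<not> (\<exists>T. subsemigroup T (generated_semigroup {f, g}) \<and> free_noncyclic_semigroup T)"
  shows "preperiodic_points f = preperiodic_points g"
proof -
  obtain n \<alpha> where n: "n \<ge> 1" and att: "attracting_domain (g ^^ n) D \<alpha> (deriv (g ^^ n) \<alpha>)"
    using attracting_component_iterate[OF assms(2,5,8)] .
  obtain p where p: "p \<ge> 1" "(f ^^ p) ` D \<subseteq> D" and comp: "fatou_component f D"
    using assms(6) unfolding periodic_fatou_component_def by blast
  have "preperiodic_points (f ^^ p) = preperiodic_points (g ^^ n)"
  proof (rule preperiodic_points_eq_self_maps[OF att entire_funpow[OF assms(1)] not_inj_funpow[OF assms(3) p(1)] p(2)
        not_inj_funpow[OF assms(4) n]])
    show "((f ^^ p) ^^ k) z \<notin> D" if "z \<in> frontier D" for k z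
      unfolding funpow_mult by (rule fatou_component_boundary[OF assms(1) comp that])
    show "\<not> contains_free {f ^^ p, g ^^ n}"
    proof
      assume "contains_free {f ^^ p, g ^^ n}"
      moreover have "{f ^^ p, g ^^ n} \<subseteq> generated_semigroup {f, g}"
        using funpow_in_generated_semigroup[OF generated_semigroup.generator p(1), of f "{f, g}"]
          funpow_in_generated_semigroup[OF generated_semigroup.generator n, of g "{f, g}"] by simp
      ultimately have "contains_free {f, g}" by (rule contains_free_mono[rotated])
      then show False using assms(9) unfolding contains_free_def by contradiction
    qed
  qed
  then show ?thesis
    by (simp only: preperiodic_points_funpow[OF p(1)] preperiodic_points_funpow[OF n])
qed

end
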